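(* Let $B_n=\{\beta_1<\beta_2<\dots<\beta_{N_n}\}$ be such that $\beta_1>1$ is fixed and $\beta_{N_n}\to\infty$ as $n\to\infty$. Let $C,L>0$ and let $x\in B_1$ be the fixed point at which the pointwise risk $E_f(\hat f_n(x)-f(x))^2$ is measured. Then: 1. There exists no optimal adaptive estimator over the scale of classes $H(\beta,C)\cap B(L)$, $\beta\in B_n$; that is, with $\phi_{n,\beta}=n^{-\frac{\beta-1}{2\beta+1}}$ (the minimax optimal rate for known $\beta$), there is no estimator $f^*$ independent of $\beta$ such that $$\limsup_{n\to\infty}\sup_{\beta\in B_n}\sup_{f\in H(\beta,C)\cap B(L)}\phi_{n,\beta}^{-2}\,E_f(f^*(x)-f(x))^2<\infty .$$ 2. The rate $\psi_{n,\beta}=\Big(\dfrac{\log n}{n}\Big)^{\frac{\beta-1}{2\beta+1}}$ is an adaptive rate of convergence (ARC) on the scale $H(\beta,C)\cap B(L)$, $\beta\in B_n$, in the sense defined in the context.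
   Context: **Model.** $B_1=\{x\in\mathbb R^2:\|x\|\le 1\}$. For $L>0$, $B(L)$ is the class of functions $f:\mathbb R^2\to\mathbb R$ supported in $B_1$, continuous a.e., with $|f(x)|\le L$. The Sobolev ball $H(\beta,C)$ is the set of $f$ with $\int_{\mathbb R^2}(1+\|\xi\|^2)^\beta|\widetilde f(\xi)|^2\,d\xi\le C$, $\widetilde f$ being the Fourier transform of $f$. Let $\mathrm S^1$ be the unit circle in $\mathbb R^2$, $Z=\mathrm S^1\times[-1,1]$, $\mu\in\mathbb R$ a fixed constant, and for $\theta\in \mathrm S^1$ let $\theta^\perp$ be the unit vector perpendicular to $\theta$ (with a fixed choice of orientation). The exponential Radon transform of $f\in B(L)$ is $$T_\mu f(\theta,s)=\int_{x\cdot\theta=s}e^{\mu x\cdot\theta^\perp}f(x)\,dx,\qquad(\theta,s)\in Z$$ (integration with respect to arc length on the line). One observes $(\theta_i,s_i,Y_i)$, $i=1,\dots,n$, with $Y_i=T_\mu f(\theta_i,s_i)+\epsilon_i$, where the $(\theta_i,s_i)$ are i.i.d. uniform on $Z$, and the noise variables $\epsilon_i$ are i.i.d. $N(0,\sigma^2)$, $0<\sigma^2<\infty$, independent of the design points. $E_f$ denotes expectation under the joint law of $(\theta_i,s_i,Y_i)_{i\le n}$. An estimator is a measurable function of the data $(\theta_i,s_i,Y_i)_{i\le n}$ (more precisely, a sequence of such in $n$); an adaptive estimator is one not depending on $\beta$. **Scale.** $\beta_1<\beta_2<\cdots$ is a fixed sequence and $B_n$ consists of its first $N_n$ terms. **Adaptive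 rate of convergence.** A positive sequence $\psi_{n,\beta}$ is an ARC on the scale $H(\beta,C)\cap B(L)$, $\beta\in B_n$, if: (a) there is an adaptive estimator $f^*(x)$, independent of $\beta$, with $$\limsup_{n\to\infty}\sup_{\beta\in B_n}\sup_{f\in H(\beta,C)\cap B(L)}\psi_{n,\beta}^{-2}E_f(f^*(x)-f(x))^2<\infty;$$ (b) if there are another positive sequence $\gamma_{n,\beta}$ and another adaptive estimator $f^{**}(x)$ with $$\limsup_{n\to\infty}\sup_{\beta\in B_n}\sup_{f\in H(\beta,C)\cap B(L)}\gamma_{n,\beta}^{-2}E_f(f^{**}(x)-f(x))^2<\infty,$$ and a $\beta'$ in the scale such that $\gamma_{n,\beta'}/\psi_{n,\beta'}\to0$ as $n\to\infty$, then there exists a $\beta''$ in the scale such that $$\frac{\gamma_{n,\beta'}}{\psi_{n,\beta'}}\cdot\frac{\gamma_{n,\beta''}}{\psi_{n,\beta''}}\to\infty\quad\text{as } n\to\infty .$$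
   Formalization: The point x is taken in the open disc (‖x‖<1), and the functions f in H(β,C)∩B(L) are taken to be continuous everywhere (the continuous representative), since the claim fails for ‖x‖=1 and for functions that are only continuous a.e. *)

theory Defs
  imports "HOL-Probability.Probability"
begin

text \<open>The counterclockwise orientation is fixed; the other one amounts to replacing
  \<open>\<mu>\<close> by \<open>- \<mu>\<close>.\<close>

definition perp :: "real ^ 2 \<Rightarrow> real ^ 2" where
  "perp \<theta> = vector [- (\<theta> $ 2), \<theta> $ 1]"

text \<open>For a unit vector \<open>\<theta>\<close>, the map \<open>t \<mapsto> s \<theta> + t \<theta>\<^sup>\<bottom>\<close> is the
  arc length parametrization of the line \<open>{y. y \<bullet> \<theta> = s}\<close>.\<close>

definition exp_radon :: "real \<Rightarrow> (real ^ 2 \<Rightarrow> real) \<Rightarrow> real ^ 2 \<Rightarrow> real \<Rightarrow> real" where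
  "exp_radon \<mu> f \<theta> s =
     (LINT t|lborel. (let y = s *\<^sub>R \<theta> + t *\<^sub>R perp \<theta> in exp (\<mu> * (y \<bullet> perp \<theta>)) * f y))"

text \<open>Unnormalized Fourier transform. Another constant factor in front of the integral
  only rescales the radius \<open>C\<close> of the Sobolev balls below.\<close>

definition fourier :: "(real ^ 2 \<Rightarrow> real) \<Rightarrow> real ^ 2 \<Rightarrow> complex" where
  "fourier f \<xi> = (LINT y|lborel. complex_of_real (f y) * cis (- (y \<bullet> \<xi>)))"

text \<open>Integrability makes the Bochner integral in \<open>fourier\<close> meaningful (otherwise it would
  be \<open>0\<close> by convention); the almost everywhere continuous, bounded, compactly supported
  functions of \<open>bounded_class\<close> are Lebesgue integrable in any case.\<close>

definition sobolev_ball :: "real \<Rightarrow> real \<Rightarrow> (real ^ 2 \<Rightarrow> real) set" where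
  "sobolev_ball \<beta> C =
     {f. integrable lborel f \<and>
         (\<integral>\<^sup>+ \<xi>. ennreal ((1 + (norm \<xi>)\<^sup>2) powr \<beta> * (cmod (fourier f \<xi>))\<^sup>2) \<partial>lborel) \<le> ennreal C}"

definition bounded_class :: "real \<Rightarrow> (real ^ 2 \<Rightarrow> real) set" where
  "bounded_class L =
     {f. (\<forall>y. f y \<noteq> 0 \<longrightarrow> norm y \<le> 1) \<and> (AE y in lborel. isCont f y) \<and> (\<forall>y. \<bar>f y\<bar> \<le> L)}"

text \<open>Sobolev functions are determined only up to null sets, whereas the pointwise risk refers
  to the value at a point. For \<open>\<beta> > 1\<close> (half the dimension) each of them agrees almost
  everywhere with exactly one continuous function, which is the representative meant here.\<close>

definition smooth_class :: "real \<Rightarrow> real \<Rightarrow> real \<Rightarrow> (real ^ 2 \<Rightarrow> real) set" where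
  "smooth_class C L \<beta> = {f \<in> sobolev_ball \<beta> C \<inter> bounded_class L. continuous_on UNIV f}"

definition circle_uniform :: "(real ^ 2) measure" where
  "circle_uniform =
     distr (uniform_measure lborel {0..2 * pi}) borel (\<lambda>a. vector [cos a, sin a])"

definition design_law :: "((real ^ 2) \<times> real) measure" where
  "design_law = circle_uniform \<Otimes>\<^sub>M uniform_measure lborel {-1..1}"

definition noise_law :: "real \<Rightarrow> real measure" where
  "noise_law \<sigma> = density lborel (\<lambda>e. ennreal (normal_density 0 \<sigma> e))"

type_synonym observation = "(real ^ 2) \<times> real \<times> real"

definition observation_law :: "real \<Rightarrow> real \<Rightarrow> (real ^ 2 \<Rightarrow> real) \<Rightarrow> observation measure" where
  "observation_law \<mu> \<sigma> f =
     distr (design_law \<Otimes>\<^sub>M noise_law \<sigma>) borel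
       (\<lambda>((\<theta>, s), e). (\<theta>, s, exp_radon \<mu> f \<theta> s + e))"

definition data_law ::
  "real \<Rightarrow> real \<Rightarrow> nat \<Rightarrow> (real ^ 2 \<Rightarrow> real) \<Rightarrow> (nat \<Rightarrow> observation) measure" where
  "data_law \<mu> \<sigma> n f = (\<Pi>\<^sub>M i\<in>{1..n}. observation_law \<mu> \<sigma> f)"

text \<open>\<open>F n d\<close> is the estimated function for the sample \<open>d\<close> of size \<open>n\<close>.
  Adaptivity means that \<open>F\<close> has no smoothness argument.\<close>

type_synonym estimator = "nat \<Rightarrow> (nat \<Rightarrow> observation) \<Rightarrow> real ^ 2 \<Rightarrow> real"

definition adaptive_estimator :: "estimator \<Rightarrow> bool" where
  "adaptive_estimator F \<longleftrightarrow>
     (\<forall>n y. (\<lambda>d. F n d y) \<in> borel_measurable (\<Pi>\<^sub>M i\<in>{1..n}. (borel :: observation measure)))"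

definition risk ::
  "real \<Rightarrow> real \<Rightarrow> real ^ 2 \<Rightarrow> estimator \<Rightarrow> nat \<Rightarrow> (real ^ 2 \<Rightarrow> real) \<Rightarrow> ennreal" where
  "risk \<mu> \<sigma> x F n f = (\<integral>\<^sup>+ d. ennreal ((F n d x - f x)\<^sup>2) \<partial>data_law \<mu> \<sigma> n f)"

definition attains_rate ::
  "real \<Rightarrow> real \<Rightarrow> real \<Rightarrow> real \<Rightarrow> real ^ 2 \<Rightarrow> (nat \<Rightarrow> real set) \<Rightarrow>
   (nat \<Rightarrow> real \<Rightarrow> real) \<Rightarrow> estimator \<Rightarrow> bool" where
  "attains_rate \<mu> \<sigma> C L x B \<psi> F \<longleftrightarrow>
     limsup (\<lambda>n. SUP \<beta>\<in>B n. SUP f\<in>smooth_class C L \<beta>.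
               ennreal (1 / (\<psi> n \<beta>)\<^sup>2) * risk \<mu> \<sigma> x F n f) < \<infinity>"

text \<open>Positivity is required for large \<open>n\<close> only, since \<open>ln n / n\<close> vanishes at \<open>n = 1\<close>.\<close>

definition positive_rate :: "(nat \<Rightarrow> real set) \<Rightarrow> (nat \<Rightarrow> real \<Rightarrow> real) \<Rightarrow> bool" where
  "positive_rate B \<psi> \<longleftrightarrow> (\<forall>\<^sub>F n in sequentially. \<forall>\<beta>\<in>B n. \<psi> n \<beta> > 0)"

definition ARC ::
  "real \<Rightarrow> real \<Rightarrow> real \<Rightarrow> real \<Rightarrow> real ^ 2 \<Rightarrow> (nat \<Rightarrow> real set) \<Rightarrow>
   (nat \<Rightarrow> real \<Rightarrow> real) \<Rightarrow> bool" where
  "ARC \<mu> \<sigma> C L x B \<psi> \<longleftrightarrow>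
     positive_rate B \<psi> \<and>
     (\<exists>F. adaptive_estimator F \<and> attains_rate \<mu> \<sigma> C L x B \<psi> F) \<and>
     (\<forall>\<gamma> G. positive_rate B \<gamma> \<and> adaptive_estimator G \<and> attains_rate \<mu> \<sigma> C L x B \<gamma> G \<longrightarrow>
        (\<forall>\<beta>'\<in>(\<Union>n. B n). (\<lambda>n. \<gamma> n \<beta>' / \<psi> n \<beta>') \<longlonglongrightarrow> 0 \<longrightarrow>
           (\<exists>\<beta>''\<in>(\<Union>n. B n).
              filterlim (\<lambda>n. (\<gamma> n \<beta>' / \<psi> n \<beta>') * (\<gamma> n \<beta>'' / \<psi> n \<beta>'')) at_top sequentially)))"

end

theory Submission
  imports Defs "HOL-Real_Asymp.Real_Asymp"
begin

text \<open>
The exponential Radon transform smooths by half a derivative. Hence the part of \<open>f\<close> at frequencies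
of size \<open>R\<close> can be estimated at a point with variance of order \<open>R^3 / n\<close>, whereas for
\<open>f\<close> in the Sobolev ball of exponent \<open>\<beta>\<close> the frequencies above \<open>R\<close> contribute at most
\<open>K * R powr (- (\<beta> - 1))\<close> to \<open>f x\<close>, by Cauchy-Schwarz. Balancing the two at
\<open>R powr (2 * \<beta> + 1) = n\<close> gives the minimax rate for known \<open>\<beta>\<close>; replacing \<open>n\<close> by
\<open>n / ln n\<close> gives the adaptive rate.

Why the adaptive rate is attained. Let \<open>band_part f x j\<close> be the contribution to \<open>f x\<close> of the
frequencies between \<open>2^(j-1)\<close> and \<open>2^j\<close>. It has an unbiased estimator that is linear in the
data (lemma \<open>radon_weight_unbiased\<close>): filtered back projection, with the ramp filter cut off
below the frequency \<open>\<bar>\<mu>\<bar>\<close>. The formula is exact because the average over all directions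
of an exponentially weighted plane wave of frequency \<open>r\<close> depends only on \<open>r\<^sup>2 - \<mu>\<^sup>2\<close>
(lemma \<open>exponential_plane_wave_average\<close>). The estimator uses no cutoff frequency: it keeps
the estimate of a band when it exceeds \<open>\<kappa> * sqrt (8^j * ln n / n)\<close>, a level beyond which the mean
square of the noise is a high negative power of \<open>n\<close> (lemma \<open>band_estimate_tail\<close>). Each band then costs
at most the smaller of its contribution and its threshold, and the sum of these minima is
dominated by the crossover frequency \<open>(n / ln n) powr (1 / (2 * \<beta> + 1))\<close>, which the procedure need
not know (lemmas \<open>crossover_level\<close> and \<open>adaptive_upper_bound\<close>). Every constant depends on the scale
only through a lower bound \<open>\<beta>\<^sub>1\<close> for the exponents, so that the classes may be as many and as smooth as one likes.

Why nothing better is possible. A bump of width \<open>h\<close> and height \<open>a * h powr (\<beta> - 1)\<close> at \<open>x\<close>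
lies in the class of exponent \<open>\<beta>\<close>, and the likelihood ratio of \<open>n\<close> observations of it against
\<open>f = 0\<close> has second moment at most \<open>exp (2 * c * n * h powr (2 * \<beta> + 1))\<close>. An
estimator with error at most \<open>r0\<close> at zero and \<open>r1\<close> on the class therefore satisfies
\<open>a * h powr (\<beta> - 1) \<le> r0 * exp (c * n * h powr (2 * \<beta> + 1)) + r1\<close> (lemma
\<open>risk_trade_off\<close>). With \<open>h powr (2 * \<beta> + 1) = 1 / n\<close> this is the minimax lower bound: the
adaptive rate can be beaten at \<open>\<beta>\<close> by at most a power of \<open>ln n\<close>. With
\<open>h powr (2 * \<beta> + 1) = \<kappa> * ln n / n\<close> it says that whoever beats the adaptive rate at \<open>\<beta>\<close>
has an error at zero of at least that rate times \<open>n powr (- \<delta>)\<close>, up to a constant, where \<open>\<delta>\<close> is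
as small as one likes. But zero lies in every smoother class as well, where the adaptive rate is smaller
by a power of \<open>n\<close>. So the loss at any larger exponent is a power of \<open>n\<close> and outweighs the gain
(lemma \<open>superefficiency_cost\<close>). This is the optimality of the adaptive rate, and it also rules out the
minimax rates on the whole scale: these would gain a power of \<open>ln n\<close> at every exponent and lose nowhere.
\<close>

section \<open>Lebesgue measure on the plane\<close>

lemma perp_simps: "perp \<theta> $ 1 = - (\<theta> $ 2)" "perp \<theta> $ 2 = \<theta> $ 1"
  by (simp_all add: perp_def)

lemma inner_vec2: "(u :: real ^ 2) \<bullet> v = u $ 1 * v $ 1 + u $ 2 * v $ 2"
  by (simp add: inner_vec_def UNIV_2)

lemma norm_vec2: "norm (u :: real ^ 2) = sqrt ((u $ 1)\<^sup>2 + (u $ 2)\<^sup>2)"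
  by (simp add: norm_eq_sqrt_inner inner_vec2 power2_eq_square)

lemma vec2_eqI: "(u :: real ^ 2) $ 1 = v $ 1 \<Longrightarrow> u $ 2 = v $ 2 \<Longrightarrow> u = v"
  by (simp add: vec_eq_iff forall_2)

lemma vector2_eq: "vector [a, b] = a *\<^sub>R axis 1 1 + b *\<^sub>R (axis 2 1 :: real ^ 2)"
  by (rule vec2_eqI) (simp_all add: axis_def)

lemma perp_eq: "perp \<theta> = (- (\<theta> $ 2)) *\<^sub>R axis 1 1 + (\<theta> $ 1) *\<^sub>R axis 2 1"
  by (simp add: perp_def vector2_eq)

lemma continuous_perp: "continuous_on UNIV perp"
  unfolding perp_eq[abs_def] by (intro continuous_intros)

lemma perp_measurable [measurable]: "perp \<in> borel_measurable borel"
  by (rule borel_measurable_continuous_onI) (rule continuous_perp)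

lemma vector2_measurable [measurable (raw)]:
  assumes [measurable]: "f \<in> borel_measurable M" "g \<in> borel_measurable M"
  shows "(\<lambda>z. vector [f z, g z] :: real ^ 2) \<in> borel_measurable M"
  unfolding vector2_eq by measurable

lemma vec_nth_measurable [measurable]: "(\<lambda>v :: real ^ 2. v $ i) \<in> borel_measurable borel"
  by (intro borel_measurable_continuous_onI continuous_intros)

lemma lborel_vector2: "lborel = distr (lborel \<Otimes>\<^sub>M lborel) borel (\<lambda>(a, b). vector [a, b] :: real ^ 2)"
proof (rule lborel_eqI)
  fix l u :: "real ^ 2" assume le: "\<And>b. b \<in> Basis \<Longrightarrow> l \<bullet> b \<le> u \<bullet> b"
  have l: "l $ i \<le> u $ i" for i 
  proof -
    have "axis i 1 \<in> (Basis :: (real ^ 2) set)" by (simp add: axis_in_Basis_iff)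
    from le[OF this] show ?thesis by (simp add: inner_axis)
  qed
  have "(\<lambda>(a, b). vector [a, b]) -` box l u = {l$1<..<u$1} \<times> {l$2<..<u$2}"
    by (auto simp: mem_box_cart forall_2)
  moreover have "(\<Prod>b\<in>Basis. (u - l) \<bullet> b) = (u $ 1 - l $ 1) * (u $ 2 - l $ 2)"
    by (simp add: Basis_vec_def UNIV_2 inner_axis axis_eq_axis)
  ultimately show "emeasure (distr (lborel \<Otimes>\<^sub>M lborel) borel (\<lambda>(a, b). vector [a, b])) (box l u) =
      ennreal (\<Prod>b\<in>Basis. (u - l) \<bullet> b)"
    using l by (subst emeasure_distr)
      (simp_all add: space_pair_measure lborel.emeasure_pair_measure_Times ennreal_mult)
qed simp

text \<open>Orthogonal maps preserve the volume of boxes, and boxes determine Lebesgue measure.\<close>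

lemma lborel_rotation:
  fixes T :: "real ^ 2 \<Rightarrow> real ^ 2"
  assumes "orthogonal_transformation T"
  shows "lborel = distr lborel borel T"
proof (rule lborel_eqI)
  fix l u :: "real ^ 2" assume le: "\<And>b. b \<in> Basis \<Longrightarrow> l \<bullet> b \<le> u \<bullet> b"
  have lin: "linear T" using assms by (rule orthogonal_transformation_linear)
  then have [measurable]: "T \<in> borel_measurable borel"
    by (intro borel_measurable_continuous_onI linear_continuous_on)
      (simp add: linear_conv_bounded_linear)
  obtain T' where T': "orthogonal_transformation T'" "\<And>y. T (T' y) = y" "\<And>y. T' (T y) = y"
    using assms by (metis orthogonal_transformation_bij orthogonal_transformation_inv
       bij_inv_eq_iff)
  have "T -` box l u = T' ` box l u" 
  proof safe
    fix y assume "T y \<in> box l u"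
    then show "y \<in> T' ` box l u" using T'(3)[of y] by (metis image_eqI)
  next
    fix y assume "y \<in> box l u"
    then show "T' y \<in> T -` box l u" using T'(2)[of y] by simp
  qed
  moreover have "measure lebesgue (T' ` box l u) = measure lebesgue (box l u)"
    by (rule measure_orthogonal_image[OF T'(1)]) simp
  moreover have "T' ` box l u \<in> lmeasurable"
    by (rule measurable_orthogonal_image[OF T'(1)]) simp
  ultimately have lm: "T -` box l u \<in> lmeasurable"
      "measure lebesgue (T -` box l u) = measure lebesgue (box l u)" by auto
  have sb: "T -` box l u \<in> sets borel" using measurable_sets[of T borel borel "box l u"] by simp
  have "emeasure lborel (T -` box l u) = emeasure lebesgue (T -` box l u)"
    using sb by simp
  also have "\<dots> = measure lebesgue (box l u)" using lm
    by (metis emeasure_eq_measure2)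
  also have "\<dots> = ennreal (\<Prod>b\<in>Basis. (u - l) \<bullet> b)"
    using le by (simp add: measure_lborel_box_eq prod_nonneg inner_simps)
  finally show "emeasure (distr lborel borel T) (box l u) = ennreal (\<Prod>b\<in>Basis. (u - l) \<bullet> b)"
    by (subst emeasure_distr) auto
qed simp

text \<open>Coordinates along and across a direction \<open>\<theta>\<close> preserve area. This is what makes the integral over
all parallel lines of an integral along each line an integral over the plane.\<close>

lemma rotated_frame:
  assumes "norm \<theta> = 1"
  shows "lborel = distr (lborel \<Otimes>\<^sub>M lborel) borel (\<lambda>(s, t). s *\<^sub>R \<theta> + t *\<^sub>R perp \<theta>)"
proof -
  let ?T = "\<lambda>v :: real ^ 2. (v $ 1) *\<^sub>R \<theta> + (v $ 2) *\<^sub>R perp \<theta>"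
  have n: "(\<theta> $ 1)\<^sup>2 + (\<theta> $ 2)\<^sup>2 = 1" using assms by (simp add: norm_vec2)
  have "linear ?T" by (intro linearI vec2_eqI) (simp_all add: algebra_simps)
  moreover have "?T v \<bullet> ?T w = v \<bullet> w" for v w
  proof -
    have "?T v \<bullet> ?T w = ((\<theta> $ 1)\<^sup>2 + (\<theta> $ 2)\<^sup>2) * (v \<bullet> w)"
      by (simp add: inner_vec2 perp_simps algebra_simps power2_eq_square)
    then show ?thesis by (simp add: n)
  qed
  ultimately have "orthogonal_transformation ?T"
    by (simp add: orthogonal_transformation_def)
  then have "lborel = distr lborel borel ?T" by (rule lborel_rotation)
  also have "\<dots> = distr (lborel \<Otimes>\<^sub>M lborel) borel (\<lambda>(s, t). s *\<^sub>R \<theta> + t *\<^sub>R perp \<theta>)"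
    by (subst lborel_vector2, subst distr_distr) (auto simp: o_def case_prod_unfold)
  finally show ?thesis .
qed

lemma lborel2_sigma_finite: "pair_sigma_finite (lborel :: real measure) (lborel :: real measure)"
  by (simp add: lborel.sigma_finite_measure_axioms pair_sigma_finite_def)

lemma nn_integral_plane:
  assumes [measurable]: "g \<in> borel_measurable borel"
  shows "(\<integral>\<^sup>+ y. g y \<partial>lborel) = (\<integral>\<^sup>+ a. \<integral>\<^sup>+ b. g (vector [a, b] :: real ^ 2) \<partial>lborel \<partial>lborel)"
  by (subst lborel_vector2)
    (simp add: nn_integral_distr lborel.nn_integral_fst[symmetric] case_prod_unfold)

lemma integral_rotated_frame:
  fixes g :: "real ^ 2 \<Rightarrow> 'a :: {banach, second_countable_topology}"
  assumes "norm \<theta> = 1" "integrable lborel g"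
  shows "(LINT y|lborel. g y) = (LINT s|lborel. LINT t|lborel. g (s *\<^sub>R \<theta> + t *\<^sub>R perp \<theta>))"
proof -
  have m[measurable]: "g \<in> borel_measurable borel" using assms(2) by measurable
  have "integrable (lborel \<Otimes>\<^sub>M lborel) (\<lambda>(s, t). g (s *\<^sub>R \<theta> + t *\<^sub>R perp \<theta>))"
    using assms(2) by (subst (asm) rotated_frame[OF assms(1)], subst (asm) integrable_distr_eq)
      (auto simp: case_prod_unfold)
  then show ?thesis
    by (subst rotated_frame[OF assms(1)], subst integral_distr)
      (auto simp: case_prod_unfold pair_sigma_finite.integral_fst[OF lborel2_sigma_finite])
qed

section \<open>Polar coordinates\<close>

definition polar :: "real ^ 2 \<Rightarrow> real ^ 2" where
  "polar v = vector [v $ 1 * cos (v $ 2), v $ 1 * sin (v $ 2)]"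

lemma polar_nth [simp]: "polar v $ 1 = v $ 1 * cos (v $ 2)" "polar v $ 2 = v $ 1 * sin (v $ 2)"
  by (simp_all add: polar_def)

lemma polar_measurable [measurable]: "polar \<in> borel_measurable borel"
  unfolding polar_def[abs_def] by measurable

text \<open>Angle zero is left out so that polar coordinates are injective with open domain; the missing half line is a null set.\<close>

definition polar_domain :: "(real ^ 2) set" where
  "polar_domain = {v. 0 < v $ 1 \<and> 0 < v $ 2 \<and> v $ 2 < 2 * pi}"

lemma polar_domain_sets [measurable]: "polar_domain \<in> sets borel"
  unfolding polar_domain_def by measurable

lemma norm_polar: "0 \<le> v $ 1 \<Longrightarrow> norm (polar v) = v $ 1"
proof -
  assume "0 \<le> v $ 1"
  moreover have "(v $ 1 * cos (v $ 2))\<^sup>2 + (v $ 1 * sin (v $ 2))\<^sup>2 =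
      (v $ 1)\<^sup>2 * ((sin (v $ 2))\<^sup>2 + (cos (v $ 2))\<^sup>2)"
    by (simp only: power_mult_distrib distrib_left add.commute)
  ultimately show ?thesis by (simp add: norm_vec2)
qed

lemma polar_has_derivative:
  "(polar has_derivative (\<lambda>w. vector [w $ 1 * cos (v $ 2) - v $ 1 * sin (v $ 2) * w $ 2,
      w $ 1 * sin (v $ 2) + v $ 1 * cos (v $ 2) * w $ 2])) (at v within S)"
  unfolding polar_def[abs_def] vector2_eq
  by (rule derivative_eq_intros bounded_linear_imp_has_derivative bounded_linear_vec_nth refl)+
    (auto simp: fun_eq_iff algebra_simps)

lemma polar_jacobian:
  "det (matrix (\<lambda>w. vector [w $ 1 * cos (v $ 2) - v $ 1 * sin (v $ 2) * w $ 2,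
      w $ 1 * sin (v $ 2) + v $ 1 * cos (v $ 2) * w $ 2] :: real ^ 2)) = v $ 1" for v :: "real ^ 2"
proof -
  have "det (matrix (\<lambda>w. vector [w $ 1 * cos (v $ 2) - v $ 1 * sin (v $ 2) * w $ 2,
      w $ 1 * sin (v $ 2) + v $ 1 * cos (v $ 2) * w $ 2] :: real ^ 2)) =
      v $ 1 * ((sin (v $ 2))\<^sup>2 + (cos (v $ 2))\<^sup>2)"
    by (simp add: det_2 matrix_def axis_def power2_eq_square ring_distribs mult_ac del: sin_cos_squared_add3)
  then show ?thesis by simp
qed

lemma inj_on_polar: "inj_on polar polar_domain"
proof (rule inj_onI)
  fix v w assume v: "v \<in> polar_domain" and w: "w \<in> polar_domain" and e: "polar v = polar w"
  have r: "v $ 1 = w $ 1" using v w e norm_polar[of v] norm_polar[of w]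
    by (simp add: polar_domain_def)
  have "v $ 1 * cos (v $ 2) = w $ 1 * cos (w $ 2)" "v $ 1 * sin (v $ 2) = w $ 1 * sin (w $ 2)"
    using arg_cong[OF e, of "\<lambda>z. z $ 1"] arg_cong[OF e, of "\<lambda>z. z $ 2"] by simp_all
  then have "sin (v $ 2) = sin (w $ 2) \<and> cos (v $ 2) = cos (w $ 2)"
    using r v by (simp add: polar_domain_def)
  then obtain n :: int where n: "v $ 2 = w $ 2 + 2 * pi * n" unfolding sin_cos_eq_iff by blast
  have "\<bar>2 * pi * n\<bar> < 2 * pi"
    using v w n unfolding polar_domain_def mem_Collect_eq by linarith
  then have "2 * pi * \<bar>real_of_int n\<bar> < 2 * pi * 1"
    by (simp add: abs_mult)
  then have "\<bar>real_of_int n\<bar> < 1" 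
    using mult_less_cancel_left_pos[of "2 * pi" "\<bar>real_of_int n\<bar>" 1] pi_gt_zero by simp
  then have "n = 0" by linarith
  then show "v = w" using n r by (intro vec2_eqI) auto
qed

lemma polar_image: "- polar ` polar_domain \<subseteq> {y. y $ 2 = 0}"
proof (rule subsetI, rule ccontr)
  fix y assume y: "y \<in> - polar ` polar_domain" and "y \<notin> {y. y $ 2 = 0}"
  then have y2: "y $ 2 \<noteq> 0" by simp
  then have n: "norm y > 0" by (metis zero_less_norm_iff zero_index)
  have "(y $ 1 / norm y)\<^sup>2 + (y $ 2 / norm y)\<^sup>2 = 1"
  proof -
    have "(norm y)\<^sup>2 = (y $ 1)\<^sup>2 + (y $ 2)\<^sup>2" by (simp add: norm_vec2)
    then have "(y $ 1 / norm y)\<^sup>2 + (y $ 2 / norm y)\<^sup>2 = (norm y)\<^sup>2 / (norm y)\<^sup>2"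
      by (simp only: power_divide add_divide_distrib)
    then show ?thesis using n by simp
  qed
  then obtain t where t: "0 \<le> t" "t < 2 * pi" "y $ 1 / norm y = cos t" "y $ 2 / norm y = sin t"
    by (rule sincos_total_2pi)
  have "t \<noteq> 0" using t(4) y2 n by auto
  then have "vector [norm y, t] \<in> polar_domain" using t n by (simp add: polar_domain_def)
  moreover have "polar (vector [norm y, t]) = y"
    using t(3,4) n by (intro vec2_eqI) (auto simp: field_simps)
  ultimately show False using y by (metis ComplD image_eqI)
qed

text \<open>By the change of variables formula the polar image of a region has area the integral of the Jacobian
\<open>r\<close> over the region. Only the positive horizontal half line is missed. As an equality of measures this
serves nonnegative and Bochner integrals alike.\<close>

lemma lborel_polar:
  "lborel = distr (density lborel (\<lambda>v. ennreal (v $ 1) * indicator polar_domain v)) borel polar"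
proof (rule lborel_eqI)
  fix l u :: "real ^ 2" assume le: "\<And>b. b \<in> Basis \<Longrightarrow> l \<bullet> b \<le> u \<bullet> b"
  let ?S = "polar_domain \<inter> polar -` box l u"
  have Sb: "?S \<in> sets borel" using measurable_sets[OF polar_measurable, of "box l u"] by auto
  have "box l u - polar ` ?S \<subseteq> {y. y $ 2 = 0}"
  proof
    fix y assume y: "y \<in> box l u - polar ` ?S"
    then have "y \<in> - polar ` polar_domain" by (auto simp del: polar_nth)
    then show "y \<in> {y. y $ 2 = 0}" using polar_image by (rule rev_subsetD)
  qed
  then have neg: "negligible (box l u - polar ` ?S)"
    by (rule negligible_subset[rotated]) (rule negligible_standard_hyperplane_cart)
  have sub: "polar ` ?S \<subseteq> box l u" by blast
  have "polar ` ?S = box l u - (box l u - polar ` ?S)" using sub by (simp add: double_diff)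
  moreover have nul: "box l u - polar ` ?S \<in> null_sets lebesgue"
    using neg unfolding negligible_iff_null_sets .
  moreover have "measure lebesgue (box l u - (box l u - polar ` ?S)) = measure lebesgue (box l u)"
    by (rule measure_Diff_null_set[OF _ nul]) simp
  moreover have "box l u - (box l u - polar ` ?S) \<in> lmeasurable"
    by (rule fmeasurable.Diff) (use neg negligible_imp_measurable in auto)
  ultimately have "polar ` ?S \<in> lmeasurable \<and> measure lebesgue (polar ` ?S) = measure lebesgue (box l u)"
    by presburger
  then have "((\<lambda>v. \<bar>v $ 1\<bar>) has_integral measure lebesgue (box l u)) ?S"
    using has_measure_differentiable_image[OF _ polar_has_derivative inj_on_subset[OF inj_on_polar], of ?S]
      Sb by (simp add: polar_jacobian)
  then have "(\<integral>\<^sup>+ v. ennreal \<bar>v $ 1\<bar> * indicator ?S v \<partial>lborel) = measure lebesgue (box l u)"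
    by (rule nn_integral_has_integral_lebesgue'[rotated]) simp
  also have "(\<integral>\<^sup>+ v. ennreal \<bar>v $ 1\<bar> * indicator ?S v \<partial>lborel) =
      (\<integral>\<^sup>+ v. ennreal (v $ 1) * indicator polar_domain v * indicator (polar -` box l u) v \<partial>lborel)"
    by (intro nn_integral_cong) (auto simp: indicator_def polar_domain_def)
  also have "\<dots> = emeasure (distr (density lborel
      (\<lambda>v. ennreal (v $ 1) * indicator polar_domain v)) borel polar) (box l u)"
    using measurable_sets[OF polar_measurable, of "box l u"]
    by (subst emeasure_distr) (auto simp: emeasure_density)
  finally show "emeasure (distr (density lborel
      (\<lambda>v. ennreal (v $ 1) * indicator polar_domain v)) borel polar) (box l u) =
      ennreal (\<Prod>b\<in>Basis. (u - l) \<bullet> b)"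
    using le by (simp add: measure_lborel_box_eq prod_nonneg inner_simps)
qed simp

lemma nn_integral_polar:
  fixes g :: "real ^ 2 \<Rightarrow> ennreal"
  assumes [measurable]: "g \<in> borel_measurable borel"
  shows "(\<integral>\<^sup>+ y. g y \<partial>lborel) =
    (\<integral>\<^sup>+ r. \<integral>\<^sup>+ \<phi>. ennreal r * indicator {0<..} r * indicator {0<..<2 * pi} \<phi> *
        g (vector [r * cos \<phi>, r * sin \<phi>]) \<partial>lborel \<partial>lborel)"
proof -
  have "(\<integral>\<^sup>+ y. g y \<partial>lborel) =
      (\<integral>\<^sup>+ v. ennreal (v $ 1) * indicator polar_domain v * g (polar v) \<partial>lborel)"
    by (subst lborel_polar) (simp add: nn_integral_distr nn_integral_density)
  also have "\<dots> = (\<integral>\<^sup>+ r. \<integral>\<^sup>+ \<phi>. ennreal r * indicator {0<..} r * indicator {0<..<2 * pi} \<phi> *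
        g (vector [r * cos \<phi>, r * sin \<phi>]) \<partial>lborel \<partial>lborel)"
    by (subst nn_integral_plane)
      (auto intro!: nn_integral_cong simp: polar_def polar_domain_def indicator_def)
  finally show ?thesis .
qed

lemma integral_polar:
  fixes g :: "real ^ 2 \<Rightarrow> 'a :: {banach, second_countable_topology}"
  assumes "integrable lborel g"
  shows "(LINT y|lborel. g y) =
    (LINT r|lborel. LINT \<phi>|lborel. (indicator {0<..} r * indicator {0<..<2 * pi} \<phi> * r) *\<^sub>R
        g (vector [r * cos \<phi>, r * sin \<phi>]))"
proof -
  have [measurable]: "g \<in> borel_measurable borel" using assms by measurable
  have eq: "lborel = distr (density lborel (\<lambda>v. ennreal (v $ 1 * indicator polar_domain v))) borel polar"
    by (subst lborel_polar, rule arg_cong[where f="\<lambda>M. distr M borel polar"],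
        rule arg_cong[where f="density lborel"]) (auto simp: fun_eq_iff indicator_def)
  have int: "integrable lborel (\<lambda>v. (v $ 1 * indicator polar_domain v) *\<^sub>R g (polar v))"
    using assms by (subst (asm) eq, subst (asm) integrable_distr_eq, simp, simp,
      subst (asm) integrable_density) (auto simp: polar_domain_def indicator_def)
  have "(LINT y|lborel. g y) = (LINT v|lborel. (v $ 1 * indicator polar_domain v) *\<^sub>R g (polar v))"
    by (subst eq, subst integral_distr, simp, simp, subst integral_density)
      (auto simp: polar_domain_def indicator_def)
  also have "\<dots> = (LINT s|lborel. LINT t|lborel. (\<lambda>v. (v $ 1 * indicator polar_domain v) *\<^sub>R g (polar v))
      (s *\<^sub>R axis 1 1 + t *\<^sub>R perp (axis 1 1)))"
    by (rule integral_rotated_frame[OF _ int]) simp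
  also have "\<dots> = (LINT r|lborel. LINT \<phi>|lborel. (indicator {0<..} r * indicator {0<..<2 * pi} \<phi> * r) *\<^sub>R
        g (vector [r * cos \<phi>, r * sin \<phi>]))"
  proof -
    have "s *\<^sub>R axis 1 1 + t *\<^sub>R perp (axis 1 1) = vector [s, t]" for s t :: real
      by (rule vec2_eqI) (simp_all add: perp_simps axis_def)
    then show ?thesis
      by (intro Bochner_Integration.integral_cong refl)
        (auto simp: polar_def polar_domain_def indicator_def)
  qed
  finally show ?thesis .
qed

section \<open>Averages of exponential plane waves\<close>

definition circle_point :: "real \<Rightarrow> real ^ 2" where
  "circle_point \<phi> = vector [cos \<phi>, sin \<phi>]"

lemma circle_point_nth [simp]: "circle_point \<phi> $ 1 = cos \<phi>" "circle_point \<phi> $ 2 = sin \<phi>"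
  by (simp_all add: circle_point_def)

lemma norm_circle_point [simp]: "norm (circle_point \<phi>) = 1"
  by (simp add: norm_vec2)

lemma inner_circle_point: "z \<bullet> circle_point \<phi> = z $ 1 * cos \<phi> + z $ 2 * sin \<phi>"
  by (simp add: inner_vec2)

lemma inner_perp_circle_point: "z \<bullet> perp (circle_point \<phi>) = z $ 2 * cos \<phi> - z $ 1 * sin \<phi>"
  by (simp add: inner_vec2 perp_simps)

text \<open>With \<open>\<alpha>\<close> the angle of \<open>z\<close>, the integrand is the real part of
\<open>exp (\<i> * \<rho> * norm z * cos (\<phi> - \<alpha> + \<i> * s))\<close>, and shifting the contour of integration of a periodic entire
function does not change its integral. In real terms: the derivative of the integrand in \<open>s\<close> is minus the
derivative in \<open>\<phi>\<close> of the corresponding imaginary part, whose integral over a period vanishes.\<close>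

lemma exp_cos_circle_integral_const:
  fixes z :: "real ^ 2" and \<rho> s :: real
  defines "G \<equiv> \<lambda>s. integral {0..2 * pi} (\<lambda>\<phi>. exp (- (\<rho> * sinh s) * (z \<bullet> perp (circle_point \<phi>))) *
      cos (\<rho> * cosh s * (z \<bullet> circle_point \<phi>)))"
  shows "G s = G 0"
proof -
  let ?Q = "\<lambda>\<phi>. z $ 1 * cos \<phi> + z $ 2 * sin \<phi>" and ?P = "\<lambda>\<phi>. z $ 2 * cos \<phi> - z $ 1 * sin \<phi>"
  let ?F = "\<lambda>s \<phi>. exp (- (\<rho> * sinh s) * ?P \<phi>) * cos (\<rho> * cosh s * ?Q \<phi>)"
  let ?D = "\<lambda>s \<phi>. - (exp (- (\<rho> * sinh s) * ?P \<phi>) * (\<rho> * sinh s * ?Q \<phi> * sin (\<rho> * cosh s * ?Q \<phi>)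
      + \<rho> * cosh s * ?P \<phi> * cos (\<rho> * cosh s * ?Q \<phi>)))"
  have "((\<lambda>s. integral (cbox 0 (2 * pi)) (?F s)) has_field_derivative integral (cbox 0 (2 * pi)) (?D s))
      (at s within UNIV)" for s
  proof (rule leibniz_rule_field_derivative)
    show "((\<lambda>s. ?F s \<phi>) has_field_derivative ?D s \<phi>) (at s within UNIV)" for s \<phi>
      by (auto intro!: derivative_eq_intros simp: algebra_simps)
    show "?F s integrable_on cbox 0 (2 * pi)" for s
      by (intro integrable_continuous continuous_intros)
    show "continuous_on (UNIV \<times> cbox 0 (2 * pi)) (\<lambda>(s, \<phi>). ?D s \<phi>)"
      unfolding case_prod_unfold by (intro continuous_intros)
  qed auto
  moreover have "integral (cbox 0 (2 * pi)) (?D s) = 0" for s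
  proof -
    have "(?D s has_integral - (exp (- (\<rho> * sinh s) * ?P (2 * pi)) * sin (\<rho> * cosh s * ?Q (2 * pi)))
        - - (exp (- (\<rho> * sinh s) * ?P 0) * sin (\<rho> * cosh s * ?Q 0))) {0..2 * pi}"
    proof (rule fundamental_theorem_of_calculus)
      fix \<phi> :: real
      have "((\<lambda>\<phi>. - (exp (- (\<rho> * sinh s) * ?P \<phi>) * sin (\<rho> * cosh s * ?Q \<phi>)))
        has_field_derivative ?D s \<phi>) (at \<phi> within {0..2 * pi})"
        by (auto intro!: derivative_eq_intros simp: algebra_simps)
      then show "((\<lambda>\<phi>. - (exp (- (\<rho> * sinh s) * ?P \<phi>) * sin (\<rho> * cosh s * ?Q \<phi>)))
        has_vector_derivative ?D s \<phi>) (at \<phi> within {0..2 * pi})"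
        by (simp add: has_real_derivative_iff_has_vector_derivative)
    qed simp
    from integral_unique[OF this] show ?thesis by simp
  qed
  ultimately have "DERIV (\<lambda>s. integral (cbox 0 (2 * pi)) (?F s)) s :> 0" for s
    by simp
  then have "integral (cbox 0 (2 * pi)) (?F s) = integral (cbox 0 (2 * pi)) (?F 0)"
    using DERIV_isconst_all by blast
  then show ?thesis
    by (simp add: G_def inner_circle_point inner_perp_circle_point)
qed

text \<open>Choosing the shift with \<open>\<rho> * sinh s = \<mu>\<close> removes the exponential weight and turns the frequency
\<open>sqrt (\<rho>\<^sup>2 + \<mu>\<^sup>2)\<close> into \<open>\<rho>\<close>. This identity inverts the exponential Radon transform.\<close>

lemma exponential_plane_wave_average:
  fixes z :: "real ^ 2" and \<rho> \<mu> :: real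
  assumes "\<rho> > 0"
  shows "integral {0..2 * pi} (\<lambda>\<phi>. exp (- \<mu> * (z \<bullet> perp (circle_point \<phi>))) *
      cos (sqrt (\<rho>\<^sup>2 + \<mu>\<^sup>2) * (z \<bullet> circle_point \<phi>))) =
    integral {0..2 * pi} (\<lambda>\<phi>. cos (\<rho> * (z \<bullet> circle_point \<phi>)))"
proof -
  have "\<rho> * sqrt ((\<mu> / \<rho>)\<^sup>2 + 1) = sqrt (\<rho>\<^sup>2 * ((\<mu> / \<rho>)\<^sup>2 + 1))"
    using assms by (simp add: real_sqrt_mult)
  also have "\<rho>\<^sup>2 * ((\<mu> / \<rho>)\<^sup>2 + 1) = \<rho>\<^sup>2 + \<mu>\<^sup>2" using assms by (simp add: field_simps)
  finally have "\<rho> * cosh (arsinh (\<mu> / \<rho>)) = sqrt (\<rho>\<^sup>2 + \<mu>\<^sup>2)"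
    by (simp add: cosh_arsinh_real)
  moreover have "\<rho> * sinh (arsinh (\<mu> / \<rho>)) = \<mu>" using assms by simp
  ultimately show ?thesis
    using exp_cos_circle_integral_const[of \<rho> "arsinh (\<mu> / \<rho>)" z] by simp
qed

section \<open>Fourier inversion in the plane\<close>

lemma cis_measurable [measurable]: "cis \<in> borel_measurable borel"
  by (intro borel_measurable_continuous_onI continuous_intros)

lemma nn_integral_gauss: "(\<integral>\<^sup>+ t. ennreal (exp (- t\<^sup>2 / 2)) \<partial>lborel) = ennreal (sqrt (2 * pi))"
proof -
  have "(\<integral>\<^sup>+ t. ennreal (sqrt (2 * pi)) * ennreal (normal_density 0 1 t) \<partial>lborel) = ennreal (sqrt (2 * pi)) * 1"
    by (subst nn_integral_cmult) (auto simp: nn_integral_eq_integral[OF integrable_normal_density] integral_normal_density)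
  then show ?thesis
    by (simp add: ennreal_mult'[symmetric] normal_density_def)
qed

lemma gauss_char: "(LINT t|lborel. cis (a * t) * complex_of_real (exp (- t\<^sup>2 / 2))) =
    complex_of_real (sqrt (2 * pi) * exp (- a\<^sup>2 / 2))"
proof -
  have "complex_of_real (exp (- a\<^sup>2 / 2)) = char std_normal_distribution a"
    by (simp add: char_std_normal_distribution)
  also have "\<dots> = (LINT t|lborel. std_normal_density t *\<^sub>R cis (a * t))"
    unfolding char_def
    by (subst integral_density) (auto simp: cis_conv_exp normal_density_nonneg)
  also have "\<dots> = (LINT t|lborel. complex_of_real (1 / sqrt (2 * pi)) *
      (cis (a * t) * complex_of_real (exp (- t\<^sup>2 / 2))))"
    by (intro Bochner_Integration.integral_cong refl) (simp add: normal_density_def scaleR_conv_of_real)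
  also have "\<dots> = complex_of_real (1 / sqrt (2 * pi)) *
      (LINT t|lborel. cis (a * t) * complex_of_real (exp (- t\<^sup>2 / 2)))"
    by (rule integral_mult_right_zero)
  finally show ?thesis by (simp add: field_simps)
qed

definition gauss2 :: "real ^ 2 \<Rightarrow> real" where
  "gauss2 v = exp (- (norm v)\<^sup>2 / 2)"

lemma gauss2_vector: "gauss2 (vector [a, b]) = exp (- a\<^sup>2 / 2) * exp (- b\<^sup>2 / 2)"
  by (simp add: gauss2_def norm_vec2 exp_add[symmetric] field_simps)

lemma gauss2_measurable [measurable]: "gauss2 \<in> borel_measurable borel"
  unfolding gauss2_def[abs_def] by measurable

lemma gauss2_pos: "gauss2 v > 0" and gauss2_le_1: "gauss2 v \<le> 1"
  by (simp_all add: gauss2_def)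

lemma integrable_gauss2: "integrable lborel gauss2"
proof (rule integrableI_bounded)
  have "(\<integral>\<^sup>+ v. ennreal (norm (gauss2 v)) \<partial>lborel) =
      (\<integral>\<^sup>+ a. \<integral>\<^sup>+ b. ennreal (exp (- a\<^sup>2 / 2)) * ennreal (exp (- b\<^sup>2 / 2)) \<partial>lborel \<partial>lborel)"
    by (subst nn_integral_plane) (auto simp: gauss2_vector ennreal_mult'[symmetric])
  also have "\<dots> = ennreal (sqrt (2 * pi)) * ennreal (sqrt (2 * pi))"
    by (simp add: nn_integral_cmult nn_integral_multc nn_integral_gauss[simplified])
  also have "\<dots> < \<infinity>" by (simp add: ennreal_mult_less_top)
  finally show "(\<integral>\<^sup>+ v. ennreal (norm (gauss2 v)) \<partial>lborel) < \<infinity>" .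
qed simp

lemma integral_plane_coordinates:
  fixes g :: "real ^ 2 \<Rightarrow> 'a :: {banach, second_countable_topology}"
  assumes "integrable lborel g"
  shows "(LINT y|lborel. g y) = (LINT s|lborel. LINT t|lborel. g (vector [s, t]))"
proof -
  have "s *\<^sub>R axis 1 1 + t *\<^sub>R perp (axis 1 1) = vector [s, t]" for s t :: real
    by (rule vec2_eqI) (simp_all add: perp_simps axis_def)
  then show ?thesis using integral_rotated_frame[OF _ assms, of "axis 1 1"] by simp
qed

lemma gauss2_char: "(LINT v|lborel. cis (z \<bullet> v) * complex_of_real (gauss2 v)) =
    complex_of_real (2 * pi * gauss2 z)"
proof -
  have int: "integrable lborel (\<lambda>v. cis (z \<bullet> v) * complex_of_real (gauss2 v))"
    by (rule Bochner_Integration.integrable_bound[OF integrable_gauss2]) (auto simp: norm_mult)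
  have "(LINT v|lborel. cis (z \<bullet> v) * complex_of_real (gauss2 v)) =
      (LINT s|lborel. LINT t|lborel. (cis (z $ 1 * s) * complex_of_real (exp (- s\<^sup>2 / 2))) *
        (cis (z $ 2 * t) * complex_of_real (exp (- t\<^sup>2 / 2))))"
    by (subst integral_plane_coordinates[OF int])
      (simp add: gauss2_vector inner_vec2 cis_mult[symmetric] mult_ac)
  also have "\<dots> = complex_of_real (sqrt (2 * pi) * exp (- (z $ 1)\<^sup>2 / 2)) *
      complex_of_real (sqrt (2 * pi) * exp (- (z $ 2)\<^sup>2 / 2))"
    by (simp only: integral_mult_right_zero integral_mult_left_zero gauss_char)
  also have "\<dots> = complex_of_real ((sqrt (2 * pi) * sqrt (2 * pi)) *
      (exp (- (z $ 1)\<^sup>2 / 2) * exp (- (z $ 2)\<^sup>2 / 2)))"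
    by (simp only: of_real_mult mult_ac)
  also have "\<dots> = complex_of_real (2 * pi * gauss2 z)"
  proof -
    have "exp (- (z $ 1)\<^sup>2 / 2) * exp (- (z $ 2)\<^sup>2 / 2) = gauss2 z"
      by (simp add: gauss2_def norm_vec2 exp_add[symmetric] field_simps)
    then show ?thesis by simp
  qed
  finally show ?thesis .
qed

lemma lborel_affine_plane:
  fixes g :: "real ^ 2 \<Rightarrow> 'a :: {banach, second_countable_topology}"
  assumes [measurable]: "g \<in> borel_measurable borel" and "c \<noteq> 0"
  shows "(LINT y|lborel. g y) = c\<^sup>2 *\<^sub>R (LINT w|lborel. g (x + c *\<^sub>R w))"
proof -
  have "(LINT y|lborel. g y) = (LINT w|lborel. c\<^sup>2 *\<^sub>R g (x + c *\<^sub>R w))"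
    by (subst lborel_affine[of c x], fact, subst integral_density)
      (auto simp: integral_distr power2_eq_square)
  then show ?thesis by simp
qed

lemma nn_integral_affine_plane:
  fixes g :: "real ^ 2 \<Rightarrow> ennreal"
  assumes [measurable]: "g \<in> borel_measurable borel" and "c \<noteq> 0"
  shows "(\<integral>\<^sup>+ y. g y \<partial>lborel) = ennreal (c\<^sup>2) * (\<integral>\<^sup>+ w. g (x + c *\<^sub>R w) \<partial>lborel)"
  by (subst lborel_affine[of c x], fact, subst nn_integral_density)
    (auto simp: nn_integral_distr nn_integral_cmult power2_eq_square)

lemma fourier_measurable [measurable]:
  assumes [measurable]: "f \<in> borel_measurable borel"
  shows "fourier f \<in> borel_measurable borel"
  unfolding fourier_def[abs_def] by measurable

text \<open>Fubini moves the Gaussian damping factor from the frequency side to a Gaussian average of \<open>f\<close> of width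
\<open>\<epsilon>\<close> around \<open>x\<close>.\<close>

lemma fourier_gauss_regularization:
  fixes f :: "real ^ 2 \<Rightarrow> real"
  assumes f: "integrable lborel f" and "\<epsilon> > 0"
  shows "(LINT \<xi>|lborel. fourier f \<xi> * cis (x \<bullet> \<xi>) * complex_of_real (gauss2 (\<epsilon> *\<^sub>R \<xi>))) =
    complex_of_real (2 * pi * (LINT w|lborel. f (x + \<epsilon> *\<^sub>R w) * gauss2 w))"
proof -
  have [measurable]: "f \<in> borel_measurable borel" using f by measurable
  have gi: "integrable lborel (\<lambda>\<xi>. gauss2 (\<epsilon> *\<^sub>R \<xi>))"
  proof -
    have "integrable (distr lborel borel (\<lambda>v. (1 / \<epsilon>) *\<^sub>R v)) (\<lambda>\<xi>. gauss2 (\<epsilon> *\<^sub>R \<xi>))"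
      using integrable_gauss2 assms(2) by (subst integrable_distr_eq) auto
    then show ?thesis using assms(2)
      by (subst lborel_affine[of "1 / \<epsilon>" 0]) (auto intro!: integrable_mult_right simp: integrable_density)
  qed
  have pint: "integrable (lborel \<Otimes>\<^sub>M lborel) (\<lambda>(\<xi>, y). complex_of_real (f y) *
      (cis ((x - y) \<bullet> \<xi>) * complex_of_real (gauss2 (\<epsilon> *\<^sub>R \<xi>))))"
  proof (rule lborel_pair.Fubini_integrable)
    show "integrable lborel (\<lambda>\<xi>. LINT y|lborel. cmod (case (\<xi>, y) of (\<xi>, y) \<Rightarrow> complex_of_real (f y) *
      (cis ((x - y) \<bullet> \<xi>) * complex_of_real (gauss2 (\<epsilon> *\<^sub>R \<xi>)))))"
      using gi gauss2_pos by (simp add: norm_mult abs_of_pos)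
    show "AE \<xi> in lborel. integrable lborel (\<lambda>y. case (\<xi>, y) of (\<xi>, y) \<Rightarrow> complex_of_real (f y) *
      (cis ((x - y) \<bullet> \<xi>) * complex_of_real (gauss2 (\<epsilon> *\<^sub>R \<xi>))))"
    proof (rule AE_I2)
      fix \<xi> :: "real ^ 2"
      show "integrable lborel (\<lambda>y. case (\<xi>, y) of (\<xi>, y) \<Rightarrow> complex_of_real (f y) *
        (cis ((x - y) \<bullet> \<xi>) * complex_of_real (gauss2 (\<epsilon> *\<^sub>R \<xi>))))"
        using gauss2_pos[of "\<epsilon> *\<^sub>R \<xi>"] gauss2_le_1[of "\<epsilon> *\<^sub>R \<xi>"]
        by (intro Bochner_Integration.integrable_bound[OF f])
         (auto simp: norm_mult intro!: mult_left_le)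
    qed
  qed simp
  have "(LINT \<xi>|lborel. fourier f \<xi> * cis (x \<bullet> \<xi>) * complex_of_real (gauss2 (\<epsilon> *\<^sub>R \<xi>))) =
      (LINT \<xi>|lborel. LINT y|lborel. complex_of_real (f y) *
        (cis ((x - y) \<bullet> \<xi>) * complex_of_real (gauss2 (\<epsilon> *\<^sub>R \<xi>))))"
  proof (intro Bochner_Integration.integral_cong refl)
    fix \<xi> :: "real ^ 2"
    have "fourier f \<xi> * (cis (x \<bullet> \<xi>) * complex_of_real (gauss2 (\<epsilon> *\<^sub>R \<xi>))) =
      (LINT y|lborel. (complex_of_real (f y) * cis (- (y \<bullet> \<xi>))) *
        (cis (x \<bullet> \<xi>) * complex_of_real (gauss2 (\<epsilon> *\<^sub>R \<xi>))))"
      unfolding fourier_def by (rule integral_mult_left_zero[symmetric])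
    also have "\<dots> = (LINT y|lborel. complex_of_real (f y) *
        (cis ((x - y) \<bullet> \<xi>) * complex_of_real (gauss2 (\<epsilon> *\<^sub>R \<xi>))))"
    proof (intro Bochner_Integration.integral_cong refl)
      fix y :: "real ^ 2"
      have "cis (- (y \<bullet> \<xi>)) * cis (x \<bullet> \<xi>) = cis ((x - y) \<bullet> \<xi>)"
        by (simp add: cis_mult inner_diff_left)
      then show "complex_of_real (f y) * cis (- (y \<bullet> \<xi>)) *
          (cis (x \<bullet> \<xi>) * complex_of_real (gauss2 (\<epsilon> *\<^sub>R \<xi>))) =
          complex_of_real (f y) * (cis ((x - y) \<bullet> \<xi>) * complex_of_real (gauss2 (\<epsilon> *\<^sub>R \<xi>)))"
        by (metis mult.assoc)
    qed
    finally show "fourier f \<xi> * cis (x \<bullet> \<xi>) * complex_of_real (gauss2 (\<epsilon> *\<^sub>R \<xi>)) =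
        (LINT y|lborel. complex_of_real (f y) *
          (cis ((x - y) \<bullet> \<xi>) * complex_of_real (gauss2 (\<epsilon> *\<^sub>R \<xi>))))"
      by (simp only: mult.assoc)
  qed
  also have "\<dots> = (LINT y|lborel. LINT \<xi>|lborel. complex_of_real (f y) *
        (cis ((x - y) \<bullet> \<xi>) * complex_of_real (gauss2 (\<epsilon> *\<^sub>R \<xi>))))"
    by (rule lborel_pair.Fubini_integral[OF pint, symmetric])
  also have "\<dots> = (LINT y|lborel. complex_of_real (f y * (2 * pi * gauss2 ((1 / \<epsilon>) *\<^sub>R (x - y)) / \<epsilon>\<^sup>2)))"
  proof (intro Bochner_Integration.integral_cong refl)
    fix y :: "real ^ 2"
    have "(LINT \<xi>|lborel. cis ((x - y) \<bullet> \<xi>) * complex_of_real (gauss2 (\<epsilon> *\<^sub>R \<xi>))) =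
      (1 / \<epsilon>)\<^sup>2 *\<^sub>R (LINT w|lborel. cis (((1 / \<epsilon>) *\<^sub>R (x - y)) \<bullet> w) * complex_of_real (gauss2 w))"
      using assms(2) by (subst lborel_affine_plane[where c="1 / \<epsilon>" and x=0]) auto
    also have "\<dots> = complex_of_real (2 * pi * gauss2 ((1 / \<epsilon>) *\<^sub>R (x - y)) / \<epsilon>\<^sup>2)"
      by (subst gauss2_char) (simp add: scaleR_conv_of_real power_divide)
    finally show "(LINT \<xi>|lborel. complex_of_real (f y) * (cis ((x - y) \<bullet> \<xi>) * complex_of_real (gauss2 (\<epsilon> *\<^sub>R \<xi>)))) =
      complex_of_real (f y * (2 * pi * gauss2 ((1 / \<epsilon>) *\<^sub>R (x - y)) / \<epsilon>\<^sup>2))" by simp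
  qed
  also have "\<dots> = complex_of_real (LINT y|lborel. f y * (2 * pi * gauss2 ((1 / \<epsilon>) *\<^sub>R (x - y)) / \<epsilon>\<^sup>2))"
    by (rule integral_complex_of_real)
  also have "(LINT y|lborel. f y * (2 * pi * gauss2 ((1 / \<epsilon>) *\<^sub>R (x - y)) / \<epsilon>\<^sup>2)) =
      \<epsilon>\<^sup>2 *\<^sub>R (LINT w|lborel. (2 * pi / \<epsilon>\<^sup>2) * (f (x + \<epsilon> *\<^sub>R w) * gauss2 w))"
  proof -
    have g: "gauss2 ((1 / \<epsilon>) *\<^sub>R (x - (x + \<epsilon> *\<^sub>R w))) = gauss2 w" for w
      using assms(2) by (simp add: gauss2_def)
    have "(LINT y|lborel. f y * (2 * pi * gauss2 ((1 / \<epsilon>) *\<^sub>R (x - y)) / \<epsilon>\<^sup>2)) =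
        \<epsilon>\<^sup>2 *\<^sub>R (LINT w|lborel. f (x + \<epsilon> *\<^sub>R w) *
          (2 * pi * gauss2 ((1 / \<epsilon>) *\<^sub>R (x - (x + \<epsilon> *\<^sub>R w))) / \<epsilon>\<^sup>2))"
      using assms(2) by (intro lborel_affine_plane) auto
    also have "(\<lambda>w. f (x + \<epsilon> *\<^sub>R w) *
          (2 * pi * gauss2 ((1 / \<epsilon>) *\<^sub>R (x - (x + \<epsilon> *\<^sub>R w))) / \<epsilon>\<^sup>2)) =
        (\<lambda>w. (2 * pi / \<epsilon>\<^sup>2) * (f (x + \<epsilon> *\<^sub>R w) * gauss2 w))"
      unfolding g by (simp add: fun_eq_iff)
    finally show ?thesis .
  qed
  also have "\<dots> = 2 * pi * (LINT w|lborel. f (x + \<epsilon> *\<^sub>R w) * gauss2 w)"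
    using assms(2) by (subst integral_mult_right_zero) simp
  finally show ?thesis .
qed

text \<open>Let the width in the regularized formula tend to zero: the left side converges by domination by the
integrable transform, the right side because \<open>f\<close> is bounded and continuous at \<open>x\<close>.\<close>

lemma fourier_inversion:
  fixes f :: "real ^ 2 \<Rightarrow> real"
  assumes f: "integrable lborel f" and bounded: "\<And>y. \<bar>f y\<bar> \<le> L" and cont: "isCont f x"
    and ff: "integrable lborel (fourier f)"
  shows "(LINT \<xi>|lborel. fourier f \<xi> * cis (x \<bullet> \<xi>)) = complex_of_real ((2 * pi)\<^sup>2 * f x)"
proof -
  have [measurable]: "f \<in> borel_measurable borel" using f by measurable
  define \<epsilon> where "\<epsilon> n = inverse (real (Suc n))" for n
  have \<epsilon>: "\<epsilon> n > 0" for n by (simp add: \<epsilon>_def)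
  have lim: "\<epsilon> \<longlonglongrightarrow> 0" unfolding \<epsilon>_def[abs_def] by (rule LIMSEQ_inverse_real_of_nat)
  have c: "continuous_on UNIV gauss2" unfolding gauss2_def[abs_def] by (intro continuous_intros) auto
  have "(\<lambda>n. LINT \<xi>|lborel. fourier f \<xi> * cis (x \<bullet> \<xi>) * complex_of_real (gauss2 (\<epsilon> n *\<^sub>R \<xi>)))
      \<longlonglongrightarrow> (LINT \<xi>|lborel. fourier f \<xi> * cis (x \<bullet> \<xi>))"
  proof (rule integral_dominated_convergence[where w="\<lambda>\<xi>. cmod (fourier f \<xi>)"])
    show "AE \<xi> in lborel. (\<lambda>n. fourier f \<xi> * cis (x \<bullet> \<xi>) * complex_of_real (gauss2 (\<epsilon> n *\<^sub>R \<xi>)))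
        \<longlonglongrightarrow> fourier f \<xi> * cis (x \<bullet> \<xi>)"
    proof (rule AE_I2)
      fix \<xi> :: "real ^ 2"
      have "(\<lambda>n. gauss2 (\<epsilon> n *\<^sub>R \<xi>)) \<longlonglongrightarrow> gauss2 (0 *\<^sub>R \<xi>)"
        using c by (intro isCont_tendsto_compose[where g=gauss2] tendsto_intros lim)
          (simp add: continuous_on_eq_continuous_at)
      then have "(\<lambda>n. fourier f \<xi> * cis (x \<bullet> \<xi>) * complex_of_real (gauss2 (\<epsilon> n *\<^sub>R \<xi>)))
        \<longlonglongrightarrow> fourier f \<xi> * cis (x \<bullet> \<xi>) * complex_of_real (gauss2 (0 *\<^sub>R \<xi>))"
        by (intro tendsto_intros)
      then show "(\<lambda>n. fourier f \<xi> * cis (x \<bullet> \<xi>) * complex_of_real (gauss2 (\<epsilon> n *\<^sub>R \<xi>)))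
        \<longlonglongrightarrow> fourier f \<xi> * cis (x \<bullet> \<xi>)" by (simp add: gauss2_def)
    qed
    show "AE \<xi> in lborel. norm (fourier f \<xi> * cis (x \<bullet> \<xi>) * complex_of_real (gauss2 (\<epsilon> n *\<^sub>R \<xi>))) \<le>
        cmod (fourier f \<xi>)" for n
      using gauss2_pos gauss2_le_1 by (auto simp: norm_mult abs_of_pos intro!: mult_left_le)
  qed (use ff in auto)
  moreover have "(\<lambda>n. LINT \<xi>|lborel. fourier f \<xi> * cis (x \<bullet> \<xi>) * complex_of_real (gauss2 (\<epsilon> n *\<^sub>R \<xi>)))
      \<longlonglongrightarrow> complex_of_real (2 * pi * (f x * (2 * pi)))"
  proof -
    have "(\<lambda>n. LINT w|lborel. f (x + \<epsilon> n *\<^sub>R w) * gauss2 w) \<longlonglongrightarrow> (LINT w|lborel. f x * gauss2 w)"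
    proof (rule integral_dominated_convergence[where w="\<lambda>w. L * gauss2 w"])
      show "AE w in lborel. (\<lambda>n. f (x + \<epsilon> n *\<^sub>R w) * gauss2 w) \<longlonglongrightarrow> f x * gauss2 w"
      proof (rule AE_I2)
        fix w :: "real ^ 2"
        have "(\<lambda>n. x + \<epsilon> n *\<^sub>R w) \<longlonglongrightarrow> x + 0 *\<^sub>R w" by (intro tendsto_intros lim)
        then have "(\<lambda>n. f (x + \<epsilon> n *\<^sub>R w)) \<longlonglongrightarrow> f x"
          by (intro isCont_tendsto_compose[OF cont]) simp
        then show "(\<lambda>n. f (x + \<epsilon> n *\<^sub>R w) * gauss2 w) \<longlonglongrightarrow> f x * gauss2 w"
          by (intro tendsto_intros)
      qed
      show "AE w in lborel. norm (f (x + \<epsilon> n *\<^sub>R w) * gauss2 w) \<le> L * gauss2 w" for n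
        using bounded gauss2_pos by (auto simp: abs_mult abs_of_pos less_imp_le intro!: mult_right_mono)
    qed (use integrable_gauss2 in auto)
    moreover have "(LINT w|lborel. gauss2 w) = 2 * pi"
    proof -
      have "complex_of_real (LINT w|lborel. gauss2 w) = complex_of_real (2 * pi)"
        using gauss2_char[of 0] by (simp add: gauss2_def integral_complex_of_real)
      then show ?thesis by (simp only: of_real_eq_iff)
    qed
    ultimately show ?thesis
      by (simp only: fourier_gauss_regularization[OF f \<epsilon>]) (intro tendsto_intros, simp)
  qed
  ultimately show ?thesis
    using LIMSEQ_unique by (fastforce simp: power2_eq_square mult_ac)
qed

section \<open>Dyadic frequency bands of Sobolev functions\<close>

lemma nn_integral_powr_tail:
  fixes a R :: real
  assumes "a > 1" "R > 0"
  shows "(\<integral>\<^sup>+ r. ennreal (r powr (- a)) * indicator {R..} r \<partial>lborel) = ennreal (R powr (1 - a) / (a - 1))"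
proof -
  have "((\<lambda>r. r powr (- a)) has_integral - (R powr (- a + 1)) / (- a + 1)) {R..}"
    using assms by (intro has_integral_powr_to_inf) auto
  also have "- (R powr (- a + 1)) / (- a + 1) = R powr (1 - a) / (a - 1)"
    using assms by (simp add: field_simps)
  finally show ?thesis by (intro nn_integral_has_integral_lebesgue') simp
qed

text \<open>In polar coordinates this is the tail of a one-dimensional power integral.\<close>

lemma nn_integral_norm_powr_tail:
  assumes "\<beta> > 1" "R > 0"
  shows "(\<integral>\<^sup>+ \<xi>. ennreal (norm \<xi> powr (- 2 * \<beta>)) * indicator {\<xi>. R < norm \<xi>} \<xi> \<partial>(lborel :: (real ^ 2) measure))
    \<le> ennreal (pi / (\<beta> - 1) * R powr (- 2 * (\<beta> - 1)))"
proof -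
  have [measurable]: "{\<xi> :: real ^ 2. R < norm \<xi>} \<in> sets borel" by measurable
  have n: "norm (vector [r * cos \<phi>, r * sin \<phi>] :: real ^ 2) = r" if "r > 0" for r \<phi>
    using norm_polar[of "vector [r, \<phi>]"] that by (simp add: polar_def)
  have "(\<integral>\<^sup>+ \<xi>. ennreal (norm \<xi> powr (- 2 * \<beta>)) * indicator {\<xi>. R < norm \<xi>} \<xi> \<partial>(lborel :: (real ^ 2) measure)) =
    (\<integral>\<^sup>+ r. \<integral>\<^sup>+ \<phi>. ennreal r * indicator {0<..} r * indicator {0<..<2 * pi} \<phi> *
      (ennreal (norm (vector [r * cos \<phi>, r * sin \<phi>] :: real ^ 2) powr (- 2 * \<beta>)) *
       indicator {\<xi>. R < norm \<xi>} (vector [r * cos \<phi>, r * sin \<phi>] :: real ^ 2)) \<partial>lborel \<partial>lborel)"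
    by (subst nn_integral_polar) auto
  also have "\<dots> \<le> (\<integral>\<^sup>+ r. \<integral>\<^sup>+ \<phi>. (ennreal (r powr (- (2 * \<beta> - 1))) * indicator {R..} r) *
      indicator {0<..<2 * pi} \<phi> \<partial>lborel \<partial>lborel)"
  proof (intro nn_integral_mono)
    fix r \<phi> :: real
    show "ennreal r * indicator {0<..} r * indicator {0<..<2 * pi} \<phi> *
      (ennreal (norm (vector [r * cos \<phi>, r * sin \<phi>] :: real ^ 2) powr (- 2 * \<beta>)) *
       indicator {\<xi>. R < norm \<xi>} (vector [r * cos \<phi>, r * sin \<phi>] :: real ^ 2))
      \<le> ennreal (r powr (- (2 * \<beta> - 1))) * indicator {R..} r * indicator {0<..<2 * pi} \<phi>"
    proof (cases "r > R")
      case True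
      then have r: "r > 0" using assms by simp
      have "r * r powr (- 2 * \<beta>) = r powr (- (2 * \<beta> - 1))"
        using r powr_add[of r 1 "- 2 * \<beta>"] by simp
      then show ?thesis using r True by (auto simp: n indicator_def ennreal_mult'[symmetric])
    next
      case False
      then show ?thesis by (cases "r > 0") (auto simp: n indicator_def)
    qed
  qed
  also have "\<dots> = (\<integral>\<^sup>+ r. ennreal (r powr (- (2 * \<beta> - 1))) * indicator {R..} r \<partial>lborel) * ennreal (2 * pi)"
    by (simp add: nn_integral_cmult nn_integral_multc)
  also have "\<dots> = ennreal (R powr (1 - (2 * \<beta> - 1)) / ((2 * \<beta> - 1) - 1)) * ennreal (2 * pi)"
    using assms by (subst nn_integral_powr_tail) auto
  also have "\<dots> = ennreal (R powr (1 - (2 * \<beta> - 1)) / ((2 * \<beta> - 1) - 1) * (2 * pi))"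
    using assms by (intro ennreal_mult''[symmetric]) simp
  also have "R powr (1 - (2 * \<beta> - 1)) / ((2 * \<beta> - 1) - 1) * (2 * pi) =
      pi / (\<beta> - 1) * R powr (- 2 * (\<beta> - 1))"
    using assms by (simp add: field_simps)
  finally show ?thesis .
qed

lemma ennreal_power2_le_cancel:
  assumes "a\<^sup>2 \<le> (ennreal b)\<^sup>2"
  shows "a \<le> ennreal b"
proof (cases "0 \<le> b")
  case True
  have "a \<noteq> \<top>"
  proof
    assume "a = \<top>"
    then have "\<top> \<le> ennreal (b\<^sup>2)" 
      using assms unfolding \<open>a = \<top>\<close> ennreal_power[OF True] by (simp add: power2_eq_square[of "\<top> :: ennreal"])
    then show False by (simp add: top_unique)
  qed
  then obtain r where r: "a = ennreal r" "0 \<le> r" by (cases a) auto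
  then have "r\<^sup>2 \<le> b\<^sup>2" using assms True by (simp add: ennreal_power)
  then show ?thesis using r True by (simp add: ennreal_leI power_mono_iff)
next
  case False
  then show ?thesis using assms by (simp add: ennreal_neg)
qed

text \<open>Cauchy-Schwarz against the Sobolev weight; the dual weight is integrable at infinity in the plane exactly because
\<open>\<beta> > 1\<close>. The constant depends on \<open>\<beta>\<^sub>1\<close> only, which is what makes all later bounds uniform over an
unbounded scale of exponents.\<close>

lemma sobolev_fourier_tail:
  assumes f: "f \<in> sobolev_ball \<beta> C" and \<beta>: "\<beta>\<^sub>1 > 1" "\<beta> \<ge> \<beta>\<^sub>1" and "C > 0" "R > 0"
  shows "(\<integral>\<^sup>+ \<xi>. ennreal (cmod (fourier f \<xi>)) * indicator {\<xi>. R < norm \<xi>} \<xi> \<partial>lborel)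
    \<le> ennreal (sqrt (C * pi / (\<beta>\<^sub>1 - 1)) * R powr (- (\<beta> - 1)))" (is "?I \<le> _")
proof -
  have [measurable]: "f \<in> borel_measurable borel" using f by (auto simp: sobolev_ball_def)
  have [measurable]: "{\<xi> :: real ^ 2. R < norm \<xi>} \<in> sets borel" by measurable
  let ?w = "\<lambda>\<xi> :: real ^ 2. 1 + (norm \<xi>)\<^sup>2"
  let ?u = "\<lambda>\<xi>. ennreal (?w \<xi> powr (\<beta> / 2) * cmod (fourier f \<xi>))"
  let ?v = "\<lambda>\<xi>. ennreal (?w \<xi> powr (- \<beta> / 2)) * indicator {\<xi>. R < norm \<xi>} \<xi>"
  have w: "?w \<xi> > 0" for \<xi> by (simp add: add_pos_nonneg)
  have "?u \<xi> * ?v \<xi> = ennreal (cmod (fourier f \<xi>)) * indicator {\<xi>. R < norm \<xi>} \<xi>" for \<xi>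
  proof -
    have "(?w \<xi> powr (\<beta> / 2) * cmod (fourier f \<xi>)) * ?w \<xi> powr (- \<beta> / 2) = cmod (fourier f \<xi>)"
      using w[of \<xi>] by (simp add: powr_minus field_simps)
    moreover have "?u \<xi> * ennreal (?w \<xi> powr (- \<beta> / 2)) =
        ennreal ((?w \<xi> powr (\<beta> / 2) * cmod (fourier f \<xi>)) * ?w \<xi> powr (- \<beta> / 2))"
      by (rule ennreal_mult''[symmetric]) simp
    ultimately show ?thesis by (simp only: mult.assoc[symmetric])
  qed
  then have "?I\<^sup>2 = (\<integral>\<^sup>+ \<xi>. ?u \<xi> * ?v \<xi> \<partial>lborel)\<^sup>2" by simp
  also have "\<dots> \<le> (\<integral>\<^sup>+ \<xi>. (?u \<xi>)\<^sup>2 \<partial>lborel) * (\<integral>\<^sup>+ \<xi>. (?v \<xi>)\<^sup>2 \<partial>lborel)"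
    by (rule Cauchy_Schwarz_nn_integral) auto
  also have "\<dots> \<le> ennreal C * ennreal (pi / (\<beta> - 1) * R powr (- 2 * (\<beta> - 1)))"
  proof (rule mult_mono)
    have "(?w \<xi> powr (\<beta> / 2))\<^sup>2 = ?w \<xi> powr \<beta>" for \<xi>
      using w[of \<xi>] by (simp add: powr_power)
    then have "(?u \<xi>)\<^sup>2 = ennreal (?w \<xi> powr \<beta> * (cmod (fourier f \<xi>))\<^sup>2)" for \<xi>
      by (simp add: ennreal_power power_mult_distrib)
    then show "(\<integral>\<^sup>+ \<xi>. (?u \<xi>)\<^sup>2 \<partial>lborel) \<le> ennreal C"
      using f by (simp add: sobolev_ball_def)
    have "(?v \<xi>)\<^sup>2 \<le> ennreal (norm \<xi> powr (- 2 * \<beta>)) * indicator {\<xi>. R < norm \<xi>} \<xi>" for \<xi>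
    proof (cases "R < norm \<xi>")
      case True
      then have n: "norm \<xi> > 0" using \<open>R > 0\<close> by linarith
      have "(?w \<xi> powr (- \<beta> / 2))\<^sup>2 = ?w \<xi> powr (- \<beta>)"
        using w[of \<xi>] by (simp add: powr_power)
      also have "\<dots> \<le> ((norm \<xi>)\<^sup>2) powr (- \<beta>)"
        using n assms by (intro powr_mono2') auto
      also have "((norm \<xi>)\<^sup>2) powr (- \<beta>) = norm \<xi> powr (- 2 * \<beta>)"
        using n powr_powr[of "norm \<xi>" 2 "- \<beta>"] by simp
      finally show ?thesis using True
        by (simp add: power_mult_distrib ennreal_power ennreal_leI)
    qed simp
    then have "(\<integral>\<^sup>+ \<xi>. (?v \<xi>)\<^sup>2 \<partial>lborel) \<le>
        (\<integral>\<^sup>+ \<xi>. ennreal (norm \<xi> powr (- 2 * \<beta>)) * indicator {\<xi>. R < norm \<xi>} \<xi> \<partial>(lborel :: (real ^ 2) measure))"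
      by (rule nn_integral_mono)
    also have "\<dots> \<le> ennreal (pi / (\<beta> - 1) * R powr (- 2 * (\<beta> - 1)))"
      using assms by (intro nn_integral_norm_powr_tail) auto
    finally show "(\<integral>\<^sup>+ \<xi>. (?v \<xi>)\<^sup>2 \<partial>lborel) \<le> ennreal (pi / (\<beta> - 1) * R powr (- 2 * (\<beta> - 1)))" .
  qed auto
  also have "\<dots> = ennreal (C * (pi / (\<beta> - 1) * R powr (- 2 * (\<beta> - 1))))"
    using assms by (intro ennreal_mult[symmetric]) auto
  also have "\<dots> \<le> ennreal ((sqrt (C * pi / (\<beta>\<^sub>1 - 1)) * R powr (- (\<beta> - 1)))\<^sup>2)"
  proof (rule ennreal_leI)
    have R2: "(R powr (- (\<beta> - 1)))\<^sup>2 = R powr (- 2 * (\<beta> - 1))"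
      using assms by (simp add: powr_power algebra_simps)
    have sq: "(sqrt (C * pi / (\<beta>\<^sub>1 - 1)))\<^sup>2 = C * pi / (\<beta>\<^sub>1 - 1)"
      using assms by simp
    have "C * (pi / (\<beta> - 1) * R powr (- 2 * (\<beta> - 1))) =
        C * pi / (\<beta> - 1) * R powr (- 2 * (\<beta> - 1))" by simp
    also have "\<dots> \<le> C * pi / (\<beta>\<^sub>1 - 1) * R powr (- 2 * (\<beta> - 1))"
      using assms by (intro mult_right_mono divide_left_mono) auto
    also have "\<dots> = (sqrt (C * pi / (\<beta>\<^sub>1 - 1)) * R powr (- (\<beta> - 1)))\<^sup>2"
      by (simp only: power_mult_distrib R2 sq)
    finally show "C * (pi / (\<beta> - 1) * R powr (- 2 * (\<beta> - 1))) \<le>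
        (sqrt (C * pi / (\<beta>\<^sub>1 - 1)) * R powr (- (\<beta> - 1)))\<^sup>2" .
  qed
  finally have "?I\<^sup>2 \<le> (ennreal (sqrt (C * pi / (\<beta>\<^sub>1 - 1)) * R powr (- (\<beta> - 1))))\<^sup>2"
    using assms by (simp add: ennreal_power)
  then show ?thesis by (rule ennreal_power2_le_cancel)
qed

lemma fourier_bound:
  assumes "integrable lborel f"
  shows "cmod (fourier f \<xi>) \<le> (LINT y|lborel. \<bar>f y\<bar>)"
  unfolding fourier_def
  by (rule order_trans[OF integral_norm_bound]) (simp add: norm_mult)

lemma sobolev_fourier_integrable:
  assumes f: "f \<in> sobolev_ball \<beta> C" and "\<beta> > 1" "C > 0"
  shows "integrable lborel (fourier f)"
proof (rule integrableI_bounded)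
  have fi: "integrable lborel f" using f by (simp add: sobolev_ball_def)
  then have [measurable]: "f \<in> borel_measurable borel" by auto
  have [measurable]: "{\<xi> :: real ^ 2. 1 < norm \<xi>} \<in> sets borel" by measurable
  have [measurable]: "cball (0 :: real ^ 2) 1 \<in> sets borel" by simp
  let ?M = "LINT y|lborel. \<bar>f y\<bar>"
  have "(\<integral>\<^sup>+ \<xi>. ennreal (cmod (fourier f \<xi>)) \<partial>lborel) \<le>
      (\<integral>\<^sup>+ \<xi>. ennreal (cmod (fourier f \<xi>)) * indicator {\<xi>. 1 < norm \<xi>} \<xi> +
        ennreal ?M * indicator (cball 0 1) \<xi> \<partial>lborel)"
    using fourier_bound[OF fi] by (intro nn_integral_mono) (auto simp: indicator_def ennreal_leI)
  also have "\<dots> = (\<integral>\<^sup>+ \<xi>. ennreal (cmod (fourier f \<xi>)) * indicator {\<xi>. 1 < norm \<xi>} \<xi> \<partial>lborel) +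
        ennreal ?M * emeasure lborel (cball (0 :: real ^ 2) 1)"
    by (subst nn_integral_add) (auto simp: nn_integral_cmult)
  also have "\<dots> < \<infinity>"
  proof -
    have "(\<integral>\<^sup>+ \<xi>. ennreal (cmod (fourier f \<xi>)) * indicator {\<xi>. 1 < norm \<xi>} \<xi> \<partial>lborel) < \<infinity>"
      using sobolev_fourier_tail[OF f \<open>\<beta> > 1\<close> order_refl \<open>C > 0\<close>, of 1]
      by (simp add: le_less_trans)
    moreover have "emeasure lborel (cball (0 :: real ^ 2) 1) < \<infinity>"
      by (rule emeasure_bounded_finite) simp
    ultimately show ?thesis by (simp add: ennreal_mult_less_top)
  qed
  finally show "(\<integral>\<^sup>+ \<xi>. ennreal (norm (fourier f \<xi>)) \<partial>lborel) < \<infinity>" .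
qed (use f in \<open>auto simp: sobolev_ball_def\<close>)

definition band :: "nat \<Rightarrow> (real ^ 2) set" where
  "band j = {\<xi>. (if j = 0 then 0 \<le> norm \<xi> else 2 ^ (j - 1) < norm \<xi>) \<and> norm \<xi> \<le> 2 ^ j}"

lemma band_sets [measurable]: "band j \<in> sets borel"
  unfolding band_def by measurable

text \<open>The contribution of the band to \<open>f x\<close> in the Fourier inversion formula.\<close>

definition band_part :: "(real ^ 2 \<Rightarrow> real) \<Rightarrow> real ^ 2 \<Rightarrow> nat \<Rightarrow> real" where
  "band_part f x j = Re (LINT \<xi>|lborel. indicator (band j) \<xi> *\<^sub>R (fourier f \<xi> * cis (x \<bullet> \<xi>))) / (2 * pi)\<^sup>2"

lemma sum_indicator_band:
  "m \<le> n \<Longrightarrow> (\<Sum>j\<in>{m<..n}. indicator (band j) \<xi> :: real) = indicator {\<xi>. 2 ^ m < norm \<xi> \<and> norm \<xi> \<le> 2 ^ n} \<xi>"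
proof (induction n rule: dec_induct)
  case base
  then show ?case by (auto simp: indicator_def)
next
  case (step n)
  have eq: "{m<..Suc n} = insert (Suc n) {m<..n}" using step.hyps by auto
  have "(\<Sum>j\<in>{m<..Suc n}. indicator (band j) \<xi> :: real) =
      indicator (band (Suc n)) \<xi> + (\<Sum>j\<in>{m<..n}. indicator (band j) \<xi>)"
    unfolding eq by (rule sum.insert) auto
  also have "\<dots> = indicator (band (Suc n)) \<xi> + indicator {\<xi>. 2 ^ m < norm \<xi> \<and> norm \<xi> \<le> 2 ^ n} \<xi>"
    by (simp only: step.IH)
  also have "\<dots> = indicator {\<xi>. 2 ^ m < norm \<xi> \<and> norm \<xi> \<le> 2 ^ Suc n} \<xi>"
  proof -
    have "(2 :: real) ^ m \<le> 2 ^ n" "(2 :: real) ^ n \<le> 2 ^ Suc n"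
      using step.hyps by (auto intro: power_increasing)
    then have "norm \<xi> \<le> 2 ^ n \<Longrightarrow> norm \<xi> \<le> 2 ^ Suc n" "2 ^ n < norm \<xi> \<Longrightarrow> 2 ^ m < norm \<xi>"
      by linarith+
    then show ?thesis by (auto simp: band_def indicator_def)
  qed
  finally show ?case .
qed

text \<open>The bands above level \<open>m\<close> and the remainder above level \<open>J\<close> split the frequencies
beyond \<open>2^m\<close>, so a single tail integral bounds the sum of all their contributions. Adding up geometric series
instead would produce constants that depend on \<open>\<beta>\<close>.\<close>

lemma band_approximation:
  assumes f: "f \<in> smooth_class C L \<beta>" and \<beta>: "\<beta>\<^sub>1 > 1" "\<beta> \<ge> \<beta>\<^sub>1" and "C > 0" and "m \<le> J"
  shows "\<bar>f x - (\<Sum>j\<le>J. band_part f x j)\<bar> + (\<Sum>j\<in>{m<..J}. \<bar>band_part f x j\<bar>)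
    \<le> sqrt (C * pi / (\<beta>\<^sub>1 - 1)) * (2 ^ m) powr (- (\<beta> - 1))"
proof -
  have fs: "f \<in> sobolev_ball \<beta> C" and fb: "\<And>y. \<bar>f y\<bar> \<le> L" and fc: "isCont f x"
    using f by (auto simp: smooth_class_def bounded_class_def continuous_on_eq_continuous_at)
  have fi: "integrable lborel f" using fs by (simp add: sobolev_ball_def)
  then have [measurable]: "f \<in> borel_measurable borel" by auto
  have ff: "integrable lborel (fourier f)" using sobolev_fourier_integrable[OF fs] assms by simp
  let ?h = "\<lambda>\<xi>. fourier f \<xi> * cis (x \<bullet> \<xi>)"
  let ?A = "\<lambda>S. (LINT \<xi>|lborel. indicator S \<xi> * cmod (fourier f \<xi>))"
  have hi: "integrable lborel (\<lambda>\<xi>. indicator S \<xi> *\<^sub>R ?h \<xi>)" if [measurable]: "S \<in> sets borel" for S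
    by (rule Bochner_Integration.integrable_bound[OF ff]) (auto simp: norm_mult indicator_def)
  have ai: "integrable lborel (\<lambda>\<xi>. indicator S \<xi> * cmod (fourier f \<xi>))" if [measurable]: "S \<in> sets borel" for S
    by (rule Bochner_Integration.integrable_bound[OF ff]) (auto simp: indicator_def)
  have bound: "\<bar>Re (LINT \<xi>|lborel. indicator S \<xi> *\<^sub>R ?h \<xi>)\<bar> \<le> ?A S" if "S \<in> sets borel" for S
  proof -
    have "\<bar>Re (LINT \<xi>|lborel. indicator S \<xi> *\<^sub>R ?h \<xi>)\<bar> \<le> cmod (LINT \<xi>|lborel. indicator S \<xi> *\<^sub>R ?h \<xi>)"
      by (rule abs_Re_le_cmod)
    also have "\<dots> \<le> (LINT \<xi>|lborel. norm (indicator S \<xi> *\<^sub>R ?h \<xi>))" by (rule integral_norm_bound)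
    finally show ?thesis by (simp add: norm_mult)
  qed
  define E where "E = {\<xi> :: real ^ 2. 2 ^ J < norm \<xi>}"
  define T where "T = {\<xi> :: real ^ 2. 2 ^ m < norm \<xi>}"
  have [measurable]: "E \<in> sets borel" "T \<in> sets borel" unfolding E_def T_def by measurable
  have split: "(\<Sum>j\<le>J. indicator (band j) \<xi> :: real) + indicator E \<xi> = 1" for \<xi>
  proof -
    have "{..J} = insert 0 {0<..J}" by auto
    then have "(\<Sum>j\<le>J. indicator (band j) \<xi> :: real) = indicator (band 0) \<xi> +
        (\<Sum>j\<in>{0<..J}. indicator (band j) \<xi>)"
      by (metis (no_types, lifting) finite_greaterThanAtMost greaterThanAtMost_iff less_irrefl sum.insert)
    also have "\<dots> = indicator (band 0) \<xi> + indicator {\<xi>. 2 ^ 0 < norm \<xi> \<and> norm \<xi> \<le> 2 ^ J} \<xi>"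
      by (subst sum_indicator_band) auto
    finally have eq: "(\<Sum>j\<le>J. indicator (band j) \<xi> :: real) = indicator (band 0) \<xi> +
        indicator {\<xi>. 2 ^ 0 < norm \<xi> \<and> norm \<xi> \<le> 2 ^ J} \<xi>" .
    have "(1::real) \<le> 2 ^ J" by simp
    then have "1 < norm \<xi>" if "2 ^ J < norm \<xi>" using that by linarith
    then show ?thesis unfolding eq by (auto simp: band_def indicator_def E_def)
  qed
  have "(2 * pi)\<^sup>2 * f x = Re (LINT \<xi>|lborel. ?h \<xi>)"
    by (subst fourier_inversion[OF fi fb fc ff]) simp
  also have "(LINT \<xi>|lborel. ?h \<xi>) = (LINT \<xi>|lborel. (\<Sum>j\<le>J. indicator (band j) \<xi> *\<^sub>R ?h \<xi>) + indicator E \<xi> *\<^sub>R ?h \<xi>)"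
    by (intro Bochner_Integration.integral_cong refl)
      (simp add: scaleR_sum_left[symmetric] scaleR_add_left[symmetric] split)
  also have "\<dots> = (\<Sum>j\<le>J. LINT \<xi>|lborel. indicator (band j) \<xi> *\<^sub>R ?h \<xi>) + (LINT \<xi>|lborel. indicator E \<xi> *\<^sub>R ?h \<xi>)"
    by (subst Bochner_Integration.integral_add, rule Bochner_Integration.integrable_sum, rule hi, simp,
        rule hi, simp, subst Bochner_Integration.integral_sum, rule hi) simp_all
  finally have "f x - (\<Sum>j\<le>J. band_part f x j) = Re (LINT \<xi>|lborel. indicator E \<xi> *\<^sub>R ?h \<xi>) / (2 * pi)\<^sup>2"
    by (simp add: band_part_def sum_divide_distrib[symmetric] field_simps)
  then have "\<bar>f x - (\<Sum>j\<le>J. band_part f x j)\<bar> \<le> ?A E / (2 * pi)\<^sup>2"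
    using bound[of E] by (simp add: divide_right_mono)
  moreover have "\<bar>band_part f x j\<bar> \<le> ?A (band j) / (2 * pi)\<^sup>2" for j
    using bound[of "band j"] by (simp add: band_part_def divide_right_mono)
  then have "(\<Sum>j\<in>{m<..J}. \<bar>band_part f x j\<bar>) \<le> (\<Sum>j\<in>{m<..J}. ?A (band j) / (2 * pi)\<^sup>2)"
    by (intro sum_mono)
  ultimately have "\<bar>f x - (\<Sum>j\<le>J. band_part f x j)\<bar> + (\<Sum>j\<in>{m<..J}. \<bar>band_part f x j\<bar>)
    \<le> (?A E + (\<Sum>j\<in>{m<..J}. ?A (band j))) / (2 * pi)\<^sup>2"
    by (simp add: add_divide_distrib sum_divide_distrib)
  also have "?A E + (\<Sum>j\<in>{m<..J}. ?A (band j)) =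
      (LINT \<xi>|lborel. indicator E \<xi> * cmod (fourier f \<xi>) + (\<Sum>j\<in>{m<..J}. indicator (band j) \<xi> * cmod (fourier f \<xi>)))"
    by (subst Bochner_Integration.integral_add, rule ai, simp, rule Bochner_Integration.integrable_sum,
        rule ai, simp, subst Bochner_Integration.integral_sum, rule ai) simp_all
  also have "\<dots> = ?A T"
  proof (intro Bochner_Integration.integral_cong refl)
    fix \<xi> :: "real ^ 2"
    have "(2 :: real) ^ m \<le> 2 ^ J" using assms by (intro power_increasing) auto
    then have "2 ^ m < norm \<xi>" if "2 ^ J < norm \<xi>" using that by linarith
    then have "indicator E \<xi> + (\<Sum>j\<in>{m<..J}. indicator (band j) \<xi>) = (indicator T \<xi> :: real)"
      using assms by (subst sum_indicator_band) (auto simp: E_def T_def indicator_def)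
    then show "indicator E \<xi> * cmod (fourier f \<xi>) + (\<Sum>j\<in>{m<..J}. indicator (band j) \<xi> * cmod (fourier f \<xi>)) =
        indicator T \<xi> * cmod (fourier f \<xi>)"
      by (simp add: sum_distrib_right[symmetric] distrib_right[symmetric])
  qed
  also have "?A T / (2 * pi)\<^sup>2 \<le> ?A T"
  proof -
    have "1 \<le> (2 * pi)\<^sup>2" using pi_ge_two by (intro one_le_power) auto
    moreover have "0 \<le> ?A T" by (intro Bochner_Integration.integral_nonneg) simp
    ultimately have "?A T / (2 * pi)\<^sup>2 \<le> ?A T / 1" by (intro divide_left_mono) auto
    then show ?thesis by simp
  qed
  also have "?A T \<le> sqrt (C * pi / (\<beta>\<^sub>1 - 1)) * (2 ^ m) powr (- (\<beta> - 1))"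
  proof -
    have "ennreal (?A T) = (\<integral>\<^sup>+ \<xi>. ennreal (indicator T \<xi> * cmod (fourier f \<xi>)) \<partial>lborel)"
      by (rule nn_integral_eq_integral[symmetric]) (auto intro!: ai)
    also have "\<dots> = (\<integral>\<^sup>+ \<xi>. ennreal (cmod (fourier f \<xi>)) * indicator {\<xi>. 2 ^ m < norm \<xi>} \<xi> \<partial>lborel)"
      by (intro nn_integral_cong) (auto simp: T_def indicator_def)
    also have "\<dots> \<le> ennreal (sqrt (C * pi / (\<beta>\<^sub>1 - 1)) * (2 ^ m) powr (- (\<beta> - 1)))"
      using assms by (intro sobolev_fourier_tail[OF fs]) auto
    finally show ?thesis using assms by (subst (asm) ennreal_le_iff) auto
  qed
  finally show ?thesis by simp
qed

section \<open>Reconstruction kernels\<close>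

text \<open>The ramp filter of filtered back projection restricted to the frequencies \<open>r = sqrt (\<rho>\<^sup>2 + \<mu>\<^sup>2)\<close> with
\<open>a < \<rho> \<le> b\<close>; note \<open>\<rho> d\<rho> = r dr\<close>. In terms of \<open>\<rho>\<close> the missing frequencies below
\<open>\<bar>\<mu>\<bar>\<close> need no separate treatment.\<close>

definition radon_kernel :: "real \<Rightarrow> real \<Rightarrow> real \<Rightarrow> real \<Rightarrow> real" where
  "radon_kernel \<mu> a b s = (LINT \<rho>|lborel. indicator {a<..b} \<rho> * (\<rho> * cos (sqrt (\<rho>\<^sup>2 + \<mu>\<^sup>2) * s)))"

lemma radon_kernel_measurable [measurable]: "radon_kernel \<mu> a b \<in> borel_measurable borel"
  unfolding radon_kernel_def[abs_def] by measurable

lemma integrable_indicator_interval [simp]: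
  fixes a b :: real
  shows "integrable lborel (indicator {a<..b} :: real \<Rightarrow> real)"
    "integrable lborel (indicator {a..b} :: real \<Rightarrow> real)"
  by (cases "a \<le> b", auto intro!: integrable_real_indicator)+

lemma abs_radon_kernel_le:
  assumes "0 \<le> a" "a \<le> b"
  shows "\<bar>radon_kernel \<mu> a b s\<bar> \<le> b\<^sup>2"
proof -
  have "\<bar>radon_kernel \<mu> a b s\<bar> \<le> (LINT \<rho>|lborel. \<bar>indicator {a<..b} \<rho> * (\<rho> * cos (sqrt (\<rho>\<^sup>2 + \<mu>\<^sup>2) * s))\<bar>)"
    unfolding radon_kernel_def by (rule integral_abs_bound)
  also have "\<dots> \<le> (LINT \<rho>|lborel. indicator {a<..b} \<rho> * b)"
  proof (rule integral_mono')
    show "integrable lborel (\<lambda>\<rho>. indicator {a<..b} \<rho> * b)" by simp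
    fix \<rho>
    show "\<bar>indicator {a<..b} \<rho> * (\<rho> * cos (sqrt (\<rho>\<^sup>2 + \<mu>\<^sup>2) * s))\<bar> \<le> indicator {a<..b} \<rho> * b"
    proof (cases "\<rho> \<in> {a<..b}")
      case True
      then have "\<bar>\<rho>\<bar> * \<bar>cos (sqrt (\<rho>\<^sup>2 + \<mu>\<^sup>2) * s)\<bar> \<le> b * 1"
        using assms by (intro mult_mono) auto
      then show ?thesis using True by (simp add: abs_mult)
    qed simp
  qed (use assms in auto)
  also have "\<dots> \<le> b * b" using assms by (simp add: mult_right_mono)
  finally show ?thesis by (simp add: power2_eq_square)
qed

text \<open>The substitution \<open>r = sqrt (\<rho>\<^sup>2 + \<mu>\<^sup>2)\<close> makes the integrand \<open>r * cos (r * s)\<close>, which has an explicit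
primitive; its boundary terms are of size \<open>r / s\<close>.\<close>

lemma radon_kernel_decay:
  assumes "0 \<le> a" "a \<le> b"
  shows "\<bar>s\<bar> * \<bar>radon_kernel \<mu> a b s\<bar> \<le> 3 * sqrt (b\<^sup>2 + \<mu>\<^sup>2)"
proof (cases "s = 0")
  case False
  let ?r = "\<lambda>\<rho>. sqrt (\<rho>\<^sup>2 + \<mu>\<^sup>2)"
  let ?F = "\<lambda>\<rho>. ?r \<rho> * sin (?r \<rho> * s) / s + cos (?r \<rho> * s) / s\<^sup>2"
  let ?f = "\<lambda>\<rho>. \<rho> * cos (?r \<rho> * s)"
  have "(?f has_integral ?F b - ?F a) {a..b}"
  proof (rule fundamental_theorem_of_calculus_interior[OF assms(2)])
    show "continuous_on {a..b} ?F" using False by (intro continuous_intros) auto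
    fix \<rho> assume "\<rho> \<in> {a<..<b}"
    then have pos: "\<rho>\<^sup>2 + \<mu>\<^sup>2 > 0" using assms by (simp add: add_pos_nonneg)
    have "(?F has_field_derivative ?f \<rho>) (at \<rho>)"
      using False pos by (auto intro!: derivative_eq_intros simp: field_simps power2_eq_square)
    then show "(?F has_vector_derivative ?f \<rho>) (at \<rho>)"
      by (simp add: has_real_derivative_iff_has_vector_derivative)
  qed
  moreover have si: "set_integrable lborel {a..b} ?f"
    by (intro borel_integrable_atLeastAtMost' continuous_intros)
  ultimately have "(LINT \<rho>:{a..b}|lborel. ?f \<rho>) = ?F b - ?F a"
    using set_borel_integral_eq_integral(2)[OF si] by (simp add: integral_unique)
  moreover have "radon_kernel \<mu> a b s = (LINT \<rho>:{a..b}|lborel. ?f \<rho>)"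
    unfolding radon_kernel_def set_lebesgue_integral_def
  proof (rule integral_cong_AE)
    have "AE \<rho> in lborel. \<rho> \<noteq> a" by (rule AE_lborel_singleton)
    then show "AE \<rho> in lborel. indicator {a<..b} \<rho> * ?f \<rho> = indicator {a..b} \<rho> *\<^sub>R ?f \<rho>"
      by eventually_elim (auto simp: indicator_def)
  qed auto
  ultimately have k: "radon_kernel \<mu> a b s = ?F b - ?F a" by simp
  have mono: "?r a \<le> ?r b" "0 \<le> ?r a" using assms by (auto intro!: real_sqrt_le_mono power_mono)
  have "\<bar>cos (?r b * s) - cos (?r a * s)\<bar> \<le> \<bar>?r b * s - ?r a * s\<bar>"
  proof -
    have "\<bar>cos (?r b * s) - cos (?r a * s)\<bar> =
        2 * \<bar>sin ((?r b * s + ?r a * s) / 2)\<bar> * \<bar>sin ((?r a * s - ?r b * s) / 2)\<bar>"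
      by (simp add: cos_diff_cos abs_mult)
    also have "\<dots> \<le> 2 * 1 * \<bar>(?r a * s - ?r b * s) / 2\<bar>"
      by (intro mult_mono abs_sin_x_le_abs_x) auto
    finally show ?thesis by (simp add: abs_minus_commute)
  qed
  also have "\<dots> = (?r b - ?r a) * \<bar>s\<bar>"
    using mono by (simp add: abs_mult flip: left_diff_distrib)
  finally have c: "\<bar>cos (?r b * s) - cos (?r a * s)\<bar> \<le> (?r b - ?r a) * \<bar>s\<bar>" .
  have "s * radon_kernel \<mu> a b s = ?r b * sin (?r b * s) - ?r a * sin (?r a * s) +
      (cos (?r b * s) - cos (?r a * s)) / s"
    using False by (simp add: k field_simps power2_eq_square)
  then have "\<bar>s * radon_kernel \<mu> a b s\<bar> \<le> \<bar>?r b * sin (?r b * s)\<bar> + \<bar>?r a * sin (?r a * s)\<bar> +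
      \<bar>(cos (?r b * s) - cos (?r a * s)) / s\<bar>" by linarith
  also have "\<bar>?r b * sin (?r b * s)\<bar> \<le> ?r b"
    using abs_sin_le_one[of "?r b * s"] by (simp add: abs_mult mult_left_le)
  also have "\<bar>?r a * sin (?r a * s)\<bar> \<le> ?r a"
    using abs_sin_le_one[of "?r a * s"] by (simp add: abs_mult mult_left_le)
  also have "\<bar>(cos (?r b * s) - cos (?r a * s)) / s\<bar> \<le> ?r b - ?r a"
    using c False by (simp add: field_simps)
  finally have "\<bar>s * radon_kernel \<mu> a b s\<bar> \<le> 2 * ?r b" by simp
  moreover have "0 \<le> ?r b" by simp
  ultimately show ?thesis unfolding abs_mult[symmetric] by linarith
qed simp

text \<open>Combines the bound near zero with the decay at infinity into one function whose primitive is an arctangent.\<close>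

lemma radon_kernel_square_le:
  fixes a b \<mu> :: real
  assumes "0 \<le> a" "a \<le> b" "b > 0"
  defines "B \<equiv> sqrt (b\<^sup>2 + \<mu>\<^sup>2)"
  shows "(radon_kernel \<mu> a b s)\<^sup>2 \<le> 18 * B ^ 4 * inverse (1 + (B * s)\<^sup>2)"
proof -
  let ?k = "radon_kernel \<mu> a b s"
  have B: "B > 0" "b\<^sup>2 \<le> B\<^sup>2" using assms by (auto simp: B_def add_pos_nonneg)
  have "\<bar>?k\<bar> \<le> B\<^sup>2" using abs_radon_kernel_le[OF assms(1,2), of \<mu> s] B by linarith
  then have "\<bar>?k\<bar>\<^sup>2 \<le> (B\<^sup>2)\<^sup>2" by (intro power_mono) auto
  moreover have "(\<bar>s\<bar> * \<bar>?k\<bar>)\<^sup>2 \<le> (3 * B)\<^sup>2"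
    using radon_kernel_decay[OF assms(1,2), of s \<mu>] by (intro power_mono) (auto simp: B_def)
  then have "B\<^sup>2 * (s\<^sup>2 * ?k\<^sup>2) \<le> B\<^sup>2 * (9 * B\<^sup>2)"
    by (intro mult_left_mono) (auto simp: power_mult_distrib)
  ultimately have "?k\<^sup>2 * (1 + (B * s)\<^sup>2) \<le> 10 * B ^ 4"
    by (simp add: algebra_simps power_mult_distrib flip: power_mult power_add)
  also have "\<dots> \<le> 18 * B ^ 4" by simp
  finally show ?thesis
    using B by (simp add: field_simps add_pos_nonneg)
qed

text \<open>The cube of the cutoff frequency, rather than the fourth power that the supremum bound would give, is
the variance that leads to the rate.\<close>

lemma nn_integral_radon_kernel_square:
  fixes a b \<mu> :: real
  assumes "0 \<le> a" "a \<le> b" "b > 0"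
  defines "B \<equiv> sqrt (b\<^sup>2 + \<mu>\<^sup>2)"
  shows "(\<integral>\<^sup>+ s. ennreal ((radon_kernel \<mu> a b (c - s))\<^sup>2) * indicator {-1..1} s \<partial>lborel) \<le> ennreal (18 * pi * B ^ 3)"
proof -
  have B: "B > 0" using assms by (auto simp: B_def add_pos_nonneg)
  let ?G = "\<lambda>s. - (18 * B ^ 3 * arctan (B * (c - s)))"
  let ?g = "\<lambda>s. 18 * B ^ 4 * inverse (1 + (B * (c - s))\<^sup>2)"
  have "(?g has_integral ?G 1 - ?G (-1)) {-1..1}"
  proof (rule fundamental_theorem_of_calculus)
    fix s :: real
    have "(?G has_field_derivative ?g s) (at s within {-1..1})"
      by (auto intro!: derivative_eq_intros simp: power_numeral_reduce)
    then show "(?G has_vector_derivative ?g s) (at s within {-1..1})"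
      by (simp add: has_real_derivative_iff_has_vector_derivative)
  qed simp
  then have I: "(\<integral>\<^sup>+ s. ennreal (?g s) * indicator {-1..1} s \<partial>lborel) = ennreal (?G 1 - ?G (-1))"
    using B by (intro nn_integral_has_integral_lebesgue') (auto simp: add_nonneg_nonneg)
  have "(\<integral>\<^sup>+ s. ennreal ((radon_kernel \<mu> a b (c - s))\<^sup>2) * indicator {-1..1} s \<partial>lborel) \<le>
      (\<integral>\<^sup>+ s. ennreal (?g s) * indicator {-1..1} s \<partial>lborel)"
    using radon_kernel_square_le[OF assms(1-3), of \<mu>]
    by (intro nn_integral_mono mult_right_mono ennreal_leI) (auto simp: B_def)
  also have "\<dots> \<le> ennreal (18 * pi * B ^ 3)" unfolding I
  proof (rule ennreal_leI)
    have "arctan (B * (c + 1)) - arctan (B * (c - 1)) \<le> pi"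
      using arctan_bounded[of "B * (c + 1)"] arctan_bounded[of "B * (c - 1)"] by linarith
    then have "18 * B ^ 3 * (arctan (B * (c + 1)) - arctan (B * (c - 1))) \<le> 18 * B ^ 3 * pi"
      using B by (intro mult_left_mono) auto
    then show "?G 1 - ?G (-1) \<le> 18 * pi * B ^ 3" by (simp add: algebra_simps)
  qed
  finally show ?thesis .
qed

lemma integrable_pair_bound:
  fixes u :: "'a :: euclidean_space \<Rightarrow> real" and v :: "'b :: euclidean_space \<Rightarrow> real"
    and g :: "'a \<times> 'b \<Rightarrow> 'c :: {banach, second_countable_topology}"
  assumes u: "integrable lborel u" and v: "integrable lborel v"
    and g: "g \<in> borel_measurable (lborel \<Otimes>\<^sub>M lborel)" and bound: "\<And>x y. norm (g (x, y)) \<le> \<bar>u x\<bar> * \<bar>v y\<bar>"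
  shows "integrable (lborel \<Otimes>\<^sub>M lborel) g"
proof -
  have [measurable]: "u \<in> borel_measurable borel" "v \<in> borel_measurable borel" using u v by auto
  have "integrable (lborel \<Otimes>\<^sub>M lborel) (\<lambda>(x, y). \<bar>u x\<bar> * \<bar>v y\<bar>)"
    by (rule lborel_pair.Fubini_integrable) (auto simp: u v)
  then show ?thesis
    by (rule Bochner_Integration.integrable_bound[OF _ g]) (auto simp: bound abs_mult)
qed

text \<open>The weight of an observation in the back projection. The exponential factor is that of the transform with
\<open>- \<mu>\<close>, the adjoint that undoes the weight of the data at \<open>x\<close>.\<close>

definition radon_weight :: "real \<Rightarrow> real ^ 2 \<Rightarrow> real \<Rightarrow> real \<Rightarrow> real ^ 2 \<Rightarrow> real \<Rightarrow> real" where
  "radon_weight \<mu> x a b \<theta> s = exp (- \<mu> * (x \<bullet> perp \<theta>)) * radon_kernel \<mu> a b (x \<bullet> \<theta> - s) / pi"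

lemma radon_weight_measurable [measurable (raw)]:
  assumes [measurable]: "p \<in> borel_measurable M" "q \<in> borel_measurable M"
  shows "(\<lambda>z. radon_weight \<mu> x a b (p z) (q z)) \<in> borel_measurable M"
  unfolding radon_weight_def by measurable

lemma norm_perp: "norm (perp \<theta>) = norm \<theta>"
  by (simp add: norm_vec2 perp_simps add.commute)

lemma exp_weight_le:
  assumes "norm y \<le> 1" "norm \<theta> = 1"
  shows "exp (\<nu> * (y \<bullet> perp \<theta>)) \<le> exp \<bar>\<nu>\<bar>"
proof -
  have "\<bar>y \<bullet> perp \<theta>\<bar> \<le> norm y * norm (perp \<theta>)" by (rule Cauchy_Schwarz_ineq2)
  then have "\<bar>y \<bullet> perp \<theta>\<bar> \<le> 1" using assms by (simp add: norm_perp)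
  then have "\<bar>\<nu>\<bar> * \<bar>y \<bullet> perp \<theta>\<bar> \<le> \<bar>\<nu>\<bar> * 1" by (intro mult_left_mono) auto
  then have "\<nu> * (y \<bullet> perp \<theta>) \<le> \<bar>\<nu>\<bar>"
    by (metis abs_ge_self abs_mult mult.right_neutral order_trans)
  then show ?thesis by simp
qed

lemma abs_radon_weight_le:
  assumes "norm x \<le> 1" "norm \<theta> = 1" "0 \<le> a" "a \<le> b"
  shows "\<bar>radon_weight \<mu> x a b \<theta> s\<bar> \<le> exp \<bar>\<mu>\<bar> * b\<^sup>2"
proof -
  have "\<bar>radon_weight \<mu> x a b \<theta> s\<bar> = exp (- \<mu> * (x \<bullet> perp \<theta>)) * \<bar>radon_kernel \<mu> a b (x \<bullet> \<theta> - s)\<bar> / pi"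
    by (simp add: radon_weight_def abs_mult)
  also have "\<dots> \<le> (exp \<bar>\<mu>\<bar> * b\<^sup>2) / 1"
    using exp_weight_le[OF assms(1,2), of "- \<mu>"] abs_radon_kernel_le[OF assms(3,4)] pi_ge_two
    by (intro frac_le mult_mono) auto
  finally show ?thesis by simp
qed

section \<open>The kernels are unbiased\<close>

lemma line_point_coordinates:
  assumes "norm \<theta> = 1"
  shows "(s *\<^sub>R \<theta> + t *\<^sub>R perp \<theta>) \<bullet> \<theta> = s" "(s *\<^sub>R \<theta> + t *\<^sub>R perp \<theta>) \<bullet> perp \<theta> = t"
    "(norm (s *\<^sub>R \<theta> + t *\<^sub>R perp \<theta>))\<^sup>2 = s\<^sup>2 + t\<^sup>2"
proof -
  have n: "\<theta> \<bullet> \<theta> = 1" "perp \<theta> \<bullet> perp \<theta> = 1" 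
    using assms norm_perp[of \<theta>] norm_eq_1[of \<theta>] norm_eq_1[of "perp \<theta>"] by simp_all
  have o: "perp \<theta> \<bullet> \<theta> = 0" "\<theta> \<bullet> perp \<theta> = 0" by (simp_all add: inner_vec2 perp_simps)
  show "(s *\<^sub>R \<theta> + t *\<^sub>R perp \<theta>) \<bullet> \<theta> = s" "(s *\<^sub>R \<theta> + t *\<^sub>R perp \<theta>) \<bullet> perp \<theta> = t"
    by (simp_all add: inner_add_left n o)
  show "(norm (s *\<^sub>R \<theta> + t *\<^sub>R perp \<theta>))\<^sup>2 = s\<^sup>2 + t\<^sup>2"
    by (subst power2_norm_eq_inner) (simp add: inner_add_left inner_add_right n o power2_eq_square)
qed

lemma exp_radon_measurable [measurable (raw)]:
  assumes [measurable]: "f \<in> borel_measurable borel" "p \<in> borel_measurable M" "q \<in> borel_measurable M"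
  shows "(\<lambda>z. exp_radon \<mu> f (p z) (q z)) \<in> borel_measurable M"
  unfolding exp_radon_def Let_def by measurable

lemma exp_radon_eq_0:
  assumes "\<And>y. f y \<noteq> 0 \<Longrightarrow> norm y \<le> 1" "norm \<theta> = 1" "\<bar>s\<bar> > 1"
  shows "exp_radon \<mu> f \<theta> s = 0"
proof -
  have "f (s *\<^sub>R \<theta> + t *\<^sub>R perp \<theta>) = 0" for t
  proof (rule ccontr)
    assume "f (s *\<^sub>R \<theta> + t *\<^sub>R perp \<theta>) \<noteq> 0"
    then have "norm (s *\<^sub>R \<theta> + t *\<^sub>R perp \<theta>) \<le> 1" by (rule assms(1))
    then have "s\<^sup>2 + t\<^sup>2 \<le> 1"
      using line_point_coordinates(3)[OF assms(2)] by (metis norm_ge_zero one_power2 power_mono)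
    moreover have "s\<^sup>2 > 1" using assms(3) by (metis abs_ge_zero one_less_power pos2 power2_abs)
    ultimately show False using zero_le_power2[of t] by linarith
  qed
  then show ?thesis by (simp add: exp_radon_def)
qed

lemma abs_exp_radon_le:
  assumes "\<And>y. f y \<noteq> 0 \<Longrightarrow> norm y \<le> 1" "\<And>y. \<bar>f y\<bar> \<le> L" "norm \<theta> = 1"
  shows "\<bar>exp_radon \<mu> f \<theta> s\<bar> \<le> 2 * L * exp \<bar>\<mu>\<bar>"
proof -
  let ?y = "\<lambda>t. s *\<^sub>R \<theta> + t *\<^sub>R perp \<theta>"
  have L: "L \<ge> 0" using assms(2)[of 0] by linarith
  have "\<bar>exp_radon \<mu> f \<theta> s\<bar> \<le> (LINT t|lborel. \<bar>exp (\<mu> * (?y t \<bullet> perp \<theta>)) * f (?y t)\<bar>)"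
    unfolding exp_radon_def Let_def by (rule integral_abs_bound)
  also have "\<dots> \<le> (LINT t|lborel. indicator {-1..1 :: real} t * (exp \<bar>\<mu>\<bar> * L))"
  proof (rule Bochner_Integration.integral_mono')
    fix t :: real
    show "\<bar>exp (\<mu> * (?y t \<bullet> perp \<theta>)) * f (?y t)\<bar> \<le> indicator {-1..1} t * (exp \<bar>\<mu>\<bar> * L)"
    proof (cases "f (?y t) = 0")
      case False
      then have n: "norm (?y t) \<le> 1" by (rule assms(1))
      then have "s\<^sup>2 + t\<^sup>2 \<le> 1"
        using line_point_coordinates(3)[OF assms(3)] by (metis norm_ge_zero one_power2 power_mono)
      then have "t\<^sup>2 \<le> 1" using zero_le_power2[of s] by linarith
      then have "t \<in> {-1..1}" by (simp add: abs_square_le_1 abs_le_iff)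
      then show ?thesis using exp_weight_le[OF n assms(3), of \<mu>] assms(2)[of "?y t"]
        by (auto simp: abs_mult intro!: mult_mono)
    qed (use L in auto)
  qed (use L in auto)
  also have "\<dots> = 2 * L * exp \<bar>\<mu>\<bar>" by simp
  finally show ?thesis .
qed

text \<open>Integrating over the lines perpendicular to \<open>\<theta>\<close> and along each line covers the plane once. The exponentials
of the transform and of the weight combine into one that depends on \<open>x - y\<close> only.\<close>

lemma exp_radon_weight_integral:
  fixes f :: "real ^ 2 \<Rightarrow> real"
  assumes f: "integrable lborel f" "\<And>y. f y \<noteq> 0 \<Longrightarrow> norm y \<le> 1" and x: "norm x \<le> 1"
    and \<theta>: "norm \<theta> = 1" and ab: "0 \<le> a" "a \<le> b"
  shows "(LINT s|lborel. indicator {-1..1} s * (exp_radon \<mu> f \<theta> s * radon_weight \<mu> x a b \<theta> s)) =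
    (LINT y|lborel. f y * (exp (- \<mu> * ((x - y) \<bullet> perp \<theta>)) * radon_kernel \<mu> a b ((x - y) \<bullet> \<theta>) / pi))"
proof -
  have [measurable]: "f \<in> borel_measurable borel" using f by auto
  let ?W = "radon_weight \<mu> x a b \<theta>"
  let ?g = "\<lambda>y. exp (\<mu> * (y \<bullet> perp \<theta>)) * f y * ?W (y \<bullet> \<theta>)"
  have gi: "integrable lborel ?g"
  proof (rule Bochner_Integration.integrable_bound)
    show "integrable lborel (\<lambda>y. exp \<bar>\<mu>\<bar> * f y * (exp \<bar>\<mu>\<bar> * b\<^sup>2))" using f by simp
    show "AE y in lborel. norm (?g y) \<le> norm (exp \<bar>\<mu>\<bar> * f y * (exp \<bar>\<mu>\<bar> * b\<^sup>2))"
    proof (rule AE_I2)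
      fix y
      show "norm (?g y) \<le> norm (exp \<bar>\<mu>\<bar> * f y * (exp \<bar>\<mu>\<bar> * b\<^sup>2))"
      proof (cases "f y = 0")
        case False
        then show ?thesis
          using exp_weight_le[OF f(2) \<theta>, of y \<mu>] abs_radon_weight_le[OF x \<theta> ab, of \<mu> "y \<bullet> \<theta>"]
          by (auto simp: abs_mult intro!: mult_mono)
      qed simp
    qed
  qed simp
  have "(LINT s|lborel. indicator {-1..1} s * (exp_radon \<mu> f \<theta> s * ?W s)) =
      (LINT s|lborel. exp_radon \<mu> f \<theta> s * ?W s)"
  proof (intro Bochner_Integration.integral_cong refl)
    fix s
    have "exp_radon \<mu> f \<theta> s = 0" if "s \<notin> {-1..1}"
      using that by (intro exp_radon_eq_0[OF f(2) \<theta>]) auto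
    then show "indicator {-1..1} s * (exp_radon \<mu> f \<theta> s * ?W s) = exp_radon \<mu> f \<theta> s * ?W s"
      by (auto simp: indicator_def)
  qed
  also have "\<dots> = (LINT s|lborel. LINT t|lborel. ?g (s *\<^sub>R \<theta> + t *\<^sub>R perp \<theta>))"
    by (simp add: exp_radon_def Let_def line_point_coordinates[OF \<theta>])
  also have "\<dots> = (LINT y|lborel. ?g y)" by (rule integral_rotated_frame[OF \<theta> gi, symmetric])
  also have "\<dots> = (LINT y|lborel. f y * (exp (- \<mu> * ((x - y) \<bullet> perp \<theta>)) * radon_kernel \<mu> a b ((x - y) \<bullet> \<theta>) / pi))"
  proof (intro Bochner_Integration.integral_cong refl)
    fix y
    have "exp (\<mu> * (y \<bullet> perp \<theta>)) * exp (- \<mu> * (x \<bullet> perp \<theta>)) = exp (- \<mu> * ((x - y) \<bullet> perp \<theta>))"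
      by (simp add: exp_add[symmetric] inner_diff_left algebra_simps)
    then show "?g y = f y * (exp (- \<mu> * ((x - y) \<bullet> perp \<theta>)) * radon_kernel \<mu> a b ((x - y) \<bullet> \<theta>) / pi)"
      by (simp add: radon_weight_def inner_diff_left)
  qed
  finally show ?thesis .
qed

lemma integral_indicator_Icc:
  fixes g :: "real \<Rightarrow> real"
  assumes "continuous_on {a..b} g"
  shows "(LINT t|lborel. indicator {a..b} t * g t) = integral {a..b} g"
  using set_borel_integral_eq_integral(2)[OF borel_integrable_atLeastAtMost'[OF assms]]
  by (simp add: set_lebesgue_integral_def)

text \<open>The Fourier transform of the indicator of the annulus with radii \<open>a\<close> and \<open>b\<close>, written in polar coordinates.\<close>

definition annulus_average :: "real \<Rightarrow> real \<Rightarrow> real ^ 2 \<Rightarrow> real" where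
  "annulus_average a b z = (LINT \<rho>|lborel. indicator {a<..b} \<rho> *
      (\<rho> * (LINT \<phi>|lborel. indicator {0..2 * pi} \<phi> * cos (\<rho> * (z \<bullet> circle_point \<phi>)))))"

lemma circle_point_measurable [measurable]: "circle_point \<in> borel_measurable borel"
  unfolding circle_point_def[abs_def] by measurable

text \<open>Back projection of the filter: after exchanging the integrals over \<open>\<phi>\<close> and \<open>\<rho>\<close>, the inner
integral is an average of exponential plane waves.\<close>

lemma radon_kernel_average:
  assumes ab: "0 \<le> a" "a \<le> b"
  shows "(LINT \<phi>|lborel. indicator {0..2 * pi} \<phi> * (exp (- \<mu> * (z \<bullet> perp (circle_point \<phi>))) *
      radon_kernel \<mu> a b (z \<bullet> circle_point \<phi>))) = annulus_average a b z"
proof -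
  define E where "E = exp (\<bar>\<mu>\<bar> * norm z)"
  let ?e = "\<lambda>\<phi>. exp (- \<mu> * (z \<bullet> perp (circle_point \<phi>)))"
  let ?c = "\<lambda>\<phi> \<rho>. cos (sqrt (\<rho>\<^sup>2 + \<mu>\<^sup>2) * (z \<bullet> circle_point \<phi>))"
  have eE: "?e \<phi> \<le> E" for \<phi>
  proof -
    have "\<bar>z \<bullet> perp (circle_point \<phi>)\<bar> \<le> norm z * norm (perp (circle_point \<phi>))" by (rule Cauchy_Schwarz_ineq2)
    then have "\<bar>\<mu>\<bar> * \<bar>z \<bullet> perp (circle_point \<phi>)\<bar> \<le> \<bar>\<mu>\<bar> * norm z"
      by (intro mult_left_mono) (auto simp: norm_perp)
    then have "- \<mu> * (z \<bullet> perp (circle_point \<phi>)) \<le> \<bar>\<mu>\<bar> * norm z"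
      by (metis abs_ge_self abs_minus_cancel abs_mult order_trans)
    then show ?thesis by (simp add: E_def)
  qed
  have "(LINT \<phi>|lborel. indicator {0..2 * pi} \<phi> * (?e \<phi> * radon_kernel \<mu> a b (z \<bullet> circle_point \<phi>))) =
    (LINT \<phi>|lborel. LINT \<rho>|lborel. indicator {0..2 * pi} \<phi> * (?e \<phi> * (indicator {a<..b} \<rho> * (\<rho> * ?c \<phi> \<rho>))))"
    by (simp add: radon_kernel_def)
  also have "\<dots> = (LINT \<rho>|lborel. LINT \<phi>|lborel. indicator {0..2 * pi} \<phi> * (?e \<phi> * (indicator {a<..b} \<rho> * (\<rho> * ?c \<phi> \<rho>))))"
  proof (rule lborel_pair.Fubini_integral[symmetric], rule integrable_pair_bound)
    show "integrable lborel (\<lambda>\<phi>. indicator {0..2 * pi} \<phi> * E)" "integrable lborel (\<lambda>\<rho>. indicator {a<..b} \<rho> * b)"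
      by simp_all
    fix \<phi> \<rho> :: real
    have "\<bar>?e \<phi>\<bar> * (\<bar>\<rho>\<bar> * \<bar>?c \<phi> \<rho>\<bar>) \<le> E * (b * 1)" if "\<rho> \<in> {a<..b}"
      using that eE ab by (intro mult_mono) (auto simp: E_def)
    then show "norm (case (\<phi>, \<rho>) of (\<phi>, \<rho>) \<Rightarrow> indicator {0..2 * pi} \<phi> * (?e \<phi> * (indicator {a<..b} \<rho> * (\<rho> * ?c \<phi> \<rho>))))
      \<le> \<bar>indicator {0..2 * pi} \<phi> * E\<bar> * \<bar>indicator {a<..b} \<rho> * b\<bar>"
      using ab by (auto simp: indicator_def abs_mult E_def)
  qed simp
  also have "\<dots> = annulus_average a b z"
    unfolding annulus_average_def
  proof (intro Bochner_Integration.integral_cong refl)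
    fix \<rho> :: real
    show "(LINT \<phi>|lborel. indicator {0..2 * pi} \<phi> * (?e \<phi> * (indicator {a<..b} \<rho> * (\<rho> * ?c \<phi> \<rho>)))) =
      indicator {a<..b} \<rho> * (\<rho> * (LINT \<phi>|lborel. indicator {0..2 * pi} \<phi> * cos (\<rho> * (z \<bullet> circle_point \<phi>))))"
    proof (cases "\<rho> \<in> {a<..b}")
      case True
      then have "\<rho> > 0" using ab by simp
      have "(LINT \<phi>|lborel. indicator {0..2 * pi} \<phi> * (?e \<phi> * ?c \<phi> \<rho>)) =
          integral {0..2 * pi} (\<lambda>\<phi>. ?e \<phi> * ?c \<phi> \<rho>)"
        unfolding inner_circle_point inner_perp_circle_point
        by (intro integral_indicator_Icc continuous_intros)
      also have "\<dots> = integral {0..2 * pi} (\<lambda>\<phi>. cos (\<rho> * (z \<bullet> circle_point \<phi>)))"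
        by (rule exponential_plane_wave_average) fact
      also have "\<dots> = (LINT \<phi>|lborel. indicator {0..2 * pi} \<phi> * cos (\<rho> * (z \<bullet> circle_point \<phi>)))"
        unfolding inner_circle_point by (intro integral_indicator_Icc[symmetric] continuous_intros)
      finally have eq: "(LINT \<phi>|lborel. indicator {0..2 * pi} \<phi> * (?e \<phi> * ?c \<phi> \<rho>)) =
          (LINT \<phi>|lborel. indicator {0..2 * pi} \<phi> * cos (\<rho> * (z \<bullet> circle_point \<phi>)))" .
      have "(LINT \<phi>|lborel. indicator {0..2 * pi} \<phi> * (?e \<phi> * (indicator {a<..b} \<rho> * (\<rho> * ?c \<phi> \<rho>)))) =
          (LINT \<phi>|lborel. \<rho> * (indicator {0..2 * pi} \<phi> * (?e \<phi> * ?c \<phi> \<rho>)))"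
        using True by (intro Bochner_Integration.integral_cong refl) simp
      also have "\<dots> = \<rho> * (LINT \<phi>|lborel. indicator {0..2 * pi} \<phi> * (?e \<phi> * ?c \<phi> \<rho>))"
        by (rule integral_mult_right_zero)
      finally show ?thesis using True eq by simp
    qed simp
  qed
  finally show ?thesis .
qed

definition band_low :: "nat \<Rightarrow> real" where
  "band_low j = (if j = 0 then 0 else 2 ^ (j - 1))"

lemma band_low_bounds: "0 \<le> band_low j" "band_low j \<le> 2 ^ j"
  by (auto simp: band_low_def intro: power_increasing)

lemma emeasure_band: "emeasure lborel (band j) < \<infinity>"
proof -
  have "band j \<subseteq> cball 0 (2 ^ j)" by (auto simp: band_def)
  then show ?thesis by (intro emeasure_bounded_finite) (rule bounded_subset[OF bounded_cball])
qed

lemma band_cos_integral: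
  "(LINT \<xi>|lborel. indicator (band j) \<xi> * cos (z \<bullet> \<xi>)) = annulus_average (band_low j) (2 ^ j) z"
proof -
  have "integrable lborel (\<lambda>\<xi>. indicator (band j) \<xi> :: real)"
    using emeasure_band by (intro integrable_real_indicator) auto
  then have int: "integrable lborel (\<lambda>\<xi>. indicator (band j) \<xi> * cos (z \<bullet> \<xi>))"
    by (rule Bochner_Integration.integrable_bound) (auto simp: indicator_def)
  have inband: "vector [\<rho> * cos \<phi>, \<rho> * sin \<phi>] \<in> band j \<longleftrightarrow> band_low j < \<rho> \<and> \<rho> \<le> 2 ^ j" if "\<rho> > 0" for \<rho> \<phi>
    using that norm_polar[of "vector [\<rho>, \<phi>]"] by (auto simp: polar_def band_def band_low_def)
  have "(LINT \<xi>|lborel. indicator (band j) \<xi> * cos (z \<bullet> \<xi>)) =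
      (LINT \<rho>|lborel. LINT \<phi>|lborel. (indicator {0<..} \<rho> * indicator {0<..<2 * pi} \<phi> * \<rho>) *\<^sub>R
        (indicator (band j) (vector [\<rho> * cos \<phi>, \<rho> * sin \<phi>]) * cos (z \<bullet> vector [\<rho> * cos \<phi>, \<rho> * sin \<phi>])))"
    by (rule integral_polar[OF int])
  also have "\<dots> = annulus_average (band_low j) (2 ^ j) z"
    unfolding annulus_average_def
  proof (intro Bochner_Integration.integral_cong refl)
    fix \<rho> :: real
    have "(LINT \<phi>|lborel. (indicator {0<..} \<rho> * indicator {0<..<2 * pi} \<phi> * \<rho>) *\<^sub>R
        (indicator (band j) (vector [\<rho> * cos \<phi>, \<rho> * sin \<phi>]) * cos (z \<bullet> vector [\<rho> * cos \<phi>, \<rho> * sin \<phi>]))) =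
      (LINT \<phi>|lborel. (indicator {band_low j<..2 ^ j} \<rho> * \<rho>) *
        (indicator {0..2 * pi} \<phi> * cos (\<rho> * (z \<bullet> circle_point \<phi>))))"
    proof (rule integral_cong_AE)
      have "AE \<phi> in lborel. \<phi> \<noteq> 0" "AE \<phi> in lborel. \<phi> \<noteq> 2 * pi" by (rule AE_lborel_singleton)+
      then show "AE \<phi> in lborel. (indicator {0<..} \<rho> * indicator {0<..<2 * pi} \<phi> * \<rho>) *\<^sub>R
        (indicator (band j) (vector [\<rho> * cos \<phi>, \<rho> * sin \<phi>]) * cos (z \<bullet> vector [\<rho> * cos \<phi>, \<rho> * sin \<phi>])) =
        (indicator {band_low j<..2 ^ j} \<rho> * \<rho>) *
        (indicator {0..2 * pi} \<phi> * cos (\<rho> * (z \<bullet> circle_point \<phi>)))"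
      proof eventually_elim
        case (elim \<phi>)
        have "z \<bullet> vector [\<rho> * cos \<phi>, \<rho> * sin \<phi>] = \<rho> * (z \<bullet> circle_point \<phi>)"
          by (simp add: inner_vec2 algebra_simps)
        then show ?case using elim inband[of \<rho> \<phi>] band_low_bounds(1)[of j]
          by (auto simp: indicator_def)
      qed
    qed measurable
    also have "\<dots> = (indicator {band_low j<..2 ^ j} \<rho> * \<rho>) *
      (LINT \<phi>|lborel. indicator {0..2 * pi} \<phi> * cos (\<rho> * (z \<bullet> circle_point \<phi>)))"
      by (rule integral_mult_right_zero)
    finally show "(LINT \<phi>|lborel. (indicator {0<..} \<rho> * indicator {0<..<2 * pi} \<phi> * \<rho>) *\<^sub>R
        (indicator (band j) (vector [\<rho> * cos \<phi>, \<rho> * sin \<phi>]) * cos (z \<bullet> vector [\<rho> * cos \<phi>, \<rho> * sin \<phi>]))) =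
      indicator {band_low j<..2 ^ j} \<rho> * (\<rho> *
        (LINT \<phi>|lborel. indicator {0..2 * pi} \<phi> * cos (\<rho> * (z \<bullet> circle_point \<phi>))))"
      by (simp only: mult.assoc)
  qed
  finally show ?thesis .
qed

text \<open>The Fourier side of the identity between band contributions and back projections: both are the
convolution of \<open>f\<close> with the same radial function.\<close>

lemma band_part_eq:
  assumes f: "integrable lborel f"
  shows "band_part f x j = (LINT y|lborel. f y * annulus_average (band_low j) (2 ^ j) (x - y)) / (2 * pi)\<^sup>2"
proof -
  have [measurable]: "f \<in> borel_measurable borel" using f by auto
  have bi: "integrable lborel (\<lambda>\<xi>. indicator (band j) \<xi> :: real)"
    using emeasure_band by (intro integrable_real_indicator) auto
  have pi: "integrable (lborel \<Otimes>\<^sub>M lborel) (\<lambda>(\<xi>, y). indicator (band j) \<xi> *\<^sub>R (complex_of_real (f y) * cis ((x - y) \<bullet> \<xi>)))"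
    by (rule integrable_pair_bound[OF bi f]) (auto simp: norm_mult)
  have "(LINT \<xi>|lborel. indicator (band j) \<xi> *\<^sub>R (fourier f \<xi> * cis (x \<bullet> \<xi>))) =
      (LINT \<xi>|lborel. LINT y|lborel. indicator (band j) \<xi> *\<^sub>R (complex_of_real (f y) * cis ((x - y) \<bullet> \<xi>)))"
  proof (intro Bochner_Integration.integral_cong refl)
    fix \<xi>
    have "fourier f \<xi> * cis (x \<bullet> \<xi>) = (LINT y|lborel. complex_of_real (f y) * cis (- (y \<bullet> \<xi>)) * cis (x \<bullet> \<xi>))"
      unfolding fourier_def by (rule integral_mult_left_zero[symmetric])
    also have "\<dots> = (LINT y|lborel. complex_of_real (f y) * cis ((x - y) \<bullet> \<xi>))"
      by (simp add: mult.assoc cis_mult inner_diff_left)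
    finally show "indicator (band j) \<xi> *\<^sub>R (fourier f \<xi> * cis (x \<bullet> \<xi>)) =
        (LINT y|lborel. indicator (band j) \<xi> *\<^sub>R (complex_of_real (f y) * cis ((x - y) \<bullet> \<xi>)))"
      by simp
  qed
  also have "\<dots> = (LINT y|lborel. LINT \<xi>|lborel. indicator (band j) \<xi> *\<^sub>R (complex_of_real (f y) * cis ((x - y) \<bullet> \<xi>)))"
    by (rule lborel_pair.Fubini_integral[OF pi, symmetric])
  also have "Re \<dots> = (LINT y|lborel. Re (LINT \<xi>|lborel. indicator (band j) \<xi> *\<^sub>R (complex_of_real (f y) * cis ((x - y) \<bullet> \<xi>))))"
    using lborel_pair.integrable_snd[OF pi] by (intro integral_Re[symmetric]) simp
  also have "\<dots> = (LINT y|lborel. f y * annulus_average (band_low j) (2 ^ j) (x - y))"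
  proof (intro Bochner_Integration.integral_cong refl)
    fix y
    have "integrable lborel (\<lambda>\<xi>. f y * indicator (band j) \<xi>)" using bi by simp
    then have "integrable lborel (\<lambda>\<xi>. indicator (band j) \<xi> *\<^sub>R (complex_of_real (f y) * cis ((x - y) \<bullet> \<xi>)))"
      by (rule Bochner_Integration.integrable_bound) (auto simp: norm_mult indicator_def)
    then have "Re (LINT \<xi>|lborel. indicator (band j) \<xi> *\<^sub>R (complex_of_real (f y) * cis ((x - y) \<bullet> \<xi>))) =
        (LINT \<xi>|lborel. f y * (indicator (band j) \<xi> * cos ((x - y) \<bullet> \<xi>)))"
      by (subst integral_Re[symmetric], assumption)
        (intro Bochner_Integration.integral_cong refl, simp)
    then show "Re (LINT \<xi>|lborel. indicator (band j) \<xi> *\<^sub>R (complex_of_real (f y) * cis ((x - y) \<bullet> \<xi>))) =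
        f y * annulus_average (band_low j) (2 ^ j) (x - y)"
      by (simp add: band_cos_integral)
  qed
  finally show ?thesis by (simp add: band_part_def)
qed

text \<open>The factor \<open>4 * pi\<close> is the total mass of the circle times the interval of the design, so that the left side is
an expectation over the design.\<close>

lemma radon_weight_unbiased:
  fixes f :: "real ^ 2 \<Rightarrow> real"
  assumes f: "integrable lborel f" "\<And>y. f y \<noteq> 0 \<Longrightarrow> norm y \<le> 1" and x: "norm x \<le> 1"
  shows "(LINT \<phi>|lborel. indicator {0..2 * pi} \<phi> * (LINT s|lborel. indicator {-1..1} s *
      (exp_radon \<mu> f (circle_point \<phi>) s * radon_weight \<mu> x (band_low j) (2 ^ j) (circle_point \<phi>) s))) / (4 * pi) =
    band_part f x j"
proof -
  note ab = band_low_bounds[of j]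
  let ?k = "radon_kernel \<mu> (band_low j) (2 ^ j)"
  have [measurable]: "f \<in> borel_measurable borel" using f by auto
  let ?h = "\<lambda>\<phi> y. indicator {0..2 * pi} \<phi> * (f y * (exp (- \<mu> * ((x - y) \<bullet> perp (circle_point \<phi>))) *
      ?k ((x - y) \<bullet> circle_point \<phi>) / pi))"
  have "(LINT \<phi>|lborel. indicator {0..2 * pi} \<phi> * (LINT s|lborel. indicator {-1..1} s *
      (exp_radon \<mu> f (circle_point \<phi>) s * radon_weight \<mu> x (band_low j) (2 ^ j) (circle_point \<phi>) s))) =
    (LINT \<phi>|lborel. LINT y|lborel. ?h \<phi> y)"
  proof -
    have "(LINT s|lborel. indicator {-1..1} s *
      (exp_radon \<mu> f (circle_point \<phi>) s * radon_weight \<mu> x (band_low j) (2 ^ j) (circle_point \<phi>) s)) =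
      (LINT y|lborel. f y * (exp (- \<mu> * ((x - y) \<bullet> perp (circle_point \<phi>))) *
        ?k ((x - y) \<bullet> circle_point \<phi>) / pi))" for \<phi>
      using f(2) by (intro exp_radon_weight_integral[OF f(1) _ x norm_circle_point ab])
    then show ?thesis by (simp only: integral_mult_right_zero)
  qed
  also have "\<dots> = (LINT y|lborel. LINT \<phi>|lborel. ?h \<phi> y)"
  proof (rule lborel_pair.Fubini_integral[symmetric], rule integrable_pair_bound[OF _ f(1)])
    show "integrable lborel (\<lambda>\<phi>. indicator {0..2 * pi} \<phi> * (exp \<bar>\<mu>\<bar> * exp \<bar>\<mu>\<bar> * (2 ^ j)\<^sup>2))" by simp
    fix \<phi> y
    show "norm (case (\<phi>, y) of (\<phi>, y) \<Rightarrow> ?h \<phi> y) \<le>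
        \<bar>indicator {0..2 * pi} \<phi> * (exp \<bar>\<mu>\<bar> * exp \<bar>\<mu>\<bar> * (2 ^ j)\<^sup>2)\<bar> * \<bar>f y\<bar>"
    proof (cases "f y = 0")
      case False
      let ?p = "perp (circle_point \<phi>)"
      have "exp (- \<mu> * ((x - y) \<bullet> ?p)) = exp (- \<mu> * (x \<bullet> ?p)) * exp (\<mu> * (y \<bullet> ?p))"
        by (simp add: exp_add[symmetric] inner_diff_left algebra_simps)
      also have "\<dots> \<le> exp \<bar>\<mu>\<bar> * exp \<bar>\<mu>\<bar>"
        using exp_weight_le[OF x norm_circle_point, of "- \<mu>" \<phi>]
          exp_weight_le[OF f(2)[OF False] norm_circle_point, of \<mu> \<phi>] by (intro mult_mono) auto
      finally have "exp (- \<mu> * ((x - y) \<bullet> ?p)) * \<bar>?k ((x - y) \<bullet> circle_point \<phi>)\<bar> / pi \<le>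
          (exp \<bar>\<mu>\<bar> * exp \<bar>\<mu>\<bar> * (2 ^ j)\<^sup>2) / 1"
        using abs_radon_kernel_le[OF ab, of \<mu> "(x - y) \<bullet> circle_point \<phi>"] pi_ge_two
        by (intro frac_le mult_mono) auto
      then have "\<bar>f y\<bar> * (exp (- \<mu> * ((x - y) \<bullet> ?p)) * \<bar>?k ((x - y) \<bullet> circle_point \<phi>)\<bar> / pi) \<le>
          \<bar>f y\<bar> * (exp \<bar>\<mu>\<bar> * exp \<bar>\<mu>\<bar> * (2 ^ j)\<^sup>2)"
        by (intro mult_left_mono) auto
      then show ?thesis by (auto simp: abs_mult indicator_def mult_ac)
    qed simp
  qed measurable
  also have "\<dots> = (LINT y|lborel. f y * annulus_average (band_low j) (2 ^ j) (x - y) / pi)"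
  proof (intro Bochner_Integration.integral_cong refl)
    fix y
    have "(LINT \<phi>|lborel. ?h \<phi> y) = (LINT \<phi>|lborel. (f y / pi) * (indicator {0..2 * pi} \<phi> *
      (exp (- \<mu> * ((x - y) \<bullet> perp (circle_point \<phi>))) * ?k ((x - y) \<bullet> circle_point \<phi>))))"
      by (intro Bochner_Integration.integral_cong refl) simp
    also have "\<dots> = (f y / pi) * annulus_average (band_low j) (2 ^ j) (x - y)"
      by (subst integral_mult_right_zero, subst radon_kernel_average[OF ab]) (rule refl)
    finally show "(LINT \<phi>|lborel. ?h \<phi> y) = f y * annulus_average (band_low j) (2 ^ j) (x - y) / pi" by simp
  qed
  also have "\<dots> = (LINT y|lborel. f y * annulus_average (band_low j) (2 ^ j) (x - y)) / pi" by simp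
  finally show ?thesis
    by (subst band_part_eq[OF f(1)]) (simp add: power2_eq_square field_simps)
qed

section \<open>Laws of the design and of a single observation\<close>

lemma prob_space_interval: "a < b \<Longrightarrow> prob_space (uniform_measure lborel {a..b :: real})"
  by (intro prob_space_uniform_measure) auto

lemma integral_uniform_interval:
  fixes g :: "real \<Rightarrow> real"
  assumes [measurable]: "g \<in> borel_measurable borel" and "a < b"
  shows "(LINT t|uniform_measure lborel {a..b}. g t) = (LINT t|lborel. indicator {a..b} t * g t) / (b - a)"
proof -
  have "uniform_measure lborel {a..b} = density lborel (\<lambda>t. ennreal (indicator {a..b} t / (b - a)))"
    unfolding uniform_measure_def using assms(2)
    by (intro arg_cong[where f="density lborel"] ext) (auto simp: indicator_def divide_ennreal[symmetric] simp del: ennreal_1 simp flip: ennreal_1)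
  then have "(LINT t|uniform_measure lborel {a..b}. g t) = (LINT t|lborel. (indicator {a..b} t * g t) / (b - a))"
    using assms(2) by (simp add: integral_density)
  then show ?thesis by simp
qed

lemma sets_circle_uniform [measurable_cong]: "sets circle_uniform = sets borel"
  by (simp add: circle_uniform_def)

lemma sets_design_law [measurable_cong]: "sets design_law = sets (borel \<Otimes>\<^sub>M borel)"
  unfolding design_law_def by (intro sets_pair_measure_cong) (simp_all add: sets_circle_uniform)

lemma space_design_law [simp]: "space design_law = UNIV"
  by (simp add: design_law_def space_pair_measure circle_uniform_def)

lemma prob_space_circle_uniform: "prob_space circle_uniform"
  unfolding circle_uniform_def
  by (intro prob_space.prob_space_distr prob_space_interval) (auto simp: measurable_def[symmetric])

lemma prob_space_design_law: "prob_space design_law"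
proof -
  interpret c: prob_space circle_uniform by (rule prob_space_circle_uniform)
  interpret u: prob_space "uniform_measure lborel {-1..1 :: real}" by (rule prob_space_interval) simp
  interpret pair_prob_space circle_uniform "uniform_measure lborel {-1..1 :: real}" ..
  show ?thesis unfolding design_law_def by (rule prob_space_axioms)
qed

lemma AE_design_law_norm: "AE z in design_law. norm (fst z) = 1"
proof -
  interpret c: prob_space circle_uniform by (rule prob_space_circle_uniform)
  interpret u: prob_space "uniform_measure lborel {-1..1 :: real}" by (rule prob_space_interval) simp
  interpret pair_prob_space circle_uniform "uniform_measure lborel {-1..1 :: real}" ..
  have "AE \<theta> in circle_uniform. norm \<theta> = 1"
    unfolding circle_uniform_def by (subst AE_distr_iff) (auto simp: norm_vec2)
  moreover have "{z \<in> space (circle_uniform \<Otimes>\<^sub>M uniform_measure lborel {-1..1}). norm (fst z) = 1} \<in>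
      sets (circle_uniform \<Otimes>\<^sub>M uniform_measure lborel {-1..1 :: real})"
    by measurable
  ultimately show ?thesis unfolding design_law_def
    by (intro AE_pair_measure) auto
qed

lemma nn_integral_design_law:
  assumes [measurable]: "g \<in> borel_measurable (borel \<Otimes>\<^sub>M borel)"
  shows "(\<integral>\<^sup>+ z. g z \<partial>design_law) = (\<integral>\<^sup>+ \<phi>. (\<integral>\<^sup>+ s. g (circle_point \<phi>, s) * indicator {-1..1} s \<partial>lborel) / 2 *
    indicator {0..2 * pi} \<phi> \<partial>lborel) / ennreal (2 * pi)"
proof -
  interpret u: prob_space "uniform_measure lborel {-1..1 :: real}" by (rule prob_space_interval) simp
  show ?thesis
    unfolding design_law_def
    by (subst u.nn_integral_fst[symmetric])
      (simp_all add: circle_uniform_def nn_integral_distr nn_integral_uniform_measure circle_point_def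
        cong: measurable_cong_sets sets_pair_measure_cong)
qed

lemma integral_design_law:
  fixes g :: "(real ^ 2) \<times> real \<Rightarrow> real"
  assumes [measurable]: "g \<in> borel_measurable (borel \<Otimes>\<^sub>M borel)" and "integrable design_law g"
  shows "(LINT z|design_law. g z) = (LINT \<phi>|lborel. indicator {0..2 * pi} \<phi> *
    (LINT s|lborel. indicator {-1..1} s * g (circle_point \<phi>, s))) / (4 * pi)"
proof -
  interpret c: prob_space circle_uniform by (rule prob_space_circle_uniform)
  interpret u: prob_space "uniform_measure lborel {-1..1 :: real}" by (rule prob_space_interval) simp
  interpret pair_prob_space circle_uniform "uniform_measure lborel {-1..1 :: real}" ..
  have "(LINT z|design_law. g z) = (LINT \<theta>|circle_uniform. LINT s|uniform_measure lborel {-1..1}. g (\<theta>, s))"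
    using assms(2) unfolding design_law_def by (rule integral_fst'[symmetric])
  also have "\<dots> = (LINT \<theta>|circle_uniform. (LINT s|lborel. indicator {-1..1} s * g (\<theta>, s)) / 2)"
    by (subst integral_uniform_interval) simp_all
  also have "\<dots> = (LINT \<phi>|uniform_measure lborel {0..2 * pi}.
      (LINT s|lborel. indicator {-1..1} s * g (circle_point \<phi>, s)) / 2)"
    unfolding circle_uniform_def by (subst integral_distr) (auto simp: circle_point_def)
  also have "\<dots> = (LINT \<phi>|lborel. indicator {0..2 * pi} \<phi> *
    ((LINT s|lborel. indicator {-1..1} s * g (circle_point \<phi>, s)) / 2)) / (2 * pi)"
    by (subst integral_uniform_interval) simp_all
  finally show ?thesis by simp
qed

lemma prob_space_noise_law: "\<sigma> > 0 \<Longrightarrow> prob_space (noise_law \<sigma>)"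
  unfolding noise_law_def by (rule prob_space_normal_density)

lemma sets_noise_law [measurable_cong]: "sets (noise_law \<sigma>) = sets borel"
  by (simp add: noise_law_def)

lemma nn_integral_noise_law:
  assumes [measurable]: "g \<in> borel_measurable borel"
  shows "(\<integral>\<^sup>+ e. g e \<partial>noise_law \<sigma>) = (\<integral>\<^sup>+ e. ennreal (normal_density 0 \<sigma> e) * g e \<partial>lborel)"
  unfolding noise_law_def by (simp add: nn_integral_density)

lemma sets_observation_law [measurable_cong]: "sets (observation_law \<mu> \<sigma> f) = sets borel"
  by (simp add: observation_law_def)

lemma space_observation_law [simp]: "space (observation_law \<mu> \<sigma> f) = UNIV"
  by (simp add: observation_law_def)

lemma observation_law_eq:
  "observation_law \<mu> \<sigma> f = distr (design_law \<Otimes>\<^sub>M noise_law \<sigma>) borel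
    (\<lambda>w. (fst (fst w), snd (fst w), exp_radon \<mu> f (fst (fst w)) (snd (fst w)) + snd w))"
  by (simp add: observation_law_def case_prod_unfold)

lemma observation_map_measurable:
  assumes [measurable]: "f \<in> borel_measurable borel"
  shows "(\<lambda>w. (fst (fst w), snd (fst w), exp_radon \<mu> f (fst (fst w)) (snd (fst w)) + snd w))
    \<in> borel_measurable (design_law \<Otimes>\<^sub>M noise_law \<sigma>)"
proof -
  have "(\<lambda>w. (fst (fst w), snd (fst w), exp_radon \<mu> f (fst (fst w)) (snd (fst w)) + snd w)) \<in>
      (borel \<Otimes>\<^sub>M borel) \<Otimes>\<^sub>M borel \<rightarrow>\<^sub>M borel \<Otimes>\<^sub>M (borel \<Otimes>\<^sub>M borel)"
    by measurable
  also have "\<dots> = borel_measurable (design_law \<Otimes>\<^sub>M noise_law \<sigma>)"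
    by (intro measurable_cong_sets sets_pair_measure_cong)
      (simp_all only: sets_design_law sets_noise_law borel_prod)
  finally show ?thesis .
qed

lemma prob_space_observation_law:
  assumes [measurable]: "f \<in> borel_measurable borel" and "\<sigma> > 0"
  shows "prob_space (observation_law \<mu> \<sigma> f)"
proof -
  interpret d: prob_space design_law by (rule prob_space_design_law)
  interpret e: prob_space "noise_law \<sigma>" by (rule prob_space_noise_law) fact
  interpret pair_prob_space design_law "noise_law \<sigma>" ..
  show ?thesis unfolding observation_law_eq
    by (rule prob_space_distr) (rule observation_map_measurable, fact)
qed

lemma nn_integral_observation_law:
  assumes f: "f \<in> borel_measurable borel" and \<sigma>: "\<sigma> > 0" and g: "g \<in> borel_measurable borel"
  shows "(\<integral>\<^sup>+ d. g d \<partial>observation_law \<mu> \<sigma> f) =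
    (\<integral>\<^sup>+ z. \<integral>\<^sup>+ e. g (fst z, snd z, exp_radon \<mu> f (fst z) (snd z) + e) \<partial>noise_law \<sigma> \<partial>design_law)"
proof -
  interpret e: prob_space "noise_law \<sigma>" by (rule prob_space_noise_law) fact
  note m = observation_map_measurable[OF f, of \<mu> \<sigma>]
  have "(\<lambda>w. g (fst (fst w), snd (fst w), exp_radon \<mu> f (fst (fst w)) (snd (fst w)) + snd w))
      \<in> borel_measurable (design_law \<Otimes>\<^sub>M noise_law \<sigma>)"
    using measurable_compose[OF m g] .
  then show ?thesis
    unfolding observation_law_eq
    by (subst nn_integral_distr[OF m], use g in simp, subst e.nn_integral_fst[symmetric]) simp_all
qed

lemma nn_integral_noise_exp:
  assumes "\<sigma> > 0"
  shows "(\<integral>\<^sup>+ e. ennreal (exp (a * e)) \<partial>noise_law \<sigma>) = ennreal (exp (a\<^sup>2 * \<sigma>\<^sup>2 / 2))"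
proof -
  have eq: "normal_density 0 \<sigma> e * exp (a * e) = exp (a\<^sup>2 * \<sigma>\<^sup>2 / 2) * normal_density (a * \<sigma>\<^sup>2) \<sigma> e" for e
  proof -
    have "- (e - 0)\<^sup>2 / (2 * \<sigma>\<^sup>2) + a * e = a\<^sup>2 * \<sigma>\<^sup>2 / 2 + - (e - a * \<sigma>\<^sup>2)\<^sup>2 / (2 * \<sigma>\<^sup>2)"
      using assms by (simp add: field_simps power2_eq_square)
    then have "exp (- (e - 0)\<^sup>2 / (2 * \<sigma>\<^sup>2)) * exp (a * e) =
        exp (a\<^sup>2 * \<sigma>\<^sup>2 / 2) * exp (- (e - a * \<sigma>\<^sup>2)\<^sup>2 / (2 * \<sigma>\<^sup>2))"
      by (simp only: exp_add[symmetric])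
    then show ?thesis by (simp only: normal_density_def mult.assoc mult.left_commute)
  qed
  have "(\<integral>\<^sup>+ e. ennreal (exp (a * e)) \<partial>noise_law \<sigma>) =
      (\<integral>\<^sup>+ e. ennreal (exp (a\<^sup>2 * \<sigma>\<^sup>2 / 2)) * ennreal (normal_density (a * \<sigma>\<^sup>2) \<sigma> e) \<partial>lborel)"
    by (subst nn_integral_noise_law) (simp_all add: ennreal_mult''[symmetric] eq)
  also have "\<dots> = ennreal (exp (a\<^sup>2 * \<sigma>\<^sup>2 / 2)) * 1"
    using assms by (subst nn_integral_cmult)
      (auto simp: nn_integral_eq_integral[OF integrable_normal_density] integral_normal_density)
  finally show ?thesis by simp
qed

text \<open>The linear term is kept exactly, so that after integration the exponential moment sees the mean to first order and
only the second moment beyond.\<close>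

lemma exp_le_quadratic: "exp x \<le> 1 + x + x\<^sup>2 * exp \<bar>x\<bar>" for x :: real
proof -
  have 1: "exp y - 1 \<le> y * exp y" for y :: real
  proof -
    have "(1 - y) * exp y \<le> exp (- y) * exp y"
      using exp_ge_add_one_self[of "- y"] by (intro mult_right_mono) auto
    then show ?thesis by (simp add: exp_minus field_simps)
  qed
  have "\<bar>exp x - 1\<bar> \<le> \<bar>x\<bar> * exp \<bar>x\<bar>"
  proof (cases "x \<ge> 0")
    case True
    then show ?thesis using 1[of x] by simp
  next
    case False
    have "1 - exp x \<le> - x" using exp_ge_add_one_self[of x] by linarith
    also have "\<dots> \<le> - x * exp \<bar>x\<bar>" using False by (simp add: mult_le_cancel_left1)
    finally show ?thesis using False by simp
  qed
  then have "\<bar>x\<bar> * \<bar>exp x - 1\<bar> \<le> \<bar>x\<bar> * (\<bar>x\<bar> * exp \<bar>x\<bar>)" by (intro mult_left_mono) auto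
  then have "\<bar>x * (exp x - 1)\<bar> \<le> x\<^sup>2 * exp \<bar>x\<bar>"
    by (simp add: abs_mult power2_eq_square flip: mult.assoc)
  then show ?thesis using 1[of x] by (simp add: algebra_simps)
qed

text \<open>The constant of the quadratic term in the exponential moment below: the first summand is the share of the
Gaussian noise, the second that of the second order remainder of the exponential.\<close>

definition mgf_const :: "real \<Rightarrow> real \<Rightarrow> real" where
  "mgf_const D \<sigma> = \<sigma>\<^sup>2 / 2 + exp (D + \<sigma>\<^sup>2 / 2) * (D + \<sigma>\<^sup>2 / 2)\<^sup>2"

text \<open>Integrating out the noise leaves the exponential of \<open>u * T * K + u\<^sup>2 * \<sigma>\<^sup>2 * K\<^sup>2 / 2\<close>, which is bounded when
\<open>u * K\<close> is. The quadratic term of its expansion involves the second moment of \<open>K\<close> and not its supremum,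
as in Bernstein's inequality.\<close>

lemma regression_mgf:
  assumes M: "prob_space M" and [measurable]: "T \<in> borel_measurable M" "K \<in> borel_measurable M"
    and T: "AE z in M. \<bar>T z\<bar> \<le> D" and K: "AE z in M. \<bar>K z\<bar> \<le> A" and V: "(LINT z|M. (K z)\<^sup>2) \<le> V"
    and \<sigma>: "\<sigma> > 0" and u: "\<bar>u\<bar> * A \<le> 1" and D: "D \<ge> 0"
  shows "(\<integral>\<^sup>+ z. \<integral>\<^sup>+ e. ennreal (exp (u * ((T z + e) * K z))) \<partial>noise_law \<sigma> \<partial>M) \<le>
    ennreal (exp (u * (LINT z|M. T z * K z) + mgf_const D \<sigma> * u\<^sup>2 * V))"
proof -
  interpret prob_space M by fact
  define c where "c = D + \<sigma>\<^sup>2 / 2"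
  define m where "m = (LINT z|M. T z * K z)"
  have c0: "c \<ge> 0" using D by (simp add: c_def)
  let ?\<zeta> = "\<lambda>z. u * (T z * K z) + u\<^sup>2 * \<sigma>\<^sup>2 / 2 * (K z)\<^sup>2"
  let ?B = "\<lambda>z. 1 + u * (T z * K z) + mgf_const D \<sigma> * u\<^sup>2 * (K z)\<^sup>2"
  have iK: "integrable M (\<lambda>z. (K z)\<^sup>2)"
    by (rule integrable_const_bound[where B="A\<^sup>2"])
      (use K in \<open>eventually_elim, simp add: abs_le_square_iff[symmetric]\<close>, simp)
  have iT: "integrable M (\<lambda>z. T z * K z)"
  proof (rule integrable_const_bound[where B="D * A"])
    show "AE z in M. norm (T z * K z) \<le> D * A"
      using T K by eventually_elim (simp add: abs_mult mult_mono D)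
  qed simp
  have bound: "AE z in M. exp (?\<zeta> z) \<le> ?B z"
    using T K
  proof eventually_elim
    case (elim z)
    have uK: "\<bar>u * K z\<bar> \<le> 1"
      using elim(2) u by (simp add: abs_mult) (meson abs_ge_zero mult_left_mono order_trans)
    have "?\<zeta> z = (u * K z) * (T z + \<sigma>\<^sup>2 / 2 * (u * K z))"
      by (simp add: algebra_simps power2_eq_square)
    moreover have "\<bar>T z + \<sigma>\<^sup>2 / 2 * (u * K z)\<bar> \<le> c"
    proof -
      have "\<bar>\<sigma>\<^sup>2 / 2 * (u * K z)\<bar> \<le> \<sigma>\<^sup>2 / 2 * 1"
        unfolding abs_mult[of "\<sigma>\<^sup>2 / 2"] using uK by (intro mult_mono) auto
      then show ?thesis using elim(1) by (simp add: c_def)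
    qed
    ultimately have z1: "\<bar>?\<zeta> z\<bar> \<le> \<bar>u * K z\<bar> * c"
      by (simp add: abs_mult mult_left_mono)
    also have "\<dots> \<le> 1 * c" using uK c0 by (intro mult_right_mono) auto
    finally have z2: "\<bar>?\<zeta> z\<bar> \<le> c" by simp
    have "(?\<zeta> z)\<^sup>2 \<le> (\<bar>u * K z\<bar> * c)\<^sup>2" using z1 by (metis abs_ge_zero power2_abs power_mono)
    then have "(?\<zeta> z)\<^sup>2 * exp \<bar>?\<zeta> z\<bar> \<le> (\<bar>u * K z\<bar> * c)\<^sup>2 * exp c"
      using z2 by (intro mult_mono) auto
    then have "exp (?\<zeta> z) \<le> 1 + ?\<zeta> z + (\<bar>u * K z\<bar> * c)\<^sup>2 * exp c"
      using exp_le_quadratic[of "?\<zeta> z"] by linarith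
    also have "\<dots> = ?B z"
      by (simp add: mgf_const_def c_def[symmetric] power_mult_distrib algebra_simps)
    finally show ?case .
  qed
  have inner: "(\<integral>\<^sup>+ e. ennreal (exp (u * ((T z + e) * K z))) \<partial>noise_law \<sigma>) = ennreal (exp (?\<zeta> z))" for z
  proof -
    have "exp (u * ((T z + e) * K z)) = exp (u * (T z * K z)) * exp ((u * K z) * e)" for e
      by (simp add: exp_add[symmetric] algebra_simps)
    then have "(\<integral>\<^sup>+ e. ennreal (exp (u * ((T z + e) * K z))) \<partial>noise_law \<sigma>) =
      (\<integral>\<^sup>+ e. ennreal (exp (u * (T z * K z))) * ennreal (exp ((u * K z) * e)) \<partial>noise_law \<sigma>)"
      by (simp only: ennreal_mult''[OF exp_ge_zero])
    also have "\<dots> = ennreal (exp (u * (T z * K z))) * ennreal (exp ((u * K z)\<^sup>2 * \<sigma>\<^sup>2 / 2))"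
      by (subst nn_integral_cmult) (simp_all add: nn_integral_noise_exp[OF \<sigma>])
    also have "\<dots> = ennreal (exp (?\<zeta> z))"
      by (simp add: ennreal_mult''[symmetric] exp_add power_mult_distrib mult_ac)
    finally show ?thesis .
  qed
  have "(\<integral>\<^sup>+ z. \<integral>\<^sup>+ e. ennreal (exp (u * ((T z + e) * K z))) \<partial>noise_law \<sigma> \<partial>M) \<le> (\<integral>\<^sup>+ z. ennreal (?B z) \<partial>M)"
    unfolding inner
    by (intro nn_integral_mono_AE) (use bound in \<open>eventually_elim, simp add: ennreal_leI\<close>)
  also have "\<dots> = ennreal (LINT z|M. ?B z)"
  proof (rule nn_integral_eq_integral)
    show "AE z in M. 0 \<le> ?B z" using bound by eventually_elim (meson exp_ge_zero order_trans)
  qed (use iK iT in auto)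
  also have "(LINT z|M. ?B z) = 1 + u * m + mgf_const D \<sigma> * u\<^sup>2 * (LINT z|M. (K z)\<^sup>2)"
    using iK iT by (simp add: m_def prob_space)
  also have "\<dots> \<le> 1 + (u * m + mgf_const D \<sigma> * u\<^sup>2 * V)"
  proof -
    have "mgf_const D \<sigma> * u\<^sup>2 * (LINT z|M. (K z)\<^sup>2) \<le> mgf_const D \<sigma> * u\<^sup>2 * V"
      using V by (intro mult_left_mono) (auto simp: mgf_const_def)
    then show ?thesis by simp
  qed
  also have "\<dots> \<le> exp (u * m + mgf_const D \<sigma> * u\<^sup>2 * V)" by (rule exp_ge_add_one_self)
  finally show ?thesis by (simp add: m_def ennreal_leI)
qed

section \<open>Deviations of the band estimates\<close>

text \<open>The second moment of the weights of band \<open>j\<close> is at most this constant times \<open>8 ^ j\<close>.\<close>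

definition weight_bound :: "real \<Rightarrow> real" where
  "weight_bound \<mu> = 9 * pi * exp (2 * \<bar>\<mu>\<bar>) * sqrt (1 + \<mu>\<^sup>2) ^ 3"

lemma weight_bound_pos: "weight_bound \<mu> > 0"
  by (auto simp: weight_bound_def add_pos_nonneg)

abbreviation band_weight :: "real \<Rightarrow> real ^ 2 \<Rightarrow> nat \<Rightarrow> real ^ 2 \<Rightarrow> real \<Rightarrow> real" where
  "band_weight \<mu> x j \<equiv> radon_weight \<mu> x (band_low j) (2 ^ j)"

lemma AE_band_weight:
  assumes "norm x \<le> 1"
  shows "AE z in design_law. \<bar>band_weight \<mu> x j (fst z) (snd z)\<bar> \<le> exp \<bar>\<mu>\<bar> * 4 ^ j"
  using AE_design_law_norm
proof eventually_elim
  case (elim z)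
  have "(2 ^ j)\<^sup>2 = (4 :: real) ^ j" by (simp add: power2_eq_square flip: power_mult_distrib)
  then show ?case using abs_radon_weight_le[OF assms elim band_low_bounds, of \<mu> j "snd z"] by simp
qed

lemma band_weight_second_moment:
  assumes x: "norm x \<le> 1"
  shows "(LINT z|design_law. (band_weight \<mu> x j (fst z) (snd z))\<^sup>2) \<le> weight_bound \<mu> * 8 ^ j"
proof -
  interpret prob_space design_law by (rule prob_space_design_law)
  let ?B = "sqrt ((2 ^ j)\<^sup>2 + \<mu>\<^sup>2)"
  let ?k = "radon_kernel \<mu> (band_low j) (2 ^ j)"
  let ?c = "exp (2 * \<bar>\<mu>\<bar>)"
  have pt: "(band_weight \<mu> x j (circle_point \<phi>) s)\<^sup>2 \<le> ?c * (?k (x \<bullet> circle_point \<phi> - s))\<^sup>2" for \<phi> s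
  proof -
    have "\<bar>band_weight \<mu> x j (circle_point \<phi>) s\<bar> =
        exp (- \<mu> * (x \<bullet> perp (circle_point \<phi>))) * \<bar>?k (x \<bullet> circle_point \<phi> - s)\<bar> / pi"
      by (simp add: radon_weight_def abs_mult)
    also have "\<dots> \<le> exp \<bar>\<mu>\<bar> * \<bar>?k (x \<bullet> circle_point \<phi> - s)\<bar> / 1"
      using exp_weight_le[OF x norm_circle_point, of "- \<mu>" \<phi>] pi_ge_two
      by (intro frac_le mult_mono) auto
    finally have "\<bar>band_weight \<mu> x j (circle_point \<phi>) s\<bar>\<^sup>2 \<le> (exp \<bar>\<mu>\<bar> * \<bar>?k (x \<bullet> circle_point \<phi> - s)\<bar>)\<^sup>2"
      by (intro power_mono) auto
    moreover have "(exp \<bar>\<mu>\<bar>)\<^sup>2 = ?c" by (simp add: exp_double)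
    ultimately show ?thesis by (simp add: power_mult_distrib)
  qed
  have "(\<integral>\<^sup>+ z. ennreal ((band_weight \<mu> x j (fst z) (snd z))\<^sup>2) \<partial>design_law) =
    (\<integral>\<^sup>+ \<phi>. (\<integral>\<^sup>+ s. ennreal ((band_weight \<mu> x j (circle_point \<phi>) s)\<^sup>2) * indicator {-1..1} s \<partial>lborel) / 2 *
      indicator {0..2 * pi} \<phi> \<partial>lborel) / ennreal (2 * pi)"
    by (subst nn_integral_design_law) auto
  also have "\<dots> \<le> (\<integral>\<^sup>+ \<phi>. ennreal (?c * (9 * pi * ?B ^ 3)) * indicator {0..2 * pi} \<phi> \<partial>lborel) / ennreal (2 * pi)"
  proof (intro divide_right_mono_ennreal nn_integral_mono mult_right_mono)
    fix \<phi> :: real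
    have "(\<integral>\<^sup>+ s. ennreal ((band_weight \<mu> x j (circle_point \<phi>) s)\<^sup>2) * indicator {-1..1} s \<partial>lborel) \<le>
        (\<integral>\<^sup>+ s. ennreal ?c * (ennreal ((?k (x \<bullet> circle_point \<phi> - s))\<^sup>2) * indicator {-1..1} s) \<partial>lborel)"
      using pt[of \<phi>] by (intro nn_integral_mono) (auto simp: ennreal_mult'[symmetric] indicator_def ennreal_leI)
    also have "\<dots> = ennreal ?c * (\<integral>\<^sup>+ s. ennreal ((?k (x \<bullet> circle_point \<phi> - s))\<^sup>2) * indicator {-1..1} s \<partial>lborel)"
      by (rule nn_integral_cmult) simp
    also have "\<dots> \<le> ennreal ?c * ennreal (18 * pi * ?B ^ 3)"
      using nn_integral_radon_kernel_square[OF band_low_bounds, of j \<mu> "x \<bullet> circle_point \<phi>"]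
      by (intro mult_left_mono) auto
    also have "\<dots> = ennreal (?c * (18 * pi * ?B ^ 3))"
      by (rule ennreal_mult'[symmetric]) simp
    finally have "(\<integral>\<^sup>+ s. ennreal ((band_weight \<mu> x j (circle_point \<phi>) s)\<^sup>2) * indicator {-1..1} s \<partial>lborel) / 2
      \<le> ennreal (?c * (18 * pi * ?B ^ 3)) / ennreal 2"
      by (simp add: divide_right_mono_ennreal)
    also have "\<dots> = ennreal (?c * (9 * pi * ?B ^ 3))"
      by (subst divide_ennreal) auto
    finally show "(\<integral>\<^sup>+ s. ennreal ((band_weight \<mu> x j (circle_point \<phi>) s)\<^sup>2) * indicator {-1..1} s \<partial>lborel) / 2
      \<le> ennreal (?c * (9 * pi * ?B ^ 3))" .
  qed auto
  also have "\<dots> = ennreal (?c * (9 * pi * ?B ^ 3))"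
  proof -
    have "(\<integral>\<^sup>+ \<phi>. ennreal (?c * (9 * pi * ?B ^ 3)) * indicator {0..2 * pi} \<phi> \<partial>lborel) =
        ennreal (?c * (9 * pi * ?B ^ 3)) * ennreal (2 * pi)"
      by (subst nn_integral_cmult_indicator) auto
    also have "\<dots> / ennreal (2 * pi) = ennreal (?c * (9 * pi * ?B ^ 3) * (2 * pi)) / ennreal (2 * pi)"
      by (subst ennreal_mult''[symmetric]) auto
    also have "\<dots> = ennreal (?c * (9 * pi * ?B ^ 3) * (2 * pi) / (2 * pi))"
      by (rule divide_ennreal) auto
    finally show ?thesis by simp
  qed
  also have "\<dots> \<le> ennreal (weight_bound \<mu> * 8 ^ j)"
  proof (rule ennreal_leI)
    have "?B \<le> sqrt ((2 ^ j)\<^sup>2 * (1 + \<mu>\<^sup>2))"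
    proof (rule real_sqrt_le_mono)
      have "1 * \<mu>\<^sup>2 \<le> (2 ^ j)\<^sup>2 * \<mu>\<^sup>2" by (intro mult_right_mono) auto
      then show "(2 ^ j)\<^sup>2 + \<mu>\<^sup>2 \<le> (2 ^ j)\<^sup>2 * (1 + \<mu>\<^sup>2)" by (simp add: algebra_simps)
    qed
    also have "\<dots> = 2 ^ j * sqrt (1 + \<mu>\<^sup>2)" by (simp add: real_sqrt_mult)
    finally have "?B ^ 3 \<le> (2 ^ j * sqrt (1 + \<mu>\<^sup>2)) ^ 3" by (intro power_mono) auto
    also have "\<dots> = 8 ^ j * sqrt (1 + \<mu>\<^sup>2) ^ 3"
      by (simp add: power_mult_distrib power_mult[symmetric] mult.commute[of j 3]) (simp add: power_mult)
    finally have "(?c * (9 * pi)) * ?B ^ 3 \<le> (?c * (9 * pi)) * (8 ^ j * sqrt (1 + \<mu>\<^sup>2) ^ 3)"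
      by (intro mult_left_mono) auto
    then show "?c * (9 * pi * ?B ^ 3) \<le> weight_bound \<mu> * 8 ^ j"
      by (simp add: weight_bound_def mult_ac)
  qed
  finally have nn: "(\<integral>\<^sup>+ z. ennreal ((band_weight \<mu> x j (fst z) (snd z))\<^sup>2) \<partial>design_law) \<le> ennreal (weight_bound \<mu> * 8 ^ j)" .
  have "integrable design_law (\<lambda>z. (band_weight \<mu> x j (fst z) (snd z))\<^sup>2)"
    by (rule integrableI_bounded) (use nn in \<open>auto intro: le_less_trans\<close>)
  then have "ennreal (LINT z|design_law. (band_weight \<mu> x j (fst z) (snd z))\<^sup>2) \<le> ennreal (weight_bound \<mu> * 8 ^ j)"
    using nn by (subst nn_integral_eq_integral[symmetric]) auto
  then show ?thesis using weight_bound_pos[of \<mu>] by (subst (asm) ennreal_le_iff) auto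
qed

lemma band_weight_mean:
  fixes f :: "real ^ 2 \<Rightarrow> real"
  assumes f: "integrable lborel f" "\<And>y. f y \<noteq> 0 \<Longrightarrow> norm y \<le> 1" "\<And>y. \<bar>f y\<bar> \<le> L" and x: "norm x \<le> 1"
  shows "(LINT z|design_law. exp_radon \<mu> f (fst z) (snd z) * band_weight \<mu> x j (fst z) (snd z)) = band_part f x j"
proof -
  interpret prob_space design_law by (rule prob_space_design_law)
  have [measurable]: "f \<in> borel_measurable borel" using f(1) by auto
  have L: "L \<ge> 0" using f(3)[of 0] by linarith
  have "integrable design_law (\<lambda>z. exp_radon \<mu> f (fst z) (snd z) * band_weight \<mu> x j (fst z) (snd z))"
  proof (rule integrable_const_bound[where B="(2 * L * exp \<bar>\<mu>\<bar>) * (exp \<bar>\<mu>\<bar> * 4 ^ j)"])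
    show "AE z in design_law. norm (exp_radon \<mu> f (fst z) (snd z) * band_weight \<mu> x j (fst z) (snd z)) \<le>
        (2 * L * exp \<bar>\<mu>\<bar>) * (exp \<bar>\<mu>\<bar> * 4 ^ j)"
      using AE_band_weight[OF x, of \<mu> j] AE_design_law_norm
    proof eventually_elim
      case (elim z)
      have "\<bar>exp_radon \<mu> f (fst z) (snd z)\<bar> \<le> 2 * L * exp \<bar>\<mu>\<bar>"
        by (rule abs_exp_radon_le) (use f elim in auto)
      then show ?case using elim(1) L by (simp add: abs_mult mult_mono)
    qed
  qed simp
  then show ?thesis
    by (subst integral_design_law) (simp_all add: radon_weight_unbiased[OF f(1,2) x])
qed

definition band_estimate :: "real \<Rightarrow> real ^ 2 \<Rightarrow> nat \<Rightarrow> nat \<Rightarrow> (nat \<Rightarrow> observation) \<Rightarrow> real" where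
  "band_estimate \<mu> x j n d =
    (\<Sum>i\<in>{1..n}. snd (snd (d i)) * band_weight \<mu> x j (fst (d i)) (fst (snd (d i)))) / real n"

lemma observation_measurable [measurable]:
  "fst \<in> (borel :: observation measure) \<rightarrow>\<^sub>M borel" "snd \<in> (borel :: observation measure) \<rightarrow>\<^sub>M borel"
  "fst \<in> (borel :: (real \<times> real) measure) \<rightarrow>\<^sub>M borel" "snd \<in> (borel :: (real \<times> real) measure) \<rightarrow>\<^sub>M borel"
  by (auto intro!: borel_measurable_continuous_onI continuous_intros)

lemma band_estimate_measurable [measurable]:
  "band_estimate \<mu> x j n \<in> borel_measurable (\<Pi>\<^sub>M i\<in>{1..n}. (borel :: observation measure))"
  unfolding band_estimate_def[abs_def] by measurable

lemma sets_data_law [measurable_cong]: "sets (data_law \<mu> \<sigma> n f) = sets (\<Pi>\<^sub>M i\<in>{1..n}. (borel :: observation measure))"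
  unfolding data_law_def by (intro sets_PiM_cong) (simp_all add: sets_observation_law)

lemma product_sigma_finite_observation_law:
  assumes "f \<in> borel_measurable borel" "\<sigma> > 0"
  shows "product_sigma_finite (\<lambda>_ :: nat. observation_law \<mu> \<sigma> f)"
proof -
  interpret prob_space "observation_law \<mu> \<sigma> f" by (rule prob_space_observation_law) fact+
  show ?thesis by unfold_locales
qed

lemma prob_space_data_law:
  assumes "f \<in> borel_measurable borel" "\<sigma> > 0"
  shows "prob_space (data_law \<mu> \<sigma> n f)"
  unfolding data_law_def by (intro prob_space_PiM prob_space_observation_law assms)

text \<open>The exponential of the error is a product over independent observations, each of which has exponential
moment close to one. The condition on \<open>u\<close> keeps the exponent of a single observation bounded.\<close>

lemma band_estimate_mgf:
  fixes f :: "real ^ 2 \<Rightarrow> real"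
  assumes f: "integrable lborel f" "\<And>y. f y \<noteq> 0 \<Longrightarrow> norm y \<le> 1" "\<And>y. \<bar>f y\<bar> \<le> L" and x: "norm x \<le> 1"
    and \<sigma>: "\<sigma> > 0" and n: "n \<ge> 1" and u: "\<bar>u\<bar> * (exp \<bar>\<mu>\<bar> * 4 ^ j) \<le> real n"
  shows "(\<integral>\<^sup>+ d. ennreal (exp (u * (band_estimate \<mu> x j n d - band_part f x j))) \<partial>data_law \<mu> \<sigma> n f) \<le>
    ennreal (exp (mgf_const (2 * L * exp \<bar>\<mu>\<bar>) \<sigma> * weight_bound \<mu> * (u\<^sup>2 * 8 ^ j / real n)))"
proof -
  have [measurable]: "f \<in> borel_measurable borel" using f(1) by auto
  have L: "L \<ge> 0" using f(3)[of 0] by linarith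
  interpret product_sigma_finite "\<lambda>_ :: nat. observation_law \<mu> \<sigma> f"
    by (rule product_sigma_finite_observation_law) (simp_all add: \<sigma>)
  define v where "v = u / real n"
  define m where "m = band_part f x j"
  define c where "c = mgf_const (2 * L * exp \<bar>\<mu>\<bar>) \<sigma>"
  let ?K = "band_weight \<mu> x j"
  let ?p = "\<lambda>w :: observation. exp (v * (snd (snd w) * ?K (fst w) (fst (snd w))) - v * m)"
  have "(\<integral>\<^sup>+ w. ennreal (?p w) \<partial>observation_law \<mu> \<sigma> f) \<le> ennreal (exp (c * v\<^sup>2 * (weight_bound \<mu> * 8 ^ j)))"
  proof -
    have "(\<integral>\<^sup>+ w. ennreal (?p w) \<partial>observation_law \<mu> \<sigma> f) = (\<integral>\<^sup>+ w. ennreal (exp (- (v * m))) *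
        ennreal (exp (v * (snd (snd w) * ?K (fst w) (fst (snd w))))) \<partial>observation_law \<mu> \<sigma> f)"
      by (simp add: ennreal_mult''[symmetric] exp_add[symmetric])
    also have "\<dots> = ennreal (exp (- (v * m))) *
        (\<integral>\<^sup>+ w. ennreal (exp (v * (snd (snd w) * ?K (fst w) (fst (snd w))))) \<partial>observation_law \<mu> \<sigma> f)"
      by (rule nn_integral_cmult) simp
    also have "(\<integral>\<^sup>+ w. ennreal (exp (v * (snd (snd w) * ?K (fst w) (fst (snd w))))) \<partial>observation_law \<mu> \<sigma> f) =
        (\<integral>\<^sup>+ z. \<integral>\<^sup>+ e. ennreal (exp (v * ((exp_radon \<mu> f (fst z) (snd z) + e) * ?K (fst z) (snd z)))) \<partial>noise_law \<sigma> \<partial>design_law)"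
      by (subst nn_integral_observation_law[OF _ \<sigma>]) simp_all
    also have "\<dots> \<le> ennreal (exp (v * (LINT z|design_law. exp_radon \<mu> f (fst z) (snd z) * ?K (fst z) (snd z)) +
        c * v\<^sup>2 * (weight_bound \<mu> * 8 ^ j)))"
      unfolding c_def
    proof (rule regression_mgf[OF prob_space_design_law])
      show "AE z in design_law. \<bar>exp_radon \<mu> f (fst z) (snd z)\<bar> \<le> 2 * L * exp \<bar>\<mu>\<bar>"
        using AE_design_law_norm by eventually_elim (rule abs_exp_radon_le[OF f(2,3)])
      show "AE z in design_law. \<bar>?K (fst z) (snd z)\<bar> \<le> exp \<bar>\<mu>\<bar> * 4 ^ j"
        by (rule AE_band_weight[OF x])
      show "\<bar>v\<bar> * (exp \<bar>\<mu>\<bar> * 4 ^ j) \<le> 1"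
        using u n by (simp add: v_def field_simps)
    qed (use L \<sigma> band_weight_second_moment[OF x] in auto)
    also have "ennreal (exp (- (v * m))) * \<dots> = ennreal (exp (c * v\<^sup>2 * (weight_bound \<mu> * 8 ^ j)))"
      by (simp add: band_weight_mean[OF f x] m_def ennreal_mult''[symmetric] exp_add[symmetric])
    finally show ?thesis by (simp add: mult_left_mono)
  qed
  note factor = this
  have "(\<integral>\<^sup>+ d. ennreal (exp (u * (band_estimate \<mu> x j n d - m))) \<partial>data_law \<mu> \<sigma> n f) =
      (\<integral>\<^sup>+ d. (\<Prod>i\<in>{1..n}. ennreal (?p (d i))) \<partial>data_law \<mu> \<sigma> n f)"
  proof (intro nn_integral_cong)
    fix d :: "nat \<Rightarrow> observation"
    have "u * (band_estimate \<mu> x j n d - m) =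
        (\<Sum>i\<in>{1..n}. v * (snd (snd (d i)) * ?K (fst (d i)) (fst (snd (d i)))) - v * m)"
    proof -
      let ?S = "\<Sum>i\<in>{1..n}. snd (snd (d i)) * ?K (fst (d i)) (fst (snd (d i)))"
      have "(\<Sum>i\<in>{1..n}. v * (snd (snd (d i)) * ?K (fst (d i)) (fst (snd (d i)))) - v * m) =
          v * ?S - real n * (v * m)"
        by (simp only: sum_subtractf sum_distrib_left[symmetric] sum_constant card_atLeastAtMost) simp
      also have "\<dots> = u * (?S / real n - m)" using n by (simp add: v_def field_simps)
      finally show ?thesis by (simp add: band_estimate_def)
    qed
    then have "exp (u * (band_estimate \<mu> x j n d - m)) = (\<Prod>i\<in>{1..n}. ?p (d i))"
      by (simp add: exp_sum)
    then show "ennreal (exp (u * (band_estimate \<mu> x j n d - m))) = (\<Prod>i\<in>{1..n}. ennreal (?p (d i)))"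
      by (simp add: prod_ennreal)
  qed
  also have "\<dots> = (\<Prod>i\<in>{1..n}. \<integral>\<^sup>+ w. ennreal (?p w) \<partial>observation_law \<mu> \<sigma> f)"
    unfolding data_law_def by (rule product_nn_integral_prod) auto
  also have "\<dots> \<le> (\<Prod>i\<in>{1..n}. ennreal (exp (c * v\<^sup>2 * (weight_bound \<mu> * 8 ^ j))))"
    by (simp only: prod_constant) (rule power_mono[OF factor], simp)
  also have "\<dots> = ennreal (exp (real n * (c * v\<^sup>2 * (weight_bound \<mu> * 8 ^ j))))"
    by (simp add: ennreal_power exp_of_nat_mult)
  also have "real n * (c * v\<^sup>2 * (weight_bound \<mu> * 8 ^ j)) = c * weight_bound \<mu> * (u\<^sup>2 * 8 ^ j / real n)"
    using n by (simp add: v_def field_simps power2_eq_square)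
  finally show ?thesis by (simp add: m_def c_def)
qed

text \<open>Trades the square and the indicator for an exponential, half of whose exponent is spent on the factor
\<open>exp (- l * t)\<close>; truncated second moments then follow from exponential moments.\<close>

lemma square_tail_le_exp:
  fixes z l t :: real
  assumes "l > 0"
  shows "z\<^sup>2 * indicator {z. \<bar>z\<bar> > t} z \<le> 2 / l\<^sup>2 * exp (- l * t) * (exp (2 * l * z) + exp (- 2 * l * z))"
proof (cases "\<bar>z\<bar> > t")
  case True
  let ?y = "l * \<bar>z\<bar>"
  have y: "0 \<le> ?y" using assms by simp
  have "?y\<^sup>2 / 2 \<le> exp ?y"
    using exp_lower_Taylor_quadratic[OF y] y by linarith
  then have "z\<^sup>2 \<le> 2 / l\<^sup>2 * exp ?y" using assms by (simp add: field_simps power_mult_distrib)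
  also have "\<dots> \<le> 2 / l\<^sup>2 * (exp (- l * t) * exp (2 * ?y))"
  proof (intro mult_left_mono)
    have "l * t \<le> l * \<bar>z\<bar>" using True assms by simp
    then have "?y \<le> - l * t + 2 * ?y" by simp
    then show "exp ?y \<le> exp (- l * t) * exp (2 * ?y)" by (simp add: exp_add[symmetric])
  qed simp
  also have "\<dots> \<le> 2 / l\<^sup>2 * (exp (- l * t) * (exp (2 * l * z) + exp (- 2 * l * z)))"
  proof -
    have "exp (2 * ?y) \<le> exp (2 * l * z) + exp (- 2 * l * z)"
    proof (cases "z \<ge> 0")
      case True
      then have "exp (2 * ?y) = exp (2 * l * z)" by simp
      also have "\<dots> \<le> exp (2 * l * z) + exp (- 2 * l * z)" by simp
      finally show ?thesis .
    next
      case False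
      then have "exp (2 * ?y) = exp (- 2 * l * z)" by simp
      also have "\<dots> \<le> exp (2 * l * z) + exp (- 2 * l * z)" by simp
      finally show ?thesis .
    qed
    then show ?thesis by (intro mult_left_mono) auto
  qed
  finally show ?thesis using True by (simp add: mult.assoc)
qed (simp add: add_nonneg_nonneg)

lemma band_estimate_tail:
  fixes f :: "real ^ 2 \<Rightarrow> real"
  assumes f: "integrable lborel f" "\<And>y. f y \<noteq> 0 \<Longrightarrow> norm y \<le> 1" "\<And>y. \<bar>f y\<bar> \<le> L" and x: "norm x \<le> 1"
    and \<sigma>: "\<sigma> > 0" and n: "n \<ge> 1" and l: "l > 0" "2 * l * (exp \<bar>\<mu>\<bar> * 4 ^ j) \<le> real n"
  defines "Z \<equiv> \<lambda>d. band_estimate \<mu> x j n d - band_part f x j"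
  shows "(\<integral>\<^sup>+ d. ennreal ((Z d)\<^sup>2 * indicator {z. \<bar>z\<bar> > t} (Z d)) \<partial>data_law \<mu> \<sigma> n f) \<le>
    ennreal (4 / l\<^sup>2 * exp (4 * mgf_const (2 * L * exp \<bar>\<mu>\<bar>) \<sigma> * weight_bound \<mu> * (l\<^sup>2 * 8 ^ j / real n) - l * t))"
proof -
  define E where "E = exp (4 * mgf_const (2 * L * exp \<bar>\<mu>\<bar>) \<sigma> * weight_bound \<mu> * (l\<^sup>2 * 8 ^ j / real n))"
  let ?D = "data_law \<mu> \<sigma> n f"
  let ?a = "2 / l\<^sup>2 * exp (- l * t)"
  have [measurable]: "Z \<in> borel_measurable ?D" unfolding Z_def by measurable
  have b: "(\<integral>\<^sup>+ d. ennreal (exp (u * Z d)) \<partial>?D) \<le> ennreal E" if "u = 2 * l \<or> u = - 2 * l" for u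
    using band_estimate_mgf[OF f x \<sigma> n, of u \<mu> j] that l
    by (auto simp: Z_def E_def power_mult_distrib mult_ac)
  have "(\<integral>\<^sup>+ d. ennreal ((Z d)\<^sup>2 * indicator {z. \<bar>z\<bar> > t} (Z d)) \<partial>?D) \<le>
      (\<integral>\<^sup>+ d. ennreal ?a * (ennreal (exp (2 * l * Z d)) + ennreal (exp (- 2 * l * Z d))) \<partial>?D)"
  proof (rule nn_integral_mono)
    fix d
    have "ennreal ?a * (ennreal (exp (2 * l * Z d)) + ennreal (exp (- 2 * l * Z d))) =
        ennreal (?a * (exp (2 * l * Z d) + exp (- 2 * l * Z d)))"
    proof -
      have "ennreal (?a * (exp (2 * l * Z d) + exp (- 2 * l * Z d))) =
          ennreal ?a * ennreal (exp (2 * l * Z d) + exp (- 2 * l * Z d))"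
        by (rule ennreal_mult') simp
      also have "ennreal (exp (2 * l * Z d) + exp (- 2 * l * Z d)) =
          ennreal (exp (2 * l * Z d)) + ennreal (exp (- 2 * l * Z d))"
        by (rule ennreal_plus) auto
      finally show ?thesis ..
    qed
    then show "ennreal ((Z d)\<^sup>2 * indicator {z. \<bar>z\<bar> > t} (Z d)) \<le>
        ennreal ?a * (ennreal (exp (2 * l * Z d)) + ennreal (exp (- 2 * l * Z d)))"
      using square_tail_le_exp[OF l(1), of "Z d" t] by (simp only: ennreal_leI)
  qed
  also have "\<dots> = ennreal ?a * ((\<integral>\<^sup>+ d. ennreal (exp (2 * l * Z d)) \<partial>?D) + (\<integral>\<^sup>+ d. ennreal (exp (- 2 * l * Z d)) \<partial>?D))"
    by (subst nn_integral_cmult, simp, subst nn_integral_add) simp_all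
  also have "\<dots> \<le> ennreal ?a * (ennreal E + ennreal E)"
    by (intro mult_left_mono add_mono b) auto
  also have "\<dots> = ennreal (?a * (E + E))"
  proof -
    have "ennreal E + ennreal E = ennreal (E + E)" by (rule ennreal_plus[symmetric]) (auto simp: E_def)
    then show ?thesis by (simp only:) (rule ennreal_mult'[symmetric], simp)
  qed
  also have "?a * (E + E) = 4 / l\<^sup>2 * (E * exp (- l * t))" by simp
  also have "E * exp (- l * t) = exp (4 * mgf_const (2 * L * exp \<bar>\<mu>\<bar>) \<sigma> * weight_bound \<mu> * (l\<^sup>2 * 8 ^ j / real n) - l * t)"
    unfolding E_def by (simp add: exp_add[symmetric])
  finally show ?thesis .
qed

section \<open>Adaptive reconstruction by thresholding\<close>

definition hard_threshold :: "real \<Rightarrow> real \<Rightarrow> real" where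
  "hard_threshold t z = (if \<bar>z\<bar> > t then z else 0)"

text \<open>If the noise \<open>z - d\<close> is at most half the threshold, a kept value has \<open>d\<close> of at least half the threshold and
the noise is no larger than \<open>d\<close>; a killed one has \<open>d\<close> of at most three halves of the threshold. Larger noise is paid for by the
last term.\<close>

lemma hard_threshold_error:
  assumes "t \<ge> 0"
  shows "\<bar>hard_threshold t z - d\<bar> \<le> 3 * min \<bar>d\<bar> t + 3 * (\<bar>z - d\<bar> * indicator {u. \<bar>u\<bar> > t / 2} (z - d))"
  using assms by (auto simp: hard_threshold_def indicator_def min_def abs_if split: if_splits)

text \<open>The highest band used: \<open>2 ^ top_level n\<close> is the cube root of \<open>n\<close> up to a factor of two. That is beyond every crossover
frequency because \<open>2 * \<beta> + 1 > 3\<close>, and low enough for the exponential moments.\<close>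

definition top_level :: "nat \<Rightarrow> nat" where
  "top_level n = (LEAST j. n \<le> 8 ^ j)"

lemma top_level_bounds:
  assumes "n \<ge> 2"
  shows "n \<le> 8 ^ top_level n" "8 ^ top_level n < 8 * n"
proof -
  have ex: "n \<le> 8 ^ n" by (rule less_imp_le) (rule less_le_trans[OF less_exp], rule power_mono, auto)
  show "n \<le> 8 ^ top_level n" unfolding top_level_def by (rule LeastI[of _ n]) (rule ex)
  show "8 ^ top_level n < 8 * n"
  proof (cases "top_level n")
    case (Suc k)
    then have "\<not> n \<le> 8 ^ k" unfolding top_level_def using not_less_Least[of k "\<lambda>j. n \<le> 8 ^ j"] by simp
    then show ?thesis using Suc by simp
  qed (use assms in simp)
qed

text \<open>The first dyadic level above the crossover frequency \<open>R\<close>. Below it the thresholds form a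
geometric sum dominated by its last term; there \<open>2 ^ m \<le> 2 * R\<close> enters with the fixed power \<open>3 / 2\<close>. Above it the tail is
bounded through \<open>R \<le> 2 ^ m\<close>, which loses no factor. Rounding in the other direction would cost
\<open>2 powr (\<beta> - 1)\<close>, which is unbounded over the scale.\<close>

lemma crossover_level:
  fixes q \<beta> :: real
  assumes q: "0 < q" "q < 1" and \<beta>: "\<beta> > 1" and J: "1 / q \<le> 8 ^ J"
  defines "\<psi> \<equiv> q powr ((\<beta> - 1) / (2 * \<beta> + 1))"
  obtains m where "m \<le> J" "(2 ^ m) powr (- (\<beta> - 1)) \<le> \<psi>" "(\<Sum>j\<le>m. sqrt (8 ^ j * q)) \<le> 6 * \<psi>"
proof -
  define R where "R = q powr (- (1 / (2 * \<beta> + 1)))"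
  have R1: "R \<ge> 1" using q \<beta> by (simp add: R_def powr_minus one_le_inverse_iff powr_le1)
  have psi1: "R powr (- (\<beta> - 1)) = \<psi>"
  proof -
    have "(- (1 / (2 * \<beta> + 1))) * (- (\<beta> - 1)) = (\<beta> - 1) / (2 * \<beta> + 1)"
      by (simp only: mult_minus_left mult_minus_right minus_minus) simp
    then show ?thesis by (simp only: R_def \<psi>_def powr_powr)
  qed
  have psi2: "sqrt q * R powr (3 / 2) = \<psi>"
  proof -
    have "1 / 2 + (- (1 / (2 * \<beta> + 1))) * (3 / 2) = (\<beta> - 1) / (2 * \<beta> + 1)"
      using \<beta> by (simp add: field_simps)
    then show ?thesis using q
      by (simp add: R_def \<psi>_def powr_powr powr_half_sqrt[symmetric] powr_add[symmetric])
  qed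
  \<comment> \<open>rounded upwards, so that the tail beyond \<open>2 ^ m\<close> is at most the tail beyond \<open>R\<close>\<close>
  define m where "m = (LEAST m. R \<le> 2 ^ m)"
  have RJ: "R \<le> 2 ^ J"
  proof -
    have "R \<le> q powr (- (1 / 3))" unfolding R_def
      using q \<beta> by (intro powr_mono') (auto simp: field_simps)
    also have "\<dots> = (1 / q) powr (1 / 3)" using q by (simp add: powr_minus powr_divide inverse_eq_divide)
    also have "\<dots> \<le> (8 ^ J) powr (1 / 3)" using q J by (intro powr_mono2) auto
    also have "(8 ^ J :: real) = (2 ^ J) powr 3"
      by (simp add: powr_numeral power_mult[symmetric] mult.commute[of J 3]) (simp add: power_mult)
    also have "((2 ^ J :: real) powr 3) powr (1 / 3) = 2 ^ J" by (simp only: powr_powr) simp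
    finally show ?thesis .
  qed
  have mJ: "m \<le> J" unfolding m_def by (rule Least_le) (rule RJ)
  have Rm: "R \<le> 2 ^ m" unfolding m_def by (rule LeastI[of _ J]) (rule RJ)
  have upper: "2 ^ m \<le> 2 * R"
  proof (cases m)
    case (Suc k)
    then have "\<not> R \<le> 2 ^ k" unfolding m_def using not_less_Least[of k "\<lambda>j. R \<le> 2 ^ j"] by simp
    then show ?thesis using Suc by simp
  qed (use R1 in simp)
  have "(2 ^ m) powr (- (\<beta> - 1)) \<le> R powr (- (\<beta> - 1))"
    using R1 Rm \<beta> by (intro powr_mono2') auto
  then have p: "(2 ^ m) powr (- (\<beta> - 1)) \<le> \<psi>" by (simp only: psi1)
  have geo: "(\<Sum>j\<le>m. sqrt 8 ^ j) \<le> 2 * sqrt 8 ^ m" for m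
  proof (induction m)
    case (Suc m)
    have "2 \<le> sqrt 8" by (rule real_le_rsqrt) simp
    then have "2 * sqrt 8 ^ m \<le> sqrt 8 * sqrt 8 ^ m" by (intro mult_right_mono) auto
    then show ?case using Suc unfolding sum.atMost_Suc power_Suc by linarith
  qed simp
  have "(\<Sum>j\<le>m. sqrt (8 ^ j * q)) = sqrt q * (\<Sum>j\<le>m. sqrt 8 ^ j)"
    by (simp add: sum_distrib_left real_sqrt_mult real_sqrt_power mult.commute)
  also have "\<dots> \<le> sqrt q * (2 * sqrt 8 ^ m)" using geo q by (intro mult_left_mono) auto
  also have "sqrt 8 ^ m = (2 ^ m) powr (3 / 2)"
  proof -
    have "(2 ^ m :: real) powr (3 / 2) = ((2 ^ m) powr 3) powr (1 / 2)" by (simp only: powr_powr) simp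
    also have "(2 ^ m :: real) powr 3 = 8 ^ m"
      by (simp add: powr_numeral power_mult[symmetric] mult.commute[of m 3]) (simp add: power_mult)
    finally show ?thesis by (simp add: powr_half_sqrt real_sqrt_power)
  qed
  also have "sqrt q * (2 * (2 ^ m) powr (3 / 2)) \<le> sqrt q * (2 * (2 * R) powr (3 / 2))"
    using upper q by (intro mult_left_mono powr_mono2) auto
  also have "(2 * R) powr (3 / 2) = 2 powr (3 / 2) * R powr (3 / 2)"
    using R1 by (simp add: powr_mult)
  also have "sqrt q * (2 * (2 powr (3 / 2) * R powr (3 / 2))) = 2 * 2 powr (3 / 2) * \<psi>"
    by (simp add: psi2[symmetric])
  also have "\<dots> \<le> 2 * 3 * \<psi>"
  proof -
    have "(2 powr (3 / 2) :: real) = (2 powr 3) powr (1 / 2)" by (simp only: powr_powr) simp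
    also have "\<dots> = sqrt (2 powr 3)" by (rule powr_half_sqrt) simp
    also have "\<dots> \<le> 3" by (rule real_le_lsqrt) auto
    finally show ?thesis by (intro mult_right_mono) (auto simp: \<psi>_def)
  qed
  finally have "(\<Sum>j\<le>m. sqrt (8 ^ j * q)) \<le> 6 * \<psi>" by simp
  with mJ p that show ?thesis by blast
qed

text \<open>Up to constants \<open>8 ^ j / n\<close> bounds the variance of the estimate of band \<open>j\<close>; the factor \<open>ln n\<close> lifts the
threshold above the noise of all bands at once.\<close>

definition adaptive_reconstruction :: "real \<Rightarrow> real \<Rightarrow> real ^ 2 \<Rightarrow> nat \<Rightarrow> (nat \<Rightarrow> observation) \<Rightarrow> real" where
  "adaptive_reconstruction \<mu> \<kappa> x n d =
    (\<Sum>j\<le>top_level n. hard_threshold (\<kappa> * sqrt (8 ^ j * (ln (real n) / real n))) (band_estimate \<mu> x j n d))"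

lemma adaptive_reconstruction_measurable [measurable]:
  "adaptive_reconstruction \<mu> \<kappa> x n \<in> borel_measurable (\<Pi>\<^sub>M i\<in>{1..n}. (borel :: observation measure))"
  unfolding adaptive_reconstruction_def[abs_def] hard_threshold_def by measurable

text \<open>The exponential moments are needed at the scale \<open>sqrt (n * ln n / 8 ^ j)\<close>, which is
\<open>sqrt (ln n)\<close> over the standard deviation of the band estimate. Since \<open>2 ^ j\<close> is at most of the order of the cube root of \<open>n\<close>, they are available there for large \<open>n\<close>.\<close>

lemma eventually_level_condition:
  "\<forall>\<^sub>F n in sequentially. n \<ge> 3 \<and> top_level n + 1 \<le> n \<and>
    (\<forall>j\<le>top_level n. 2 * sqrt (real n * ln (real n) / 8 ^ j) * (exp \<bar>\<mu>\<bar> * 4 ^ j) \<le> real n)"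
proof -
  define c where "c = 4 * (exp \<bar>\<mu>\<bar>)\<^sup>2"
  have c: "c > 0" by (simp add: c_def)
  have "(\<lambda>n. ln (real n) * (8 * real n) powr (1 / 3) / real n) \<longlonglongrightarrow> 0" by real_asymp
  then have "\<forall>\<^sub>F n in sequentially. ln (real n) * (8 * real n) powr (1 / 3) / real n < 1 / c"
    using c by (intro order_tendstoD) auto
  moreover have "\<forall>\<^sub>F n in sequentially. (8 * real n) powr (1 / 3) \<le> real n" by real_asymp
  moreover have "\<forall>\<^sub>F n in sequentially. n \<ge> (3 :: nat)" by (rule eventually_ge_at_top)
  ultimately show ?thesis
  proof eventually_elim
    case (elim n)
    let ?J = "top_level n"
    have l: "ln (real n) \<ge> 0" using elim(3) by simp
    have "8 ^ ?J \<le> 8 * n" using top_level_bounds(2)[of n] elim(3) by simp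
    then have "real (8 ^ ?J) \<le> real (8 * n)" by (simp only: of_nat_le_iff)
    then have "(8 :: real) ^ ?J \<le> 8 * real n" by simp
    moreover have "((2 :: real) ^ ?J) powr 3 = 8 ^ ?J"
      by (simp add: powr_numeral power_mult[symmetric] mult.commute[of ?J 3]) (simp add: power_mult)
    ultimately have "((2 ^ ?J) powr 3) powr (1 / 3) \<le> (8 * real n) powr (1 / 3)"
      by (intro powr_mono2) auto
    then have J: "2 ^ ?J \<le> (8 * real n) powr (1 / 3)" unfolding powr_powr by simp
    have "real (?J + 1) \<le> 2 ^ ?J"
    proof -
      have "Suc ?J \<le> 2 ^ ?J" by (rule Suc_leI) (rule less_exp)
      then show ?thesis by (metis Suc_eq_plus1 of_nat_le_iff of_nat_numeral of_nat_power)
    qed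
    then have "real (?J + 1) \<le> real n" using J elim(2) by linarith
    then have 1: "?J + 1 \<le> n" by (simp only: of_nat_le_iff)
    have "2 * sqrt (real n * ln (real n) / 8 ^ j) * (exp \<bar>\<mu>\<bar> * 4 ^ j) \<le> real n" if "j \<le> ?J" for j
    proof -
      have "(2 * sqrt (real n * ln (real n) / 8 ^ j) * (exp \<bar>\<mu>\<bar> * 4 ^ j))\<^sup>2 =
          c * (real n * ln (real n)) * ((4 ^ j)\<^sup>2 / 8 ^ j)"
        using l by (simp add: c_def power_mult_distrib)
      also have "(4 ^ j)\<^sup>2 / 8 ^ j = (2 ^ j :: real)"
        by (simp add: power_mult_distrib[symmetric] power2_eq_square power_divide[symmetric])
      also have "c * (real n * ln (real n)) * 2 ^ j \<le> c * (real n * ln (real n)) * (8 * real n) powr (1 / 3)"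
      proof (rule mult_left_mono)
        have "(2 :: real) ^ j \<le> 2 ^ ?J" using that by (intro power_increasing) auto
        then show "2 ^ j \<le> (8 * real n) powr (1 / 3)" using J by linarith
      qed (use c l in auto)
      also have "\<dots> = c * (real n)\<^sup>2 * (ln (real n) * (8 * real n) powr (1 / 3) / real n)"
        using elim(3) by (simp add: power2_eq_square)
      also have "\<dots> \<le> c * (real n)\<^sup>2 * (1 / c)"
        using elim(1) c by (intro mult_left_mono) auto
      also have "\<dots> = (real n)\<^sup>2" using c by simp
      finally show ?thesis by (rule power2_le_imp_le) simp
    qed
    with 1 elim(3) show ?case by blast
  qed
qed

text \<open>The error is at most a deterministic part, of the order of the rate by the choice of the crossover level, plus the
noise beyond half the thresholds in each band. The constant \<open>\<kappa>\<close> makes the mean square of the latter of order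
\<open>n powr (- 4)\<close> per band, negligible even after summing over all bands.\<close>

lemma adaptive_reconstruction_risk:
  fixes f :: "real ^ 2 \<Rightarrow> real" and \<beta> \<beta>\<^sub>1 :: real
  assumes f: "f \<in> smooth_class C L \<beta>" and \<beta>: "\<beta>\<^sub>1 > 1" "\<beta> \<ge> \<beta>\<^sub>1" and C: "C > 0" and \<sigma>: "\<sigma> > 0"
    and x: "norm x \<le> 1" and n: "n \<ge> 3" "top_level n + 1 \<le> n"
    and cond: "\<And>j. j \<le> top_level n \<Longrightarrow> 2 * sqrt (real n * ln (real n) / 8 ^ j) * (exp \<bar>\<mu>\<bar> * 4 ^ j) \<le> real n"
  defines "\<psi> \<equiv> (ln (real n) / real n) powr ((\<beta> - 1) / (2 * \<beta> + 1))"
    and "\<kappa> \<equiv> 8 * (mgf_const (2 * L * exp \<bar>\<mu>\<bar>) \<sigma> * weight_bound \<mu> + 1)"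
    and "K \<equiv> sqrt (C * pi / (\<beta>\<^sub>1 - 1))"
  shows "(\<integral>\<^sup>+ d. ennreal ((adaptive_reconstruction \<mu> \<kappa> x n d - f x)\<^sup>2) \<partial>data_law \<mu> \<sigma> n f) \<le>
    ennreal ((2 * (3 * K + 18 * \<kappa>)\<^sup>2 + 576) * \<psi>\<^sup>2)"
proof -
  define c where "c = mgf_const (2 * L * exp \<bar>\<mu>\<bar>) \<sigma> * weight_bound \<mu>"
  define q where "q = ln (real n) / real n"
  define \<tau> where "\<tau> j = \<kappa> * sqrt (8 ^ j * q)" for j :: nat
  define J where "J = top_level n"
  define Z where "Z j d = band_estimate \<mu> x j n d - band_part f x j" for j d
  define Y where "Y j d = \<bar>Z j d\<bar> * indicator {u. \<bar>u\<bar> > \<tau> j / 2} (Z j d)" for j d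
  let ?D = "data_law \<mu> \<sigma> n f"
  have fs: "integrable lborel f" "\<And>y. f y \<noteq> 0 \<Longrightarrow> norm y \<le> 1" "\<And>y. \<bar>f y\<bar> \<le> L"
    using f by (auto simp: smooth_class_def sobolev_ball_def bounded_class_def)
  have fm: "f \<in> borel_measurable borel" using fs(1) by auto
  interpret prob_space ?D by (rule prob_space_data_law[OF fm \<sigma>])
  have L: "L \<ge> 0" using fs(3)[of 0] by linarith
  have cpos: "c \<ge> 0"
    using weight_bound_pos[of \<mu>] by (simp add: c_def mgf_const_def add_nonneg_nonneg)
  have kpos: "\<kappa> \<ge> 0" and keq: "\<kappa> = 8 * (c + 1)" using cpos by (simp_all add: \<kappa>_def c_def)
  have Kpos: "K \<ge> 0" using C \<beta> by (simp add: K_def)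
  have lnn: "ln (real n) \<ge> 1"
  proof -
    have "exp 1 \<le> real n" using exp_le n(1) by linarith
    then show ?thesis by (subst ln_ge_iff) (use n in auto)
  qed
  have q: "0 < q" "q < 1" "1 / real n \<le> q"
    using lnn n ln_less_self[of "real n"] by (auto simp: q_def field_simps)
  have "n \<le> 8 ^ J" using top_level_bounds(1)[of n] n by (simp add: J_def)
  then have "real n \<le> real (8 ^ J)" by (simp only: of_nat_le_iff)
  moreover have "1 / q \<le> real n" using q n by (simp add: field_simps)
  ultimately have "1 / q \<le> real (8 ^ J)" by linarith
  then have qJ: "1 / q \<le> 8 ^ J" by simp
  obtain m where m: "m \<le> J" "(2 ^ m) powr (- (\<beta> - 1)) \<le> \<psi>" "(\<Sum>j\<le>m. sqrt (8 ^ j * q)) \<le> 6 * \<psi>"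
    using crossover_level[OF q(1,2) _ qJ, of \<beta>] \<beta> unfolding \<psi>_def q_def by force
  have tpos: "\<tau> j \<ge> 0" for j using kpos q by (simp add: \<tau>_def)
  have [measurable]: "Y j \<in> borel_measurable ?D" "Z j \<in> borel_measurable ?D" for j
    unfolding Y_def Z_def by measurable
  have error: "\<bar>adaptive_reconstruction \<mu> \<kappa> x n d - f x\<bar> \<le> (3 * K + 18 * \<kappa>) * \<psi> + 3 * (\<Sum>j\<le>J. Y j d)" for d
  proof -
    have "adaptive_reconstruction \<mu> \<kappa> x n d - f x =
      (\<Sum>j\<le>J. hard_threshold (\<tau> j) (band_estimate \<mu> x j n d) - band_part f x j) - (f x - (\<Sum>j\<le>J. band_part f x j))"
      by (simp add: adaptive_reconstruction_def \<tau>_def q_def J_def sum_subtractf)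
    then have "\<bar>adaptive_reconstruction \<mu> \<kappa> x n d - f x\<bar> \<le>
        (\<Sum>j\<le>J. \<bar>hard_threshold (\<tau> j) (band_estimate \<mu> x j n d) - band_part f x j\<bar>) +
        \<bar>f x - (\<Sum>j\<le>J. band_part f x j)\<bar>"
      using sum_abs[of "\<lambda>j. hard_threshold (\<tau> j) (band_estimate \<mu> x j n d) - band_part f x j" "{..J}"] by linarith
    also have "(\<Sum>j\<le>J. \<bar>hard_threshold (\<tau> j) (band_estimate \<mu> x j n d) - band_part f x j\<bar>) \<le>
        (\<Sum>j\<le>J. 3 * min \<bar>band_part f x j\<bar> (\<tau> j) + 3 * Y j d)"
      unfolding Y_def Z_def by (intro sum_mono hard_threshold_error tpos)
    also have "\<dots> = 3 * (\<Sum>j\<le>J. min \<bar>band_part f x j\<bar> (\<tau> j)) + 3 * (\<Sum>j\<le>J. Y j d)"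
      by (simp add: sum.distrib sum_distrib_left)
    also have "(\<Sum>j\<le>J. min \<bar>band_part f x j\<bar> (\<tau> j)) =
        (\<Sum>j\<le>m. min \<bar>band_part f x j\<bar> (\<tau> j)) + (\<Sum>j\<in>{m<..J}. min \<bar>band_part f x j\<bar> (\<tau> j))"
    proof -
      have "{..J} = {..m} \<union> {m<..J}" using m(1) by auto
      then show ?thesis by (simp only:) (rule sum.union_disjoint, auto)
    qed
    also have "\<dots> \<le> (\<Sum>j\<le>m. \<tau> j) + (\<Sum>j\<in>{m<..J}. \<bar>band_part f x j\<bar>)"
      by (intro add_mono sum_mono) auto
    also have "(\<Sum>j\<le>m. \<tau> j) \<le> \<kappa> * (6 * \<psi>)"
      unfolding \<tau>_def sum_distrib_left[symmetric] using m(3) kpos by (intro mult_left_mono)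
    finally have 1: "\<bar>adaptive_reconstruction \<mu> \<kappa> x n d - f x\<bar> \<le>
        3 * (\<kappa> * (6 * \<psi>) + (\<Sum>j\<in>{m<..J}. \<bar>band_part f x j\<bar>)) + 3 * (\<Sum>j\<le>J. Y j d) +
        \<bar>f x - (\<Sum>j\<le>J. band_part f x j)\<bar>" by simp
    have "\<bar>f x - (\<Sum>j\<le>J. band_part f x j)\<bar> + (\<Sum>j\<in>{m<..J}. \<bar>band_part f x j\<bar>) \<le> K * (2 ^ m) powr (- (\<beta> - 1))"
      unfolding K_def by (rule band_approximation[OF f \<beta> C m(1)])
    also have "\<dots> \<le> K * \<psi>" using m(2) Kpos by (rule mult_left_mono)
    finally have "3 * (\<Sum>j\<in>{m<..J}. \<bar>band_part f x j\<bar>) + \<bar>f x - (\<Sum>j\<le>J. band_part f x j)\<bar> \<le> 3 * (K * \<psi>)"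
      using abs_ge_zero[of "f x - (\<Sum>j\<le>J. band_part f x j)"] by linarith
    with 1 show ?thesis by (simp add: algebra_simps)
  qed
  define a where "a = (3 * K + 18 * \<kappa>) * \<psi>"
  have square: "(adaptive_reconstruction \<mu> \<kappa> x n d - f x)\<^sup>2 \<le> 2 * a\<^sup>2 + (\<Sum>j\<le>J. 18 * real n * (Y j d)\<^sup>2)" for d
  proof -
    let ?S = "\<Sum>j\<le>J. Y j d"
    have "(adaptive_reconstruction \<mu> \<kappa> x n d - f x)\<^sup>2 \<le> (a + 3 * ?S)\<^sup>2"
      using error[of d] by (metis a_def abs_ge_zero power2_abs power_mono)
    also have "\<dots> \<le> 2 * a\<^sup>2 + 18 * ?S\<^sup>2"
      using zero_le_power2[of "a - 3 * ?S"] by (simp add: power2_eq_square algebra_simps)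
    also have "?S\<^sup>2 \<le> real (J + 1) * (\<Sum>j\<le>J. (Y j d)\<^sup>2)"
      using Cauchy_Schwarz_ineq_sum[of "\<lambda>_. 1" "\<lambda>j. Y j d" "{..J}"] by simp
    also have "\<dots> \<le> real n * (\<Sum>j\<le>J. (Y j d)\<^sup>2)"
      using n(2) by (intro mult_right_mono sum_nonneg) (simp_all add: J_def)
    finally show ?thesis by (simp add: sum_distrib_left mult.assoc)
  qed
  have tail: "(\<integral>\<^sup>+ d. ennreal ((Y j d)\<^sup>2) \<partial>?D) \<le> ennreal (32 * inverse (real n ^ 4))" if j: "j \<le> J" for j
  proof -
    \<comment> \<open>the inverse of the threshold up to the factor \<open>\<kappa> * ln n\<close>: then \<open>l * \<tau> j\<close> is a multiple of \<open>ln n\<close> and the exponential bound a power of \<open>n\<close>\<close>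
    define l where "l = sqrt (real n * ln (real n) / 8 ^ j)"
    have l: "l > 0" "l\<^sup>2 = real n * ln (real n) / 8 ^ j" using lnn n by (auto simp: l_def)
    have "l * \<tau> j = \<kappa> * sqrt ((real n * ln (real n) / 8 ^ j) * (8 ^ j * q))"
      by (simp only: l_def \<tau>_def real_sqrt_mult mult.left_commute)
    also have "(real n * ln (real n) / 8 ^ j) * (8 ^ j * q) = (ln (real n))\<^sup>2"
      using n by (simp add: q_def power2_eq_square)
    finally have lt: "l * (\<tau> j / 2) = \<kappa> / 2 * ln (real n)" using lnn by simp
    have "(Y j d)\<^sup>2 = (Z j d)\<^sup>2 * indicator {z. \<bar>z\<bar> > \<tau> j / 2} (Z j d)" for d
      by (simp add: Y_def power_mult_distrib power2_eq_square[of "indicator _ _"] indicator_def)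
    then have "(\<integral>\<^sup>+ d. ennreal ((Y j d)\<^sup>2) \<partial>?D) =
        (\<integral>\<^sup>+ d. ennreal ((Z j d)\<^sup>2 * indicator {z. \<bar>z\<bar> > \<tau> j / 2} (Z j d)) \<partial>?D)" by simp
    also have "\<dots> \<le> ennreal (4 / l\<^sup>2 * exp (4 * mgf_const (2 * L * exp \<bar>\<mu>\<bar>) \<sigma> * weight_bound \<mu> *
        (l\<^sup>2 * 8 ^ j / real n) - l * (\<tau> j / 2)))"
      unfolding Z_def
      by (rule band_estimate_tail[OF fs x \<sigma> _ l(1)]) (use n cond j in \<open>auto simp: J_def l_def\<close>)
    also have "\<dots> \<le> ennreal (32 * inverse (real n ^ 4))"
    proof (rule ennreal_leI)
      have ll: "l\<^sup>2 * 8 ^ j / real n = ln (real n)" using n by (simp add: l)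
      have "4 * mgf_const (2 * L * exp \<bar>\<mu>\<bar>) \<sigma> * weight_bound \<mu> * (l\<^sup>2 * 8 ^ j / real n) - l * (\<tau> j / 2) =
          4 * c * ln (real n) - \<kappa> / 2 * ln (real n)"
        by (simp only: lt ll c_def mult.assoc)
      also have "\<dots> = - (4 * ln (real n))" by (simp add: keq algebra_simps)
      finally have "4 * mgf_const (2 * L * exp \<bar>\<mu>\<bar>) \<sigma> * weight_bound \<mu> * (l\<^sup>2 * 8 ^ j / real n) - l * (\<tau> j / 2) =
          - (4 * ln (real n))" .
      moreover have "exp (- (4 * ln (real n))) = inverse (real n ^ 4)"
      proof -
        have "exp (4 * ln (real n)) = exp (ln (real n)) ^ 4" by (subst exp_of_nat_mult[symmetric]) simp
        then show ?thesis using n by (simp add: exp_minus)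
      qed
      moreover have "4 / l\<^sup>2 \<le> 32"
      proof -
        have "(8 :: real) ^ j \<le> 8 ^ J" using j by (intro power_increasing) auto
        also have "(8 :: real) ^ J \<le> 8 * real n"
        proof -
          have "8 ^ J \<le> 8 * n" using top_level_bounds(2)[of n] n by (simp add: J_def)
          then have "real (8 ^ J) \<le> real (8 * n)" by (simp only: of_nat_le_iff)
          then show ?thesis by simp
        qed
        also have "\<dots> \<le> 8 * (real n * ln (real n))"
          using mult_left_mono[OF lnn, of "real n"] by simp
        finally show ?thesis using lnn n by (simp add: l field_simps)
      qed
      ultimately show "4 / l\<^sup>2 * exp (4 * mgf_const (2 * L * exp \<bar>\<mu>\<bar>) \<sigma> * weight_bound \<mu> *
        (l\<^sup>2 * 8 ^ j / real n) - l * (\<tau> j / 2)) \<le> 32 * inverse (real n ^ 4)"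
        by (simp only:) (rule mult_right_mono, auto)
    qed
    finally show ?thesis .
  qed
  have "(\<integral>\<^sup>+ d. ennreal ((adaptive_reconstruction \<mu> \<kappa> x n d - f x)\<^sup>2) \<partial>?D) \<le>
      (\<integral>\<^sup>+ d. ennreal (2 * a\<^sup>2) + (\<Sum>j\<le>J. ennreal (18 * real n) * ennreal ((Y j d)\<^sup>2)) \<partial>?D)"
  proof (rule nn_integral_mono)
    fix d
    have "ennreal (2 * a\<^sup>2) + (\<Sum>j\<le>J. ennreal (18 * real n) * ennreal ((Y j d)\<^sup>2)) =
        ennreal (2 * a\<^sup>2 + (\<Sum>j\<le>J. 18 * real n * (Y j d)\<^sup>2))"
      by (simp add: ennreal_mult'[symmetric] ennreal_plus sum_nonneg del: sum_ennreal) (simp add: sum_ennreal)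
    then show "ennreal ((adaptive_reconstruction \<mu> \<kappa> x n d - f x)\<^sup>2) \<le>
        ennreal (2 * a\<^sup>2) + (\<Sum>j\<le>J. ennreal (18 * real n) * ennreal ((Y j d)\<^sup>2))"
      using square[of d] by (simp only: ennreal_leI)
  qed
  also have "\<dots> = ennreal (2 * a\<^sup>2) + (\<Sum>j\<le>J. ennreal (18 * real n) * (\<integral>\<^sup>+ d. ennreal ((Y j d)\<^sup>2) \<partial>?D))"
    by (subst nn_integral_add, simp, simp, subst nn_integral_sum, simp)
      (simp add: nn_integral_cmult emeasure_space_1)
  also have "\<dots> \<le> ennreal (2 * a\<^sup>2) + (\<Sum>j\<le>J. ennreal (18 * real n) * ennreal (32 * inverse (real n ^ 4)))"
    by (intro add_left_mono sum_mono mult_left_mono tail) auto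
  also have "\<dots> = ennreal (2 * a\<^sup>2 + real (J + 1) * (18 * real n * (32 * inverse (real n ^ 4))))"
    by (simp only: ennreal_mult'[symmetric] sum_constant card_atMost ennreal_of_nat_eq_real_of_nat)
      (simp add: ennreal_mult'[symmetric] ennreal_plus[symmetric] del: ennreal_plus)
  also have "\<dots> \<le> ennreal ((2 * (3 * K + 18 * \<kappa>)\<^sup>2 + 576) * \<psi>\<^sup>2)"
  proof (rule ennreal_leI)
    have "real (J + 1) * (18 * real n * (32 * inverse (real n ^ 4))) \<le> real n * (18 * real n * (32 * inverse (real n ^ 4)))"
      using n(2) by (intro mult_right_mono) (auto simp: J_def)
    also have "\<dots> = 576 * (1 / real n) ^ 2" using n by (simp add: field_simps power2_eq_square power4_eq_xxxx)
    also have "(1 / real n) ^ 2 \<le> (1 / real n) ^ 1" using n by (intro power_decreasing) auto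
    also have "(1 / real n) ^ 1 \<le> q" using q(3) by simp
    also have "q \<le> \<psi>\<^sup>2"
    proof -
      have "\<psi>\<^sup>2 = q powr (2 * ((\<beta> - 1) / (2 * \<beta> + 1)))"
        using q by (simp add: \<psi>_def q_def[symmetric] powr_power mult.commute)
      moreover have "q powr 1 \<le> q powr (2 * ((\<beta> - 1) / (2 * \<beta> + 1)))"
        using q \<beta> by (intro powr_mono') (auto simp: field_simps)
      ultimately show ?thesis using q by simp
    qed
    finally have "real (J + 1) * (18 * real n * (32 * inverse (real n ^ 4))) \<le> 576 * \<psi>\<^sup>2" by simp
    moreover have "(2 * (3 * K + 18 * \<kappa>)\<^sup>2 + 576) * \<psi>\<^sup>2 = 2 * a\<^sup>2 + 576 * \<psi>\<^sup>2"
    proof -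
      have "a\<^sup>2 = (3 * K + 18 * \<kappa>)\<^sup>2 * \<psi>\<^sup>2" by (simp only: a_def power_mult_distrib)
      then show ?thesis by (simp only: distrib_right mult.assoc)
    qed
    ultimately show "2 * a\<^sup>2 + real (J + 1) * (18 * real n * (32 * inverse (real n ^ 4))) \<le>
        (2 * (3 * K + 18 * \<kappa>)\<^sup>2 + 576) * \<psi>\<^sup>2" by linarith
  qed
  finally show ?thesis .
qed

text \<open>The risk is measured at the point \<open>x\<close> only, so the estimated function may be constant in space.\<close>

theorem adaptive_upper_bound:
  fixes \<mu> \<sigma> C L \<beta>\<^sub>1 :: real
  assumes \<sigma>: "\<sigma> > 0" and C: "C > 0" and x: "norm x \<le> 1" and \<beta>\<^sub>1: "\<beta>\<^sub>1 > 1" and B: "\<And>n \<beta>. \<beta> \<in> B n \<Longrightarrow> \<beta> \<ge> \<beta>\<^sub>1"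
  shows "\<exists>F. adaptive_estimator F \<and>
    attains_rate \<mu> \<sigma> C L x B (\<lambda>n \<beta>. (ln (real n) / real n) powr ((\<beta> - 1) / (2 * \<beta> + 1))) F"
proof -
  define \<kappa> where "\<kappa> = 8 * (mgf_const (2 * L * exp \<bar>\<mu>\<bar>) \<sigma> * weight_bound \<mu> + 1)"
  define M where "M = 2 * (3 * sqrt (C * pi / (\<beta>\<^sub>1 - 1)) + 18 * \<kappa>)\<^sup>2 + 576"
  let ?\<psi> = "\<lambda>n \<beta>. (ln (real n) / real n) powr ((\<beta> - 1) / (2 * \<beta> + 1))"
  let ?F = "\<lambda>n d (y :: real ^ 2). adaptive_reconstruction \<mu> \<kappa> x n d"
  have "adaptive_estimator ?F" unfolding adaptive_estimator_def
    using adaptive_reconstruction_measurable by blast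
  moreover have "attains_rate \<mu> \<sigma> C L x B ?\<psi> ?F"
  proof -
    have "\<forall>\<^sub>F n in sequentially. (SUP \<beta>\<in>B n. SUP f\<in>smooth_class C L \<beta>.
        ennreal (1 / (?\<psi> n \<beta>)\<^sup>2) * risk \<mu> \<sigma> x ?F n f) \<le> ennreal M"
      using eventually_level_condition[of \<mu>]
    proof eventually_elim
      case (elim n)
      show ?case
      proof (intro SUP_least)
        fix \<beta> f assume b: "\<beta> \<in> B n" and f: "f \<in> smooth_class C L \<beta>"
        have pos: "?\<psi> n \<beta> > 0" using elim by simp
        have "risk \<mu> \<sigma> x ?F n f \<le> ennreal (M * (?\<psi> n \<beta>)\<^sup>2)"
          unfolding risk_def M_def \<kappa>_def
          by (rule adaptive_reconstruction_risk[OF f \<beta>\<^sub>1 B[OF b] C \<sigma> x]) (use elim in auto)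
        then have "ennreal (1 / (?\<psi> n \<beta>)\<^sup>2) * risk \<mu> \<sigma> x ?F n f \<le> ennreal (1 / (?\<psi> n \<beta>)\<^sup>2) * ennreal (M * (?\<psi> n \<beta>)\<^sup>2)"
          by (rule mult_left_mono) simp
        also have "\<dots> = ennreal (1 / (?\<psi> n \<beta>)\<^sup>2 * (M * (?\<psi> n \<beta>)\<^sup>2))"
          by (rule ennreal_mult'[symmetric]) simp
        also have "1 / (?\<psi> n \<beta>)\<^sup>2 * (M * (?\<psi> n \<beta>)\<^sup>2) = M"
        proof -
          have "1 / p\<^sup>2 * (M * p\<^sup>2) = M" if "p > 0" for p using that by simp
          then show ?thesis using pos .
        qed
        finally show "ennreal (1 / (?\<psi> n \<beta>)\<^sup>2) * risk \<mu> \<sigma> x ?F n f \<le> ennreal M" .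
      qed
    qed
    then have "limsup (\<lambda>n. SUP \<beta>\<in>B n. SUP f\<in>smooth_class C L \<beta>.
        ennreal (1 / (?\<psi> n \<beta>)\<^sup>2) * risk \<mu> \<sigma> x ?F n f) \<le> ennreal M"
      by (rule Limsup_bounded)
    also have "ennreal M < \<infinity>" by simp
    finally show ?thesis unfolding attains_rate_def .
  qed
  ultimately show ?thesis by blast
qed

section \<open>Bumps with decaying Fourier transform\<close>

text \<open>Integration by parts: each factor \<open>1 - t\<^sup>2\<close> makes the boundary terms vanish once and gains one power of the
frequency, at the price of another polynomial. Cosine and sine integrals are
treated together since each step exchanges them.\<close>

lemma polynomial_bump_fourier_decay:
  fixes p :: "real poly"
  shows "\<exists>M. \<forall>s. \<bar>s\<bar> ^ k * (\<bar>integral {-1..1} (\<lambda>t. poly p t * (1 - t\<^sup>2) ^ k * cos (t * s))\<bar> +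
    \<bar>integral {-1..1} (\<lambda>t. poly p t * (1 - t\<^sup>2) ^ k * sin (t * s))\<bar>) \<le> M"
proof (induction k arbitrary: p)
  case 0
  let ?I = "integral {-1..1} (\<lambda>t. \<bar>poly p t\<bar>)"
  have c: "\<bar>integral {-1..1} (\<lambda>t. poly p t * cos (t * s))\<bar> \<le> ?I" for s
    unfolding real_norm_def[symmetric]
    by (rule integral_norm_bound_integral)
      (auto intro!: integrable_continuous_real continuous_intros simp: abs_mult mult_left_le)
  have d: "\<bar>integral {-1..1} (\<lambda>t. poly p t * sin (t * s))\<bar> \<le> ?I" for s
    unfolding real_norm_def[symmetric]
    by (rule integral_norm_bound_integral)
      (auto intro!: integrable_continuous_real continuous_intros simp: abs_mult mult_left_le)
  have "\<bar>s\<bar> ^ 0 * (\<bar>integral {-1..1} (\<lambda>t. poly p t * (1 - t\<^sup>2) ^ 0 * cos (t * s))\<bar> +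
    \<bar>integral {-1..1} (\<lambda>t. poly p t * (1 - t\<^sup>2) ^ 0 * sin (t * s))\<bar>) \<le> ?I + ?I" for s
    using add_mono[OF c d, of s s] by simp
  then show ?case by blast
next
  case (Suc k)
  \<comment> \<open>chosen such that \<open>?Q\<close> is the derivative of \<open>?P\<close>\<close>
  define q where "q = pderiv p * [:1, 0, -1:] - smult (2 * (real k + 1)) ([:0, 1:] * p)"
  let ?P = "\<lambda>t. poly p t * (1 - t\<^sup>2) ^ Suc k" and ?Q = "\<lambda>t. poly q t * (1 - t\<^sup>2) ^ k"
  let ?C = "\<lambda>f s. integral {-1..1} (\<lambda>t. f t * cos (t * s))" and ?S = "\<lambda>f s. integral {-1..1} (\<lambda>t. f t * sin (t * s))"
  have dP: "(?P has_real_derivative ?Q t) (at t within A)" for t A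
  proof -
    have d: "((\<lambda>t. 1 - t\<^sup>2) has_real_derivative - (2 * t)) (at t within A)"
      by (auto intro!: derivative_eq_intros)
    have p: "((\<lambda>t. poly p t) has_real_derivative poly (pderiv p) t) (at t within A)"
      by (rule DERIV_subset[OF poly_DERIV]) simp
    have "((\<lambda>t. (1 - t\<^sup>2) ^ Suc k) has_real_derivative real (Suc k) * (- (2 * t)) * (1 - t\<^sup>2) ^ k) (at t within A)"
      using DERIV_power[OF d, of "Suc k"] by (simp only: diff_Suc_Suc diff_zero mult.assoc)
    from DERIV_mult[OF p this]
    have "(?P has_real_derivative poly (pderiv p) t * (1 - t\<^sup>2) ^ Suc k +
        (real (Suc k) * (- (2 * t)) * (1 - t\<^sup>2) ^ k) * poly p t) (at t within A)"
      by simp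
    also have "poly (pderiv p) t * (1 - t\<^sup>2) ^ Suc k + (real (Suc k) * (- (2 * t)) * (1 - t\<^sup>2) ^ k) * poly p t = ?Q t"
      by (simp add: q_def algebra_simps power2_eq_square)
    finally show ?thesis .
  qed
  have ends: "?P 1 = 0" "?P (-1) = 0" by simp_all
  have iP: "(\<lambda>t. ?P t * cos (t * s)) integrable_on {-1..1}" "(\<lambda>t. ?P t * sin (t * s)) integrable_on {-1..1}"
    "(\<lambda>t. ?Q t * cos (t * s)) integrable_on {-1..1}" "(\<lambda>t. ?Q t * sin (t * s)) integrable_on {-1..1}"
    "(\<lambda>t. s * (?P t * sin (t * s))) integrable_on {-1..1}" "(\<lambda>t. s * (?P t * cos (t * s))) integrable_on {-1..1}" for s
    by (intro integrable_continuous_real continuous_intros)+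
  have C: "?C ?Q s = s * ?S ?P s" for s
  proof -
    have "((\<lambda>t. ?Q t * cos (t * s) - s * (?P t * sin (t * s))) has_integral
        ?P 1 * cos (1 * s) - ?P (-1) * cos (-1 * s)) {-1..1}"
    proof (rule fundamental_theorem_of_calculus)
      fix t :: real
      have "((\<lambda>t. ?P t * cos (t * s)) has_real_derivative ?Q t * cos (t * s) - s * (?P t * sin (t * s))) (at t within {-1..1})"
        by (rule derivative_eq_intros dP refl | simp add: algebra_simps)+
      then show "((\<lambda>t. ?P t * cos (t * s)) has_vector_derivative ?Q t * cos (t * s) - s * (?P t * sin (t * s))) (at t within {-1..1})"
        by (simp add: has_real_derivative_iff_has_vector_derivative)
    qed simp
    from integral_unique[OF this] show ?thesis
      unfolding integral_diff[OF iP(3)[of s] iP(5)[of s]] ends by simp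
  qed
  have S: "?S ?Q s = - (s * ?C ?P s)" for s
  proof -
    have "((\<lambda>t. ?Q t * sin (t * s) + s * (?P t * cos (t * s))) has_integral
        ?P 1 * sin (1 * s) - ?P (-1) * sin (-1 * s)) {-1..1}"
    proof (rule fundamental_theorem_of_calculus)
      fix t :: real
      have "((\<lambda>t. ?P t * sin (t * s)) has_real_derivative ?Q t * sin (t * s) + s * (?P t * cos (t * s))) (at t within {-1..1})"
        by (rule derivative_eq_intros dP refl | simp add: algebra_simps)+
      then show "((\<lambda>t. ?P t * sin (t * s)) has_vector_derivative ?Q t * sin (t * s) + s * (?P t * cos (t * s))) (at t within {-1..1})"
        by (simp add: has_real_derivative_iff_has_vector_derivative)
    qed simp
    from integral_unique[OF this] show ?thesis
      unfolding integral_add[OF iP(4)[of s] iP(6)[of s]] ends by simp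
  qed
  obtain M where M: "\<And>s. \<bar>s\<bar> ^ k * (\<bar>?C ?Q s\<bar> + \<bar>?S ?Q s\<bar>) \<le> M" using Suc[of q] by auto
  have "\<bar>s\<bar> ^ Suc k * (\<bar>?C ?P s\<bar> + \<bar>?S ?P s\<bar>) \<le> M" for s
  proof -
    have "\<bar>s\<bar> ^ Suc k * (\<bar>?C ?P s\<bar> + \<bar>?S ?P s\<bar>) = \<bar>s\<bar> ^ k * (\<bar>s * ?S ?P s\<bar> + \<bar>s * ?C ?P s\<bar>)"
      by (simp only: abs_mult power_Suc) (simp only: algebra_simps)
    also have "\<dots> = \<bar>s\<bar> ^ k * (\<bar>?C ?Q s\<bar> + \<bar>?S ?Q s\<bar>)"
      by (simp only: C S abs_minus_cancel)
    also have "\<dots> \<le> M" by (rule M)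
    finally show ?thesis .
  qed
  then show ?case by blast
qed

text \<open>A truncated polynomial instead of a smooth bump: finitely many derivatives suffice for a given exponent, and its
Fourier transform is elementary.\<close>

definition bump1 :: "nat \<Rightarrow> real \<Rightarrow> real" where
  "bump1 k t = (max 0 (1 - t\<^sup>2)) ^ k"

lemma continuous_on_bump1 [continuous_intros]: "continuous_on A (bump1 k)"
  unfolding bump1_def[abs_def] by (intro continuous_intros)

lemma bump1_measurable [measurable]: "bump1 k \<in> borel_measurable borel"
  by (intro borel_measurable_continuous_onI continuous_intros)

lemma bump1_bounds: "0 \<le> bump1 k t" "bump1 k t \<le> 1" "bump1 k 0 = 1"
  by (auto simp: bump1_def max_def intro!: power_le_one)

lemma bump1_support: "k \<ge> 1 \<Longrightarrow> bump1 k t \<noteq> 0 \<Longrightarrow> \<bar>t\<bar> \<le> 1"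
proof -
  assume "k \<ge> 1" "bump1 k t \<noteq> 0"
  then have "1 - t\<^sup>2 > 0" by (auto simp: bump1_def max_def split: if_splits)
  then have "t\<^sup>2 \<le> 1" by simp
  then show ?thesis by (simp only: abs_square_le_1)
qed

definition fourier1 :: "nat \<Rightarrow> real \<Rightarrow> complex" where
  "fourier1 k s = (LINT t|lborel. complex_of_real (bump1 k t) * cis (- (t * s)))"

lemma integrable_bump1: "k \<ge> 1 \<Longrightarrow> integrable lborel (bump1 k)"
proof (rule Bochner_Integration.integrable_bound[OF integrable_indicator_interval(2)[of "-1" 1]])
  assume k: "k \<ge> 1"
  have "norm (bump1 k t) \<le> norm (indicator {-1..1} t :: real)" for t
    using bump1_support[OF k, of t] bump1_bounds(1,2)[of k t] by (cases "bump1 k t = 0") (auto simp: abs_le_iff)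
  then show "AE t in lborel. norm (bump1 k t) \<le> norm (indicator {-1..1} t :: real)" by simp
qed simp

lemma integral_bump1:
  fixes g :: "real \<Rightarrow> real"
  assumes k: "k \<ge> 1" and g: "continuous_on UNIV g"
  shows "(LINT t|lborel. bump1 k t * g t) = integral {-1..1} (\<lambda>t. (1 - t\<^sup>2) ^ k * g t)"
proof -
  have "continuous_on {-1..1} (\<lambda>t. (1 - t\<^sup>2) ^ k * g t)"
    by (intro continuous_intros continuous_on_subset[OF g]) auto
  from integral_indicator_Icc[OF this] show ?thesis
  proof (rule trans[rotated], intro Bochner_Integration.integral_cong refl)
    fix t :: real
    show "bump1 k t * g t = indicator {-1..1} t * ((1 - t\<^sup>2) ^ k * g t)"
    proof (cases "t \<in> {-1..1}")
      case True
      then have "t\<^sup>2 \<le> 1" by (simp only: abs_square_le_1) auto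
      then show ?thesis using True by (simp add: bump1_def)
    next
      case False
      have "bump1 k t = 0"
      proof (rule ccontr)
        assume "bump1 k t \<noteq> 0"
        from bump1_support[OF k this] False show False by (auto simp: abs_le_iff)
      qed
      then show ?thesis using False by simp
    qed
  qed
qed

lemma fourier1_eq:
  assumes k: "k \<ge> 1"
  shows "fourier1 k s = Complex (integral {-1..1} (\<lambda>t. (1 - t\<^sup>2) ^ k * cos (t * s)))
    (- integral {-1..1} (\<lambda>t. (1 - t\<^sup>2) ^ k * sin (t * s)))"
proof -
  have int: "integrable lborel (\<lambda>t. complex_of_real (bump1 k t) * cis (- (t * s)))"
    by (rule Bochner_Integration.integrable_bound[OF integrable_bump1[OF k]]) (auto simp: norm_mult)
  show ?thesis
    unfolding fourier1_def
  proof (rule complex_eqI)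
    show "Re (LINT t|lborel. complex_of_real (bump1 k t) * cis (- (t * s))) =
      Re (Complex (integral {-1..1} (\<lambda>t. (1 - t\<^sup>2) ^ k * cos (t * s))) (- integral {-1..1} (\<lambda>t. (1 - t\<^sup>2) ^ k * sin (t * s))))"
      by (subst integral_Re[OF int, symmetric], simp, rule integral_bump1[OF k]) (intro continuous_intros)
    have "Im (LINT t|lborel. complex_of_real (bump1 k t) * cis (- (t * s))) =
        - (LINT t|lborel. bump1 k t * sin (t * s))"
      by (subst integral_Im[OF int, symmetric]) simp
    also have "(LINT t|lborel. bump1 k t * sin (t * s)) = integral {-1..1} (\<lambda>t. (1 - t\<^sup>2) ^ k * sin (t * s))"
      by (rule integral_bump1[OF k]) (intro continuous_intros)
    finally show "Im (LINT t|lborel. complex_of_real (bump1 k t) * cis (- (t * s))) =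
      Im (Complex (integral {-1..1} (\<lambda>t. (1 - t\<^sup>2) ^ k * cos (t * s))) (- integral {-1..1} (\<lambda>t. (1 - t\<^sup>2) ^ k * sin (t * s))))"
      by simp
  qed
qed

lemma fourier1_bound:
  assumes k: "k \<ge> 1"
  obtains M where "\<And>s. (1 + s\<^sup>2) ^ k * (cmod (fourier1 k s))\<^sup>2 \<le> M"
proof -
  have "\<exists>M. \<forall>s :: real. \<bar>s\<bar> ^ k * (\<bar>integral {-1..1} (\<lambda>t. (1 - t\<^sup>2) ^ k * cos (t * s))\<bar> +
    \<bar>integral {-1..1} (\<lambda>t. (1 - t\<^sup>2) ^ k * sin (t * s))\<bar>) \<le> M"
    using polynomial_bump_fourier_decay[of k 1] by simp
  then obtain M1 where M1: "\<And>s :: real. \<bar>s\<bar> ^ k * (\<bar>integral {-1..1} (\<lambda>t. (1 - t\<^sup>2) ^ k * cos (t * s))\<bar> +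
    \<bar>integral {-1..1} (\<lambda>t. (1 - t\<^sup>2) ^ k * sin (t * s))\<bar>) \<le> M1"
    by blast
  have M1': "\<bar>s\<bar> ^ k * cmod (fourier1 k s) \<le> M1" for s
  proof -
    have "cmod (fourier1 k s) \<le> \<bar>integral {-1..1} (\<lambda>t. (1 - t\<^sup>2) ^ k * cos (t * s))\<bar> +
      \<bar>integral {-1..1} (\<lambda>t. (1 - t\<^sup>2) ^ k * sin (t * s))\<bar>"
      using cmod_le[of "fourier1 k s"] by (simp add: fourier1_eq[OF k])
    then have "\<bar>s\<bar> ^ k * cmod (fourier1 k s) \<le> \<bar>s\<bar> ^ k * (\<bar>integral {-1..1} (\<lambda>t. (1 - t\<^sup>2) ^ k * cos (t * s))\<bar> +
      \<bar>integral {-1..1} (\<lambda>t. (1 - t\<^sup>2) ^ k * sin (t * s))\<bar>)" by (intro mult_left_mono) auto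
    then show ?thesis using M1 by (rule order_trans)
  qed
  let ?M0 = "LINT t|lborel. bump1 k t"
  have M0: "cmod (fourier1 k s) \<le> ?M0" for s
    unfolding fourier1_def
    by (rule order_trans[OF integral_norm_bound]) (simp add: norm_mult bump1_bounds)
  have "(1 + s\<^sup>2) ^ k * (cmod (fourier1 k s))\<^sup>2 \<le> 2 ^ k * (?M0\<^sup>2 + M1\<^sup>2)" for s
  proof (cases "\<bar>s\<bar> \<le> 1")
    case True
    then have "(1 + s\<^sup>2) ^ k \<le> 2 ^ k" by (intro power_mono) (auto simp: abs_square_le_1)
    moreover have "(cmod (fourier1 k s))\<^sup>2 \<le> ?M0\<^sup>2" using M0 by (intro power_mono) auto
    ultimately have "(1 + s\<^sup>2) ^ k * (cmod (fourier1 k s))\<^sup>2 \<le> 2 ^ k * ?M0\<^sup>2" by (intro mult_mono) auto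
    also have "\<dots> \<le> 2 ^ k * (?M0\<^sup>2 + M1\<^sup>2)" by (intro mult_left_mono) auto
    finally show ?thesis .
  next
    case False
    then have "1 \<le> s\<^sup>2" by (metis abs_ge_zero linear one_le_power power2_abs)
    then have "(1 + s\<^sup>2) ^ k \<le> (2 * s\<^sup>2) ^ k" by (intro power_mono) auto
    also have "\<dots> = 2 ^ k * (\<bar>s\<bar> ^ k)\<^sup>2"
      by (simp add: power_mult_distrib power_mult[symmetric] mult.commute[of k 2]) (simp add: power_mult)
    finally have "(1 + s\<^sup>2) ^ k * (cmod (fourier1 k s))\<^sup>2 \<le> 2 ^ k * (\<bar>s\<bar> ^ k)\<^sup>2 * (cmod (fourier1 k s))\<^sup>2"
      by (intro mult_right_mono) auto
    also have "\<dots> = 2 ^ k * (\<bar>s\<bar> ^ k * cmod (fourier1 k s))\<^sup>2" by (simp add: power_mult_distrib)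
    also have "\<dots> \<le> 2 ^ k * M1\<^sup>2" using M1' by (intro mult_left_mono power_mono) auto
    also have "\<dots> \<le> 2 ^ k * (?M0\<^sup>2 + M1\<^sup>2)" by (intro mult_left_mono) auto
    finally show ?thesis .
  qed
  then show ?thesis by (rule that)
qed

lemma fourier1_measurable [measurable]: "fourier1 k \<in> borel_measurable borel"
  unfolding fourier1_def[abs_def] by measurable

lemma nn_integral_cauchy_finite: "(\<integral>\<^sup>+ s. ennreal (inverse (1 + s\<^sup>2)) \<partial>lborel) < \<infinity>"
proof -
  let ?f = "\<lambda>s :: real. inverse (1 + s\<^sup>2)"
  have half: "(\<integral>\<^sup>+ s. ennreal (?f s) * indicator {0..} s \<partial>lborel) = ennreal (pi / 2 - arctan 0)"
  proof (rule nn_integral_FTC_atLeast)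
    show "(arctan has_real_derivative ?f s) (at s)" for s by (rule DERIV_arctan)
    show "(arctan \<longlongrightarrow> pi / 2) at_top" by (rule tendsto_arctan_at_top)
  qed (auto simp: add_nonneg_nonneg)
  have "(\<integral>\<^sup>+ s. ennreal (?f s) \<partial>lborel) \<le>
      (\<integral>\<^sup>+ s. ennreal (?f s) * indicator {0..} s + ennreal (?f (0 + (-1) * s)) * indicator {0..} (0 + (-1) * s) \<partial>lborel)"
    by (intro nn_integral_mono) (auto simp: indicator_def)
  also have "\<dots> = (\<integral>\<^sup>+ s. ennreal (?f s) * indicator {0..} s \<partial>lborel) +
      (\<integral>\<^sup>+ s. ennreal (?f (0 + (-1) * s)) * indicator {0..} (0 + (-1) * s) \<partial>lborel)"
    by (rule nn_integral_add) auto
  also have "(\<integral>\<^sup>+ s. ennreal (?f (0 + (-1) * s)) * indicator {0..} (0 + (-1) * s) \<partial>lborel) =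
      (\<integral>\<^sup>+ s. ennreal (?f s) * indicator {0..} s \<partial>lborel)"
    by (subst nn_integral_real_affine[where c="-1" and t=0 and f="\<lambda>s. ennreal (?f s) * indicator {0..} s"]) auto
  finally show ?thesis unfolding half by (simp add: le_less_trans)
qed

text \<open>With zeros of order \<open>k\<close> at the ends of the support the squared transform is \<open>O(1 / (1 + s\<^sup>2) ^ k)\<close>. The weight uses up
all of this decay but one factor, which is the Cauchy density up to a constant.\<close>

lemma fourier1_weighted_finite:
  assumes "real k \<ge> \<beta> + 1" "k \<ge> 1"
  shows "(\<integral>\<^sup>+ s. ennreal ((1 + s\<^sup>2) powr \<beta> * (cmod (fourier1 k s))\<^sup>2) \<partial>lborel) < \<infinity>"
proof -
  obtain M where M: "\<And>s. (1 + s\<^sup>2) ^ k * (cmod (fourier1 k s))\<^sup>2 \<le> M"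
    using fourier1_bound[OF assms(2)] by blast
  have M0: "M \<ge> 0" using M[of 0] by (simp add: order_trans[OF zero_le_power2])
  have "(1 + s\<^sup>2) powr \<beta> * (cmod (fourier1 k s))\<^sup>2 \<le> M * inverse (1 + s\<^sup>2)" for s
  proof -
    have w: "1 + s\<^sup>2 \<ge> 1" by simp
    have "(1 + s\<^sup>2) powr \<beta> \<le> (1 + s\<^sup>2) powr (real k - 1)"
      using w assms by (intro powr_mono) auto
    also have "\<dots> = (1 + s\<^sup>2) ^ k * inverse (1 + s\<^sup>2)"
    proof -
      have "0 < 1 + s\<^sup>2" by (simp add: add_pos_nonneg)
      then show ?thesis by (simp add: powr_diff powr_realpow divide_inverse)
    qed
    finally have "(1 + s\<^sup>2) powr \<beta> * (cmod (fourier1 k s))\<^sup>2 \<le>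
        ((1 + s\<^sup>2) ^ k * inverse (1 + s\<^sup>2)) * (cmod (fourier1 k s))\<^sup>2"
      by (rule mult_right_mono) simp
    also have "\<dots> = ((1 + s\<^sup>2) ^ k * (cmod (fourier1 k s))\<^sup>2) * inverse (1 + s\<^sup>2)"
      by (simp only: mult_ac)
    also have "\<dots> \<le> M * inverse (1 + s\<^sup>2)" using M w by (intro mult_right_mono) auto
    finally show ?thesis .
  qed
  then have "(\<integral>\<^sup>+ s. ennreal ((1 + s\<^sup>2) powr \<beta> * (cmod (fourier1 k s))\<^sup>2) \<partial>lborel) \<le>
      (\<integral>\<^sup>+ s. ennreal M * ennreal (inverse (1 + s\<^sup>2)) \<partial>lborel)"
    by (intro nn_integral_mono) (simp only: ennreal_mult'[OF M0, symmetric] ennreal_leI)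
  also have "\<dots> = ennreal M * (\<integral>\<^sup>+ s. ennreal (inverse (1 + s\<^sup>2)) \<partial>lborel)"
    by (rule nn_integral_cmult) simp
  also have "\<dots> < \<infinity>" using nn_integral_cauchy_finite by (simp add: ennreal_mult_less_top)
  finally show ?thesis .
qed

definition bump2 :: "nat \<Rightarrow> real ^ 2 \<Rightarrow> real" where
  "bump2 k y = bump1 k (y $ 1) * bump1 k (y $ 2)"

lemma continuous_on_bump2: "continuous_on UNIV (bump2 k)"
  unfolding bump2_def[abs_def]
  by (intro continuous_intros continuous_on_compose2[OF continuous_on_bump1[of UNIV]]) auto

lemma bump2_measurable [measurable]: "bump2 k \<in> borel_measurable borel"
  by (rule borel_measurable_continuous_onI) (rule continuous_on_bump2)

lemma bump2_bounds: "0 \<le> bump2 k y" "bump2 k y \<le> 1" "bump2 k 0 = 1"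
  using bump1_bounds by (auto simp: bump2_def mult_le_one)

lemma bump2_support: "k \<ge> 1 \<Longrightarrow> bump2 k y \<noteq> 0 \<Longrightarrow> norm y \<le> 2"
proof -
  assume k: "k \<ge> 1" and "bump2 k y \<noteq> 0"
  then have "\<bar>y $ 1\<bar> \<le> 1" "\<bar>y $ 2\<bar> \<le> 1" using bump1_support[OF k] by (auto simp: bump2_def)
  then have "(y $ 1)\<^sup>2 + (y $ 2)\<^sup>2 \<le> 2\<^sup>2" by (simp add: abs_square_le_1[symmetric])
  then show ?thesis unfolding norm_vec2 by (intro real_le_lsqrt) auto
qed

lemma integrable_bump2:
  assumes k: "k \<ge> 1"
  shows "integrable lborel (bump2 k)"
proof (rule Bochner_Integration.integrable_bound)
  have "emeasure lborel (cball (0 :: real ^ 2) 2) < \<infinity>" by (rule emeasure_bounded_finite) simp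
  then show "integrable lborel (indicator (cball (0 :: real ^ 2) 2) :: real ^ 2 \<Rightarrow> real)"
    by (intro integrable_real_indicator) auto
  have "norm (bump2 k y) \<le> norm (indicator (cball 0 2) y :: real)" for y
    using bump2_support[OF k, of y] bump2_bounds(1,2)[of k y] by (cases "bump2 k y = 0") auto
  then show "AE y in lborel. norm (bump2 k y) \<le> norm (indicator (cball 0 2) y :: real)" by simp
qed simp

lemma fourier_bump2:
  assumes k: "k \<ge> 1"
  shows "fourier (bump2 k) \<xi> = fourier1 k (\<xi> $ 1) * fourier1 k (\<xi> $ 2)"
proof -
  have int: "integrable lborel (\<lambda>y. complex_of_real (bump2 k y) * cis (- (y \<bullet> \<xi>)))"
    by (rule Bochner_Integration.integrable_bound[OF integrable_bump2[OF k]]) (auto simp: norm_mult)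
  have c: "cis (- a - b) = cis (- a) * cis (- b)" for a b by (simp add: cis_mult)
  have "fourier (bump2 k) \<xi> = (LINT s|lborel. LINT t|lborel. (complex_of_real (bump1 k s) * cis (- (s * \<xi> $ 1))) *
      (complex_of_real (bump1 k t) * cis (- (t * \<xi> $ 2))))"
    unfolding fourier_def
    by (subst integral_plane_coordinates[OF int])
      (simp add: bump2_def inner_vec2 c mult_ac)
  then show ?thesis
    by (simp only: integral_mult_right_zero integral_mult_left_zero fourier1_def)
qed

text \<open>The Sobolev weight of the plane is at most the product of the one-dimensional weights, so that the
integral factorizes.\<close>

lemma bump2_sobolev:
  assumes \<beta>: "\<beta> \<ge> 0" and k: "real k \<ge> \<beta> + 1" "k \<ge> 1"
  shows "(\<integral>\<^sup>+ \<xi>. ennreal ((1 + (norm \<xi>)\<^sup>2) powr \<beta> * (cmod (fourier (bump2 k) \<xi>))\<^sup>2) \<partial>lborel) < \<infinity>"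
proof -
  let ?w = "\<lambda>s. ennreal ((1 + s\<^sup>2) powr \<beta> * (cmod (fourier1 k s))\<^sup>2)"
  have "(\<integral>\<^sup>+ \<xi>. ennreal ((1 + (norm \<xi>)\<^sup>2) powr \<beta> * (cmod (fourier (bump2 k) \<xi>))\<^sup>2) \<partial>lborel) \<le>
      (\<integral>\<^sup>+ a. \<integral>\<^sup>+ b. ?w a * ?w b \<partial>lborel \<partial>lborel)"
  proof (subst nn_integral_plane)
    show "(\<integral>\<^sup>+ a. \<integral>\<^sup>+ b. ennreal ((1 + (norm (vector [a, b] :: real ^ 2))\<^sup>2) powr \<beta> *
        (cmod (fourier (bump2 k) (vector [a, b])))\<^sup>2) \<partial>lborel \<partial>lborel) \<le> (\<integral>\<^sup>+ a. \<integral>\<^sup>+ b. ?w a * ?w b \<partial>lborel \<partial>lborel)"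
    proof (intro nn_integral_mono)
      fix a b :: real
      have "1 + (norm (vector [a, b] :: real ^ 2))\<^sup>2 \<le> (1 + a\<^sup>2) * (1 + b\<^sup>2)"
        by (simp add: norm_vec2 algebra_simps)
      then have "(1 + (norm (vector [a, b] :: real ^ 2))\<^sup>2) powr \<beta> \<le> ((1 + a\<^sup>2) * (1 + b\<^sup>2)) powr \<beta>"
        using \<beta> by (intro powr_mono2) auto
      also have "\<dots> = (1 + a\<^sup>2) powr \<beta> * (1 + b\<^sup>2) powr \<beta>" by (simp add: powr_mult)
      finally have "(1 + (norm (vector [a, b] :: real ^ 2))\<^sup>2) powr \<beta> * (cmod (fourier (bump2 k) (vector [a, b])))\<^sup>2 \<le>
        ((1 + a\<^sup>2) powr \<beta> * (1 + b\<^sup>2) powr \<beta>) * (cmod (fourier (bump2 k) (vector [a, b])))\<^sup>2"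
        by (rule mult_right_mono) simp
      also have "\<dots> = ((1 + a\<^sup>2) powr \<beta> * (cmod (fourier1 k a))\<^sup>2) * ((1 + b\<^sup>2) powr \<beta> * (cmod (fourier1 k b))\<^sup>2)"
        by (simp add: fourier_bump2[OF k(2)] norm_mult power_mult_distrib)
      finally show "ennreal ((1 + (norm (vector [a, b] :: real ^ 2))\<^sup>2) powr \<beta> *
        (cmod (fourier (bump2 k) (vector [a, b])))\<^sup>2) \<le> ?w a * ?w b"
        by (subst ennreal_mult[symmetric]) (auto intro: ennreal_leI)
    qed
  qed simp
  also have "\<dots> = (\<integral>\<^sup>+ a. ?w a \<partial>lborel) * (\<integral>\<^sup>+ b. ?w b \<partial>lborel)"
    by (subst nn_integral_cmult, simp, subst nn_integral_multc) simp_all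
  also have "\<dots> < \<infinity>"
    using fourier1_weighted_finite[OF k] by (simp add: ennreal_mult_less_top)
  finally show ?thesis .
qed

section \<open>Rescaled bumps in the Sobolev class\<close>

definition scaled_bump :: "nat \<Rightarrow> real ^ 2 \<Rightarrow> real \<Rightarrow> real \<Rightarrow> real ^ 2 \<Rightarrow> real" where
  "scaled_bump k x c h y = c * bump2 k ((1 / h) *\<^sub>R (y - x))"

lemma scaled_bump_measurable [measurable]: "scaled_bump k x c h \<in> borel_measurable borel"
  unfolding scaled_bump_def[abs_def] by measurable

lemma scaled_bump_support:
  assumes "k \<ge> 1" "h > 0" "scaled_bump k x c h y \<noteq> 0"
  shows "norm (y - x) \<le> 2 * h"
proof -
  have "norm ((1 / h) *\<^sub>R (y - x)) \<le> 2"
    using assms by (intro bump2_support[OF assms(1)]) (auto simp: scaled_bump_def)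
  moreover have "norm ((1 / h) *\<^sub>R (y - x)) = norm (y - x) / h"
    using assms(2) by (simp only: norm_scaleR) simp
  ultimately have "norm (y - x) / h \<le> 2" by (simp only:)
  then show ?thesis using assms(2) by (simp add: divide_le_eq)
qed

lemma abs_scaled_bump_le: "c \<ge> 0 \<Longrightarrow> \<bar>scaled_bump k x c h y\<bar> \<le> c"
  using bump2_bounds(1,2) by (simp add: scaled_bump_def abs_mult mult_left_le)

lemma fourier_scaled_bump:
  assumes "h > 0"
  shows "fourier (scaled_bump k x c h) \<xi> = complex_of_real (c * h\<^sup>2) * cis (- (x \<bullet> \<xi>)) * fourier (bump2 k) (h *\<^sub>R \<xi>)"
proof -
  have "fourier (scaled_bump k x c h) \<xi> =
      h\<^sup>2 *\<^sub>R (LINT w|lborel. complex_of_real (scaled_bump k x c h (x + h *\<^sub>R w)) * cis (- ((x + h *\<^sub>R w) \<bullet> \<xi>)))"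
    unfolding fourier_def using assms by (intro lborel_affine_plane) auto
  also have "(LINT w|lborel. complex_of_real (scaled_bump k x c h (x + h *\<^sub>R w)) * cis (- ((x + h *\<^sub>R w) \<bullet> \<xi>))) =
      (LINT w|lborel. (complex_of_real c * cis (- (x \<bullet> \<xi>))) * (complex_of_real (bump2 k w) * cis (- (w \<bullet> (h *\<^sub>R \<xi>)))))"
  proof (intro Bochner_Integration.integral_cong refl)
    fix w :: "real ^ 2"
    have "cis (- ((x + h *\<^sub>R w) \<bullet> \<xi>)) = cis (- (x \<bullet> \<xi>)) * cis (- (w \<bullet> (h *\<^sub>R \<xi>)))"
      by (simp add: cis_mult inner_add_left)
    moreover have "scaled_bump k x c h (x + h *\<^sub>R w) = c * bump2 k w"
      using assms by (simp add: scaled_bump_def)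
    ultimately show "complex_of_real (scaled_bump k x c h (x + h *\<^sub>R w)) * cis (- ((x + h *\<^sub>R w) \<bullet> \<xi>)) =
      (complex_of_real c * cis (- (x \<bullet> \<xi>))) * (complex_of_real (bump2 k w) * cis (- (w \<bullet> (h *\<^sub>R \<xi>))))"
      by (simp only: of_real_mult mult_ac)
  qed
  also have "\<dots> = (complex_of_real c * cis (- (x \<bullet> \<xi>))) * fourier (bump2 k) (h *\<^sub>R \<xi>)"
    unfolding fourier_def by (rule integral_mult_right_zero)
  finally show ?thesis by (simp add: scaleR_conv_of_real)
qed

text \<open>Rescaling: the amplitude \<open>h powr (\<beta> - 1)\<close> compensates the growth of the top order Sobolev norm in two
dimensions, and for \<open>h \<le> 1\<close> the lower order part of the weight only decreases.\<close>

lemma scaled_bump_sobolev: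
  assumes h: "0 < h" "h \<le> 1" and \<beta>: "\<beta> \<ge> 1"
  shows "(\<integral>\<^sup>+ \<xi>. ennreal ((1 + (norm \<xi>)\<^sup>2) powr \<beta> *
      (cmod (fourier (scaled_bump k x (a * h powr (\<beta> - 1)) h) \<xi>))\<^sup>2) \<partial>lborel) \<le>
    ennreal (a\<^sup>2) * (\<integral>\<^sup>+ \<xi>. ennreal ((1 + (norm \<xi>)\<^sup>2) powr \<beta> * (cmod (fourier (bump2 k) \<xi>))\<^sup>2) \<partial>lborel)"
proof -
  let ?f = "scaled_bump k x (a * h powr (\<beta> - 1)) h"
  let ?g = "\<lambda>\<xi>. ennreal ((1 + (norm \<xi>)\<^sup>2) powr \<beta> * (cmod (fourier ?f \<xi>))\<^sup>2)"
  have "(\<integral>\<^sup>+ \<xi>. ?g \<xi> \<partial>lborel) = ennreal ((1 / h)\<^sup>2) * (\<integral>\<^sup>+ \<eta>. ?g (0 + (1 / h) *\<^sub>R \<eta>) \<partial>lborel)"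
    using h by (intro nn_integral_affine_plane) auto
  also have "\<dots> = (\<integral>\<^sup>+ \<eta>. ennreal ((1 / h)\<^sup>2) * ?g (0 + (1 / h) *\<^sub>R \<eta>) \<partial>lborel)"
    by (rule nn_integral_cmult[symmetric]) simp
  also have "\<dots> \<le> (\<integral>\<^sup>+ \<eta>. ennreal (a\<^sup>2) * ennreal ((1 + (norm \<eta>)\<^sup>2) powr \<beta> * (cmod (fourier (bump2 k) \<eta>))\<^sup>2) \<partial>lborel)"
  proof (rule nn_integral_mono)
    fix \<eta> :: "real ^ 2"
    let ?F = "(cmod (fourier (bump2 k) \<eta>))\<^sup>2"
    let ?w = "1 + (norm ((1 / h) *\<^sub>R \<eta>))\<^sup>2"
    have "cmod (fourier ?f ((1 / h) *\<^sub>R \<eta>)) = \<bar>a\<bar> * h powr (\<beta> - 1) * h\<^sup>2 * cmod (fourier (bump2 k) \<eta>)"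
      using h by (simp add: fourier_scaled_bump norm_mult abs_mult norm_power)
    then have sq: "(cmod (fourier ?f ((1 / h) *\<^sub>R \<eta>)))\<^sup>2 = a\<^sup>2 * ((h powr (\<beta> - 1))\<^sup>2 * (h\<^sup>2)\<^sup>2) * ?F"
      by (simp add: power_mult_distrib)
    have hp: "(h powr (\<beta> - 1))\<^sup>2 * (h\<^sup>2)\<^sup>2 = h\<^sup>2 * (h\<^sup>2) powr \<beta>"
    proof -
      have "(h\<^sup>2) powr \<beta> = h powr (2 * \<beta>)" using h powr_powr[of h 2 \<beta>] by simp
      moreover have "(h powr (\<beta> - 1))\<^sup>2 = h powr (2 * \<beta> - 2)" using h by (simp add: powr_power algebra_simps)
      moreover have "h powr (2 * \<beta>) = h powr (2 * \<beta> - 2) * h\<^sup>2"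
        using h powr_add[of h "2 * \<beta> - 2" 2] by simp
      ultimately show ?thesis by (simp add: power2_eq_square)
    qed
    have "?w powr \<beta> * (h\<^sup>2) powr \<beta> = (?w * h\<^sup>2) powr \<beta>" by (simp add: powr_mult)
    also have "?w * h\<^sup>2 = h\<^sup>2 + (norm \<eta>)\<^sup>2" using h by (simp add: field_simps power2_eq_square)
    also have "\<dots> powr \<beta> \<le> (1 + (norm \<eta>)\<^sup>2) powr \<beta>"
      using h \<beta> by (intro powr_mono2) (auto simp: power_le_one)
    finally have w: "?w powr \<beta> * (h\<^sup>2) powr \<beta> \<le> (1 + (norm \<eta>)\<^sup>2) powr \<beta>" .
    have "(1 / h)\<^sup>2 * (?w powr \<beta> * (cmod (fourier ?f ((1 / h) *\<^sub>R \<eta>)))\<^sup>2) =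
        ((1 / h)\<^sup>2 * h\<^sup>2) * (a\<^sup>2 * ((?w powr \<beta> * (h\<^sup>2) powr \<beta>) * ?F))"
      unfolding sq hp by (simp only: mult_ac)
    also have "\<dots> = a\<^sup>2 * ((?w powr \<beta> * (h\<^sup>2) powr \<beta>) * ?F)" using h by (simp add: power_divide)
    also have "\<dots> \<le> a\<^sup>2 * ((1 + (norm \<eta>)\<^sup>2) powr \<beta> * ?F)"
      using w by (intro mult_left_mono mult_right_mono) auto
    finally have "ennreal ((1 / h)\<^sup>2 * (?w powr \<beta> * (cmod (fourier ?f ((1 / h) *\<^sub>R \<eta>)))\<^sup>2)) \<le>
        ennreal (a\<^sup>2 * ((1 + (norm \<eta>)\<^sup>2) powr \<beta> * ?F))" by (rule ennreal_leI)
    then show "ennreal ((1 / h)\<^sup>2) * ?g (0 + (1 / h) *\<^sub>R \<eta>) \<le> ennreal (a\<^sup>2) * ennreal ((1 + (norm \<eta>)\<^sup>2) powr \<beta> * ?F)"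
      by (simp only: add_0 ennreal_mult'[OF zero_le_power2])
  qed
  also have "\<dots> = ennreal (a\<^sup>2) * (\<integral>\<^sup>+ \<xi>. ennreal ((1 + (norm \<xi>)\<^sup>2) powr \<beta> * (cmod (fourier (bump2 k) \<xi>))\<^sup>2) \<partial>lborel)"
    by (rule nn_integral_cmult) simp
  finally show ?thesis .
qed

text \<open>Only lines at distance at most \<open>r\<close> from \<open>x\<close> meet the support, each within a segment of length at most \<open>2 * r\<close>. For a bump of
height \<open>h powr (\<beta> - 1)\<close> this gains one power of \<open>h\<close> in size and one in the share of lines, whence the exponent
\<open>2 * \<beta> + 1\<close> of its second moment.\<close>

lemma abs_exp_radon_local_le:
  assumes f: "\<And>y. f y \<noteq> 0 \<Longrightarrow> norm y \<le> 1" "\<And>y. f y \<noteq> 0 \<Longrightarrow> norm (y - x) \<le> r" "\<And>y. \<bar>f y\<bar> \<le> c"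
    and \<theta>: "norm \<theta> = 1" and r: "r \<ge> 0"
  shows "\<bar>exp_radon \<mu> f \<theta> s\<bar> \<le> 2 * exp \<bar>\<mu>\<bar> * c * r * indicator {-r..r} (s - x \<bullet> \<theta>)"
proof -
  let ?y = "\<lambda>t. s *\<^sub>R \<theta> + t *\<^sub>R perp \<theta>"
  have c: "c \<ge> 0" using f(3)[of 0] by linarith
  have coord: "\<bar>s - x \<bullet> \<theta>\<bar> \<le> r \<and> \<bar>t - x \<bullet> perp \<theta>\<bar> \<le> r" if "f (?y t) \<noteq> 0" for t
  proof -
    have n: "norm (?y t - x) \<le> r" using that by (rule f(2))
    have "\<bar>(?y t - x) \<bullet> \<theta>\<bar> \<le> norm (?y t - x) * norm \<theta>" "\<bar>(?y t - x) \<bullet> perp \<theta>\<bar> \<le> norm (?y t - x) * norm (perp \<theta>)"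
      by (rule Cauchy_Schwarz_ineq2)+
    then show ?thesis using n \<theta> by (auto simp: norm_perp inner_diff_left line_point_coordinates[OF \<theta>])
  qed
  let ?m = "x \<bullet> perp \<theta>"
  have "\<bar>exp_radon \<mu> f \<theta> s\<bar> \<le> (LINT t|lborel. \<bar>exp (\<mu> * (?y t \<bullet> perp \<theta>)) * f (?y t)\<bar>)"
    unfolding exp_radon_def Let_def by (rule integral_abs_bound)
  also have "\<dots> \<le> (LINT t|lborel. indicator {?m - r..?m + r} t * (exp \<bar>\<mu>\<bar> * c * indicator {-r..r} (s - x \<bullet> \<theta>)))"
  proof (rule Bochner_Integration.integral_mono')
    fix t :: real
    show "\<bar>exp (\<mu> * (?y t \<bullet> perp \<theta>)) * f (?y t)\<bar> \<le>
        indicator {?m - r..?m + r} t * (exp \<bar>\<mu>\<bar> * c * indicator {-r..r} (s - x \<bullet> \<theta>))"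
    proof (cases "f (?y t) = 0")
      case False
      have "\<bar>exp (\<mu> * (?y t \<bullet> perp \<theta>)) * f (?y t)\<bar> \<le> exp \<bar>\<mu>\<bar> * c"
        using exp_weight_le[OF f(1)[OF False] \<theta>, of \<mu>] f(3)[of "?y t"]
        unfolding abs_mult by (intro mult_mono) auto
      then show ?thesis using coord[OF False] by (auto simp: indicator_def abs_le_iff)
    qed (use c in auto)
  qed (use c in auto)
  also have "\<dots> = 2 * exp \<bar>\<mu>\<bar> * c * r * indicator {-r..r} (s - x \<bullet> \<theta>)" using r by simp
  finally show ?thesis .
qed

lemma bump_family:
  fixes \<mu> C L \<beta> :: real and x :: "real ^ 2"
  assumes C: "C > 0" and L: "L > 0" and x: "norm x < 1" and \<beta>: "\<beta> > 1"
  obtains a h\<^sub>0 D :: real and f :: "real \<Rightarrow> real ^ 2 \<Rightarrow> real" where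
    "a > 0" "h\<^sub>0 > 0" "D \<ge> 0"
    "\<And>h. 0 < h \<Longrightarrow> h \<le> h\<^sub>0 \<Longrightarrow> f h \<in> smooth_class C L \<beta> \<and> f h x = a * h powr (\<beta> - 1)"
    "\<And>h \<theta> s. 0 < h \<Longrightarrow> h \<le> h\<^sub>0 \<Longrightarrow> norm \<theta> = 1 \<Longrightarrow>
      \<bar>exp_radon \<mu> (f h) \<theta> s\<bar> \<le> D * h powr \<beta> * indicator {-2 * h..2 * h} (s - x \<bullet> \<theta>)"
proof -
  \<comment> \<open>smooth enough for finite Sobolev norm of order \<open>\<beta>\<close>\<close>
  define k where "k = nat \<lceil>\<beta> + 1\<rceil>"
  have k: "real k \<ge> \<beta> + 1" "k \<ge> 1" using \<beta> by (auto simp: k_def) linarith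
  define I where "I = enn2real (\<integral>\<^sup>+ \<xi>. ennreal ((1 + (norm \<xi>)\<^sup>2) powr \<beta> * (cmod (fourier (bump2 k) \<xi>))\<^sup>2) \<partial>lborel)"
  have I: "(\<integral>\<^sup>+ \<xi>. ennreal ((1 + (norm \<xi>)\<^sup>2) powr \<beta> * (cmod (fourier (bump2 k) \<xi>))\<^sup>2) \<partial>lborel) = ennreal I" "I \<ge> 0"
    using bump2_sobolev[OF _ k] \<beta> by (auto simp: I_def)
  define a where "a = min L (sqrt (C / (I + 1)))"
  \<comment> \<open>keeps the bump, of radius at most \<open>2 * h\<close>, inside the unit disc\<close>
  define h\<^sub>0 where "h\<^sub>0 = min 1 ((1 - norm x) / 2)"
  define D where "D = 4 * exp \<bar>\<mu>\<bar> * a"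
  define f where "f h = scaled_bump k x (a * h powr (\<beta> - 1)) h" for h
  have a: "a > 0" "a \<le> L" using L C I by (auto simp: a_def)
  have aI: "a\<^sup>2 * I \<le> C"
  proof -
    have "a\<^sup>2 \<le> (sqrt (C / (I + 1)))\<^sup>2" using a by (intro power_mono) (auto simp: a_def)
    then have "a\<^sup>2 \<le> C / (I + 1)" using C I by simp
    then have "a\<^sup>2 * I \<le> C / (I + 1) * I" using I by (intro mult_right_mono) auto
    also have "\<dots> \<le> C" using C I by (simp add: field_simps)
    finally show ?thesis .
  qed
  have small: "norm y \<le> 1" if "norm (y - x) \<le> 2 * h" "h \<le> h\<^sub>0" for y h
  proof -
    have "norm y \<le> norm x + norm (y - x)" by (metis add.commute diff_add_cancel norm_triangle_ineq)
    then show ?thesis using that by (simp add: h\<^sub>0_def)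
  qed
  have amp: "a * h powr (\<beta> - 1) \<le> L" "0 \<le> a * h powr (\<beta> - 1)" if "0 < h" "h \<le> h\<^sub>0" for h
  proof -
    have "h powr (\<beta> - 1) \<le> 1" using that \<beta> by (intro powr_le1) (auto simp: h\<^sub>0_def)
    then have "a * h powr (\<beta> - 1) \<le> a * 1" using a by (intro mult_left_mono) auto
    then show "a * h powr (\<beta> - 1) \<le> L" using a by linarith
  qed (use a in auto)
  show ?thesis
  proof
    show "a > 0" "h\<^sub>0 > 0" "D \<ge> 0" using a x by (auto simp: h\<^sub>0_def D_def)
    fix h :: real assume h: "0 < h" "h \<le> h\<^sub>0"
    have supp: "norm (y - x) \<le> 2 * h" if "f h y \<noteq> 0" for y
      using that unfolding f_def by (rule scaled_bump_support[OF k(2) h(1)])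
    have cont: "continuous_on UNIV (f h)"
      unfolding f_def scaled_bump_def[abs_def] using h
      by (intro continuous_intros continuous_on_compose2[OF continuous_on_bump2]) auto
    have bound: "\<bar>f h y\<bar> \<le> a * h powr (\<beta> - 1)" for y
      unfolding f_def by (rule abs_scaled_bump_le) (rule amp(2)[OF h])
    have int: "integrable lborel (f h)"
    proof -
      have "integrable lborel (\<lambda>y. (a * h powr (\<beta> - 1)) * indicator (cball (0 :: real ^ 2) 1) y :: real)"
        using emeasure_bounded_finite[of "cball (0 :: real ^ 2) 1"]
        by (intro integrable_mult_right integrable_real_indicator) auto
      then show ?thesis
      proof (rule Bochner_Integration.integrable_bound)
        show "AE y in lborel. norm (f h y) \<le> norm ((a * h powr (\<beta> - 1)) * indicator (cball 0 1) y :: real)"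
        proof (rule AE_I2)
          fix y
          show "norm (f h y) \<le> norm ((a * h powr (\<beta> - 1)) * indicator (cball 0 1) y :: real)"
            using bound[of y] small[OF supp h(2), of y] amp(2)[OF h] by (cases "f h y = 0") auto
        qed
      qed (simp add: f_def)
    qed
    have "(\<integral>\<^sup>+ \<xi>. ennreal ((1 + (norm \<xi>)\<^sup>2) powr \<beta> * (cmod (fourier (f h) \<xi>))\<^sup>2) \<partial>lborel) \<le> ennreal (a\<^sup>2) * ennreal I"
      unfolding f_def I(1)[symmetric] using h \<beta> by (intro scaled_bump_sobolev) (auto simp: h\<^sub>0_def)
    also have "\<dots> = ennreal (a\<^sup>2 * I)" by (rule ennreal_mult'[symmetric]) simp
    also have "\<dots> \<le> ennreal C" using aI by (rule ennreal_leI)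
    finally have "f h \<in> sobolev_ball \<beta> C" using int by (simp add: sobolev_ball_def)
    moreover have "f h \<in> bounded_class L"
      unfolding bounded_class_def
    proof (safe)
      fix y assume "f h y \<noteq> 0"
      then show "norm y \<le> 1" using small[OF supp h(2)] by blast
    next
      show "AE y in lborel. isCont (f h) y" using cont by (simp add: continuous_on_eq_continuous_at)
    next
      fix y show "\<bar>f h y\<bar> \<le> L" using bound[of y] amp(1)[OF h] by linarith
    qed
    moreover have "f h x = a * h powr (\<beta> - 1)" by (simp add: f_def scaled_bump_def bump2_bounds)
    ultimately show "f h \<in> smooth_class C L \<beta> \<and> f h x = a * h powr (\<beta> - 1)"
      using cont by (simp add: smooth_class_def)
    fix \<theta> :: "real ^ 2" and s :: real assume \<theta>: "norm \<theta> = 1"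
    have "\<bar>exp_radon \<mu> (f h) \<theta> s\<bar> \<le> 2 * exp \<bar>\<mu>\<bar> * (a * h powr (\<beta> - 1)) * (2 * h) * indicator {-(2 * h)..2 * h} (s - x \<bullet> \<theta>)"
      by (rule abs_exp_radon_local_le[OF _ supp bound \<theta>]) (use small[OF supp h(2)] h in auto)
    also have "2 * exp \<bar>\<mu>\<bar> * (a * h powr (\<beta> - 1)) * (2 * h) = D * h powr \<beta>"
      using h powr_add[of h "\<beta> - 1" 1] by (simp add: D_def)
    finally show "\<bar>exp_radon \<mu> (f h) \<theta> s\<bar> \<le> D * h powr \<beta> * indicator {-2 * h..2 * h} (s - x \<bullet> \<theta>)" by simp
  qed
qed

section \<open>Likelihood ratios and two hypotheses\<close>

text \<open>The density of the law of an observation of \<open>f\<close> with respect to that of pure noise.\<close>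

definition likelihood_ratio :: "real \<Rightarrow> real \<Rightarrow> (real ^ 2 \<Rightarrow> real) \<Rightarrow> observation \<Rightarrow> real" where
  "likelihood_ratio \<mu> \<sigma> f w = (let T = exp_radon \<mu> f (fst w) (fst (snd w)) in
     exp ((snd (snd w) * T - T\<^sup>2 / 2) / \<sigma>\<^sup>2))"

lemma likelihood_ratio_measurable [measurable]:
  assumes [measurable]: "f \<in> borel_measurable borel"
  shows "likelihood_ratio \<mu> \<sigma> f \<in> borel_measurable borel"
  unfolding likelihood_ratio_def[abs_def] Let_def by measurable

lemma exp_radon_zero [simp]: "exp_radon \<mu> (\<lambda>_. 0) \<theta> s = 0"
  by (simp add: exp_radon_def)

lemma normal_density_shift:
  assumes "\<sigma> > 0"
  shows "normal_density 0 \<sigma> (y - T) = normal_density 0 \<sigma> y * exp ((y * T - T\<^sup>2 / 2) / \<sigma>\<^sup>2)"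
proof -
  have "- (y - T - 0)\<^sup>2 / (2 * \<sigma>\<^sup>2) = - (y - 0)\<^sup>2 / (2 * \<sigma>\<^sup>2) + (y * T - T\<^sup>2 / 2) / \<sigma>\<^sup>2"
    using assms by (simp add: field_simps power2_eq_square)
  then show ?thesis unfolding normal_density_def by (simp only: exp_add mult.assoc)
qed

text \<open>The design has the same law under both hypotheses, and given the design the observations differ by a shift of the
Gaussian noise.\<close>

lemma nn_integral_likelihood_ratio:
  assumes f[measurable]: "f \<in> borel_measurable borel" and \<sigma>: "\<sigma> > 0" and g[measurable]: "g \<in> borel_measurable borel"
  shows "(\<integral>\<^sup>+ w. g w \<partial>observation_law \<mu> \<sigma> f) =
    (\<integral>\<^sup>+ w. ennreal (likelihood_ratio \<mu> \<sigma> f w) * g w \<partial>observation_law \<mu> \<sigma> (\<lambda>_. 0))"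
proof -
  have gm: "(\<lambda>e. g (\<theta>, s, e)) \<in> borel_measurable borel" for \<theta> s
    by (rule measurable_compose[OF _ g]) (intro borel_measurable_Pair, auto)
  have "(\<integral>\<^sup>+ w. g w \<partial>observation_law \<mu> \<sigma> f) =
    (\<integral>\<^sup>+ z. \<integral>\<^sup>+ e. g (fst z, snd z, exp_radon \<mu> f (fst z) (snd z) + e) \<partial>noise_law \<sigma> \<partial>design_law)"
    by (rule nn_integral_observation_law[OF f \<sigma> g])
  also have "\<dots> = (\<integral>\<^sup>+ z. \<integral>\<^sup>+ e. ennreal (likelihood_ratio \<mu> \<sigma> f (fst z, snd z, 0 + e)) * g (fst z, snd z, 0 + e)
      \<partial>noise_law \<sigma> \<partial>design_law)"
  proof (rule nn_integral_cong)
    fix z :: "(real ^ 2) \<times> real"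
    let ?T = "exp_radon \<mu> f (fst z) (snd z)" and ?g = "\<lambda>e. g (fst z, snd z, e)"
    note [measurable] = gm[of "fst z" "snd z"]
    have "(\<integral>\<^sup>+ e. g (fst z, snd z, ?T + e) \<partial>noise_law \<sigma>) =
        (\<integral>\<^sup>+ e. ennreal (normal_density 0 \<sigma> ((?T + 1 * e) - ?T)) * ?g (?T + 1 * e) \<partial>lborel)"
      by (subst nn_integral_noise_law) simp_all
    also have "\<dots> = (\<integral>\<^sup>+ y. ennreal (normal_density 0 \<sigma> (y - ?T)) * ?g y \<partial>lborel)"
      by (subst nn_integral_real_affine[where c=1 and t="?T"]) simp_all
    also have "\<dots> = (\<integral>\<^sup>+ y. ennreal (normal_density 0 \<sigma> y) * (ennreal (likelihood_ratio \<mu> \<sigma> f (fst z, snd z, y)) * ?g y) \<partial>lborel)"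
      by (simp add: normal_density_shift[OF \<sigma>] likelihood_ratio_def Let_def ennreal_mult' mult.assoc normal_density_nonneg)
    also have "\<dots> = (\<integral>\<^sup>+ e. ennreal (likelihood_ratio \<mu> \<sigma> f (fst z, snd z, e)) * ?g e \<partial>noise_law \<sigma>)"
    proof (rule nn_integral_noise_law[symmetric])
      have "(\<lambda>e. likelihood_ratio \<mu> \<sigma> f (fst z, snd z, e)) \<in> borel_measurable borel"
        by (rule measurable_compose[OF _ likelihood_ratio_measurable[OF f]]) (intro borel_measurable_Pair, auto)
      then show "(\<lambda>e. ennreal (likelihood_ratio \<mu> \<sigma> f (fst z, snd z, e)) * ?g e) \<in> borel_measurable borel"
        by measurable
    qed
    finally show "(\<integral>\<^sup>+ e. g (fst z, snd z, ?T + e) \<partial>noise_law \<sigma>) =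
      (\<integral>\<^sup>+ e. ennreal (likelihood_ratio \<mu> \<sigma> f (fst z, snd z, 0 + e)) * g (fst z, snd z, 0 + e) \<partial>noise_law \<sigma>)"
      by simp
  qed
  also have "\<dots> = (\<integral>\<^sup>+ w. ennreal (likelihood_ratio \<mu> \<sigma> f w) * g w \<partial>observation_law \<mu> \<sigma> (\<lambda>_. 0))"
    by (subst nn_integral_observation_law[OF _ \<sigma>]) simp_all
  finally show ?thesis .
qed

lemma data_law_density:
  assumes f[measurable]: "f \<in> borel_measurable borel" and \<sigma>: "\<sigma> > 0"
  shows "data_law \<mu> \<sigma> n f = density (data_law \<mu> \<sigma> n (\<lambda>_. 0)) (\<lambda>d. \<Prod>i\<in>{1..n}. ennreal (likelihood_ratio \<mu> \<sigma> f (d i)))"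
proof -
  let ?p = "\<lambda>w. ennreal (likelihood_ratio \<mu> \<sigma> f w)"
  let ?O = "observation_law \<mu> \<sigma> (\<lambda>_. 0)"
  interpret f: product_sigma_finite "\<lambda>_ :: nat. observation_law \<mu> \<sigma> f"
    by (rule product_sigma_finite_observation_law) (simp_all add: \<sigma>)
  interpret z: product_sigma_finite "\<lambda>_ :: nat. ?O"
    by (rule product_sigma_finite_observation_law) (simp_all add: \<sigma>)
  have pm: "(\<lambda>d. \<Prod>i\<in>{1..n}. ?p (d i)) \<in> borel_measurable (\<Pi>\<^sub>M i\<in>{1..n}. ?O)"
    by measurable
  have "density (\<Pi>\<^sub>M i\<in>{1..n}. ?O) (\<lambda>d. \<Prod>i\<in>{1..n}. ?p (d i)) = (\<Pi>\<^sub>M i\<in>{1..n}. observation_law \<mu> \<sigma> f)"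
  proof (rule f.PiM_eqI)
    show "sets (density (\<Pi>\<^sub>M i\<in>{1..n}. ?O) (\<lambda>d. \<Prod>i\<in>{1..n}. ?p (d i))) = sets (\<Pi>\<^sub>M i\<in>{1..n}. observation_law \<mu> \<sigma> f)"
      unfolding sets_density by (intro sets_PiM_cong) (simp_all add: sets_observation_law)
    fix A :: "nat \<Rightarrow> observation set"
    assume "\<And>i. i \<in> {1..n} \<Longrightarrow> A i \<in> sets (observation_law \<mu> \<sigma> f)"
    then have A: "A i \<in> sets borel" if "i \<in> {1..n}" for i using that by (simp add: sets_observation_law)
    then have AO: "Pi\<^sub>E {1..n} A \<in> sets (\<Pi>\<^sub>M i\<in>{1..n}. ?O)"
      by (intro sets_PiM_I_finite) (auto simp: sets_observation_law)
    have "emeasure (density (\<Pi>\<^sub>M i\<in>{1..n}. ?O) (\<lambda>d. \<Prod>i\<in>{1..n}. ?p (d i))) (Pi\<^sub>E {1..n} A) =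
        (\<integral>\<^sup>+ d. (\<Prod>i\<in>{1..n}. ?p (d i)) * indicator (Pi\<^sub>E {1..n} A) d \<partial>(\<Pi>\<^sub>M i\<in>{1..n}. ?O))"
      by (rule emeasure_density[OF pm AO])
    also have "\<dots> = (\<integral>\<^sup>+ d. (\<Prod>i\<in>{1..n}. ?p (d i) * indicator (A i) (d i)) \<partial>(\<Pi>\<^sub>M i\<in>{1..n}. ?O))"
    proof (rule nn_integral_cong)
      fix d assume d: "d \<in> space (\<Pi>\<^sub>M i\<in>{1..n}. ?O)"
      have "indicator (Pi\<^sub>E {1..n} A) d = (\<Prod>i\<in>{1..n}. indicator (A i) (d i) :: ennreal)"
      proof (cases "d \<in> Pi\<^sub>E {1..n} A")
        case True
        then show ?thesis by (auto simp: PiE_mem)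
      next
        case False
        then obtain i where "i \<in> {1..n}" "d i \<notin> A i" using d by (auto simp: space_PiM PiE_iff)
        then have "(\<Prod>i\<in>{1..n}. indicator (A i) (d i) :: ennreal) = 0"
          by (intro prod_zero bexI[of _ i]) auto
        then show ?thesis using False by simp
      qed
      then show "(\<Prod>i\<in>{1..n}. ?p (d i)) * indicator (Pi\<^sub>E {1..n} A) d = (\<Prod>i\<in>{1..n}. ?p (d i) * indicator (A i) (d i))"
        by (simp add: prod.distrib)
    qed
    also have "\<dots> = (\<Prod>i\<in>{1..n}. \<integral>\<^sup>+ w. ?p w * indicator (A i) w \<partial>?O)"
      by (rule z.product_nn_integral_prod) (use A in \<open>auto intro!: borel_measurable_times_ennreal borel_measurable_indicator simp: sets_observation_law\<close>)
    also have "\<dots> = (\<Prod>i\<in>{1..n}. emeasure (observation_law \<mu> \<sigma> f) (A i))"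
    proof (rule prod.cong[OF refl])
      fix i assume i: "i \<in> {1..n}"
      have "(\<integral>\<^sup>+ w. indicator (A i) w \<partial>observation_law \<mu> \<sigma> f) = (\<integral>\<^sup>+ w. ?p w * indicator (A i) w \<partial>?O)"
        by (rule nn_integral_likelihood_ratio[OF f \<sigma>]) (use A[OF i] in simp)
      then show "(\<integral>\<^sup>+ w. ?p w * indicator (A i) w \<partial>?O) = emeasure (observation_law \<mu> \<sigma> f) (A i)"
        using A[OF i] by (simp add: sets_observation_law)
    qed
    finally show "emeasure (density (\<Pi>\<^sub>M i\<in>{1..n}. ?O) (\<lambda>d. \<Prod>i\<in>{1..n}. ?p (d i))) (Pi\<^sub>E {1..n} A) =
      (\<Prod>i\<in>{1..n}. emeasure (observation_law \<mu> \<sigma> f) (A i))" .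
  qed simp
  then show ?thesis unfolding data_law_def ..
qed

text \<open>For a shift by \<open>T\<close> the second moment of the Gaussian likelihood ratio is \<open>exp (T\<^sup>2 / \<sigma>\<^sup>2)\<close>. For small shifts it
is linear in \<open>T\<^sup>2\<close>, so that only the mean square over the design matters.\<close>

lemma likelihood_ratio_second_moment:
  assumes f[measurable]: "f \<in> borel_measurable borel" and \<sigma>: "\<sigma> > 0"
    and small: "\<And>\<theta> s. norm \<theta> = 1 \<Longrightarrow> (exp_radon \<mu> f \<theta> s)\<^sup>2 \<le> \<sigma>\<^sup>2"
    and V: "(\<integral>\<^sup>+ z. ennreal ((exp_radon \<mu> f (fst z) (snd z))\<^sup>2) \<partial>design_law) \<le> ennreal V" "V \<ge> 0"
  shows "(\<integral>\<^sup>+ d. (\<Prod>i\<in>{1..n}. ennreal (likelihood_ratio \<mu> \<sigma> f (d i)))\<^sup>2 \<partial>data_law \<mu> \<sigma> n (\<lambda>_. 0)) \<le>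
    ennreal (exp (2 * real n * V / \<sigma>\<^sup>2))"
proof -
  interpret design: prob_space design_law by (rule prob_space_design_law)
  let ?O = "observation_law \<mu> \<sigma> (\<lambda>_. 0)"
  interpret z: product_sigma_finite "\<lambda>_ :: nat. ?O"
    by (rule product_sigma_finite_observation_law) (simp_all add: \<sigma>)
  let ?T = "\<lambda>z. exp_radon \<mu> f (fst z) (snd z)"
  have "(\<integral>\<^sup>+ w. (ennreal (likelihood_ratio \<mu> \<sigma> f w))\<^sup>2 \<partial>?O) =
      (\<integral>\<^sup>+ z. \<integral>\<^sup>+ e. (ennreal (likelihood_ratio \<mu> \<sigma> f (fst z, snd z, e)))\<^sup>2 \<partial>noise_law \<sigma> \<partial>design_law)"
    by (subst nn_integral_observation_law[OF _ \<sigma>]) simp_all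
  also have "\<dots> = (\<integral>\<^sup>+ z. ennreal (exp ((?T z)\<^sup>2 / \<sigma>\<^sup>2)) \<partial>design_law)"
  proof (rule nn_integral_cong)
    fix z :: "(real ^ 2) \<times> real"
    let ?t = "?T z"
    have "(likelihood_ratio \<mu> \<sigma> f (fst z, snd z, e))\<^sup>2 = exp (- (?t\<^sup>2 / \<sigma>\<^sup>2)) * exp ((2 * ?t / \<sigma>\<^sup>2) * e)" for e
    proof -
      have "(likelihood_ratio \<mu> \<sigma> f (fst z, snd z, e))\<^sup>2 = exp (2 * ((e * ?t - ?t\<^sup>2 / 2) / \<sigma>\<^sup>2))"
        by (simp only: likelihood_ratio_def Let_def fst_conv snd_conv exp_double)
      also have "2 * ((e * ?t - ?t\<^sup>2 / 2) / \<sigma>\<^sup>2) = - (?t\<^sup>2 / \<sigma>\<^sup>2) + (2 * ?t / \<sigma>\<^sup>2) * e"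
        using \<sigma> by (simp add: field_simps)
      finally show ?thesis by (simp only: exp_add)
    qed
    then have "(\<integral>\<^sup>+ e. (ennreal (likelihood_ratio \<mu> \<sigma> f (fst z, snd z, e)))\<^sup>2 \<partial>noise_law \<sigma>) =
        (\<integral>\<^sup>+ e. ennreal (exp (- (?t\<^sup>2 / \<sigma>\<^sup>2))) * ennreal (exp ((2 * ?t / \<sigma>\<^sup>2) * e)) \<partial>noise_law \<sigma>)"
      by (simp add: ennreal_power likelihood_ratio_def Let_def ennreal_mult'[symmetric])
    also have "\<dots> = ennreal (exp (- (?t\<^sup>2 / \<sigma>\<^sup>2))) * ennreal (exp ((2 * ?t / \<sigma>\<^sup>2)\<^sup>2 * \<sigma>\<^sup>2 / 2))"
      by (subst nn_integral_cmult, simp, subst nn_integral_noise_exp[OF \<sigma>]) (rule refl)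
    also have "\<dots> = ennreal (exp (- (?t\<^sup>2 / \<sigma>\<^sup>2) + (2 * ?t / \<sigma>\<^sup>2)\<^sup>2 * \<sigma>\<^sup>2 / 2))"
      by (simp only: ennreal_mult'[OF exp_ge_zero] exp_add)
    also have "- (?t\<^sup>2 / \<sigma>\<^sup>2) + (2 * ?t / \<sigma>\<^sup>2)\<^sup>2 * \<sigma>\<^sup>2 / 2 = ?t\<^sup>2 / \<sigma>\<^sup>2"
      using \<sigma> by (simp add: field_simps power2_eq_square)
    finally show "(\<integral>\<^sup>+ e. (ennreal (likelihood_ratio \<mu> \<sigma> f (fst z, snd z, e)))\<^sup>2 \<partial>noise_law \<sigma>) = ennreal (exp (?t\<^sup>2 / \<sigma>\<^sup>2))" .
  qed
  also have "\<dots> \<le> (\<integral>\<^sup>+ z. 1 + ennreal (2 / \<sigma>\<^sup>2) * ennreal ((?T z)\<^sup>2) \<partial>design_law)"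
  proof (rule nn_integral_mono_AE)
    show "AE z in design_law. ennreal (exp ((?T z)\<^sup>2 / \<sigma>\<^sup>2)) \<le> 1 + ennreal (2 / \<sigma>\<^sup>2) * ennreal ((?T z)\<^sup>2)"
      using AE_design_law_norm
    proof eventually_elim
      case (elim z)
      define v where "v = (?T z)\<^sup>2 / \<sigma>\<^sup>2"
      have v: "0 \<le> v" "v \<le> 1" using small[OF elim, of "snd z"] \<sigma> by (auto simp: v_def)
      have "exp v \<le> 1 + v + v\<^sup>2" using v by (rule exp_bound)
      also have "v\<^sup>2 \<le> v" using v by (simp add: power2_eq_square mult_left_le)
      finally have "exp v \<le> 1 + 2 / \<sigma>\<^sup>2 * (?T z)\<^sup>2" by (simp add: v_def)
      then have "ennreal (exp v) \<le> ennreal (1 + 2 / \<sigma>\<^sup>2 * (?T z)\<^sup>2)" by (rule ennreal_leI)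
      also have "\<dots> = ennreal 1 + ennreal (2 / \<sigma>\<^sup>2 * (?T z)\<^sup>2)" by (rule ennreal_plus) auto
      also have "ennreal (2 / \<sigma>\<^sup>2 * (?T z)\<^sup>2) = ennreal (2 / \<sigma>\<^sup>2) * ennreal ((?T z)\<^sup>2)" by (rule ennreal_mult') simp
      finally show ?case by (simp add: v_def)
    qed
  qed
  also have "\<dots> = 1 + ennreal (2 / \<sigma>\<^sup>2) * (\<integral>\<^sup>+ z. ennreal ((?T z)\<^sup>2) \<partial>design_law)"
    by (subst nn_integral_add, simp, simp, subst nn_integral_cmult, simp) (simp add: design.emeasure_space_1[simplified])
  also have "\<dots> \<le> 1 + ennreal (2 / \<sigma>\<^sup>2) * ennreal V" using V by (intro add_left_mono mult_left_mono) auto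
  also have "\<dots> = ennreal 1 + ennreal (2 / \<sigma>\<^sup>2 * V)" by (subst ennreal_mult') simp_all
  also have "\<dots> = ennreal (1 + 2 / \<sigma>\<^sup>2 * V)" using V by (intro ennreal_plus[symmetric]) auto
  also have "\<dots> \<le> ennreal (exp (2 / \<sigma>\<^sup>2 * V))" by (intro ennreal_leI exp_ge_add_one_self)
  finally have single: "(\<integral>\<^sup>+ w. (ennreal (likelihood_ratio \<mu> \<sigma> f w))\<^sup>2 \<partial>?O) \<le> ennreal (exp (2 / \<sigma>\<^sup>2 * V))" .
  have "(\<integral>\<^sup>+ d. (\<Prod>i\<in>{1..n}. ennreal (likelihood_ratio \<mu> \<sigma> f (d i)))\<^sup>2 \<partial>data_law \<mu> \<sigma> n (\<lambda>_. 0)) =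
      (\<Prod>i\<in>{1..n}. \<integral>\<^sup>+ w. (ennreal (likelihood_ratio \<mu> \<sigma> f w))\<^sup>2 \<partial>?O)"
    unfolding data_law_def prod_power_distrib by (rule z.product_nn_integral_prod) auto
  also have "\<dots> \<le> (\<Prod>i\<in>{1..n}. ennreal (exp (2 / \<sigma>\<^sup>2 * V)))"
    by (rule prod_mono_ennreal) (rule single)
  also have "\<dots> = ennreal (exp (2 * real n * V / \<sigma>\<^sup>2))"
    by (simp add: ennreal_power exp_of_nat_mult[symmetric] mult_ac)
  finally show ?thesis .
qed

text \<open>The constrained risk inequality of Brown and Low. The triangle inequality splits \<open>v\<close> into the errors at
the two hypotheses; the first one is transported to the null hypothesis by the likelihood ratio and Cauchy-Schwarz.\<close>

lemma two_point_inequality: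
  assumes f: "f \<in> borel_measurable borel" and \<sigma>: "\<sigma> > 0"
    and F[measurable]: "F \<in> borel_measurable (\<Pi>\<^sub>M i\<in>{1..n}. (borel :: observation measure))"
    and R0: "(\<integral>\<^sup>+ d. ennreal ((F d)\<^sup>2) \<partial>data_law \<mu> \<sigma> n (\<lambda>_. 0)) \<le> ennreal (r0\<^sup>2)" "r0 \<ge> 0"
    and R1: "(\<integral>\<^sup>+ d. ennreal ((F d - v)\<^sup>2) \<partial>data_law \<mu> \<sigma> n f) \<le> ennreal (r1\<^sup>2)" "r1 \<ge> 0"
    and P: "(\<integral>\<^sup>+ d. (\<Prod>i\<in>{1..n}. ennreal (likelihood_ratio \<mu> \<sigma> f (d i)))\<^sup>2 \<partial>data_law \<mu> \<sigma> n (\<lambda>_. 0)) \<le> ennreal (I\<^sup>2)" "I \<ge> 0"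
    and v: "v \<ge> 0"
  shows "v \<le> r0 * I + r1"
proof -
  let ?D0 = "data_law \<mu> \<sigma> n (\<lambda>_. 0)" and ?D1 = "data_law \<mu> \<sigma> n f"
  let ?P = "\<lambda>d. \<Prod>i\<in>{1..n}. ennreal (likelihood_ratio \<mu> \<sigma> f (d i))"
  interpret one: prob_space ?D1 by (rule prob_space_data_law[OF f \<sigma>])
  have [measurable]: "likelihood_ratio \<mu> \<sigma> f \<in> borel_measurable borel" using f by measurable
  have "?P \<in> borel_measurable (\<Pi>\<^sub>M i\<in>{1..n}. (borel :: observation measure))" by measurable
  then have Pm[measurable]: "?P \<in> borel_measurable ?D0" by measurable
  have "ennreal v = (\<integral>\<^sup>+ d. ennreal v \<partial>?D1)" by (simp add: one.emeasure_space_1)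
  also have "\<dots> \<le> (\<integral>\<^sup>+ d. ennreal \<bar>F d\<bar> + ennreal \<bar>F d - v\<bar> \<partial>?D1)"
    by (intro nn_integral_mono) (auto simp: ennreal_plus[symmetric] simp del: ennreal_plus intro!: ennreal_leI)
  also have "\<dots> = (\<integral>\<^sup>+ d. ennreal \<bar>F d\<bar> \<partial>?D1) + (\<integral>\<^sup>+ d. ennreal \<bar>F d - v\<bar> \<partial>?D1)"
    by (rule nn_integral_add) auto
  also have "\<dots> \<le> ennreal (r0 * I) + ennreal r1"
  proof (rule add_mono)
    have "(\<integral>\<^sup>+ d. ennreal \<bar>F d\<bar> \<partial>?D1) = (\<integral>\<^sup>+ d. ennreal \<bar>F d\<bar> * ?P d \<partial>?D0)"
      unfolding data_law_density[OF f \<sigma>, of \<mu> n] by (subst nn_integral_density) (simp_all add: mult.commute)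
    moreover have "(\<integral>\<^sup>+ d. ennreal \<bar>F d\<bar> * ?P d \<partial>?D0)\<^sup>2 \<le> (ennreal (r0 * I))\<^sup>2"
    proof -
      have "(\<integral>\<^sup>+ d. ennreal \<bar>F d\<bar> * ?P d \<partial>?D0)\<^sup>2 \<le> (\<integral>\<^sup>+ d. (ennreal \<bar>F d\<bar>)\<^sup>2 \<partial>?D0) * (\<integral>\<^sup>+ d. (?P d)\<^sup>2 \<partial>?D0)"
        by (rule Cauchy_Schwarz_nn_integral) auto
      also have "(\<lambda>d. (ennreal \<bar>F d\<bar>)\<^sup>2) = (\<lambda>d. ennreal ((F d)\<^sup>2))" by (simp add: ennreal_power fun_eq_iff)
      also have "(\<integral>\<^sup>+ d. ennreal ((F d)\<^sup>2) \<partial>?D0) * (\<integral>\<^sup>+ d. (?P d)\<^sup>2 \<partial>?D0) \<le> ennreal (r0\<^sup>2) * ennreal (I\<^sup>2)"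
        using R0(1) P(1) by (intro mult_mono) auto
      also have "\<dots> = ennreal (r0\<^sup>2 * I\<^sup>2)" by (rule ennreal_mult'[symmetric]) simp
      also have "\<dots> = (ennreal (r0 * I))\<^sup>2" using R0(2) P(2) by (simp add: ennreal_power power_mult_distrib)
      finally show ?thesis .
    qed
    ultimately show "(\<integral>\<^sup>+ d. ennreal \<bar>F d\<bar> \<partial>?D1) \<le> ennreal (r0 * I)"
      by (simp only: ennreal_power2_le_cancel)
    have "(\<integral>\<^sup>+ d. ennreal \<bar>F d - v\<bar> * 1 \<partial>?D1)\<^sup>2 \<le> (\<integral>\<^sup>+ d. (ennreal \<bar>F d - v\<bar>)\<^sup>2 \<partial>?D1) * (\<integral>\<^sup>+ d. 1\<^sup>2 \<partial>?D1)"
      by (rule Cauchy_Schwarz_nn_integral) auto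
    also have "\<dots> = (\<integral>\<^sup>+ d. ennreal ((F d - v)\<^sup>2) \<partial>?D1)" by (simp add: ennreal_power one.emeasure_space_1)
    also have "\<dots> \<le> (ennreal r1)\<^sup>2" using R1 by (simp add: ennreal_power)
    finally show "(\<integral>\<^sup>+ d. ennreal \<bar>F d - v\<bar> \<partial>?D1) \<le> ennreal r1"
      by (intro ennreal_power2_le_cancel) simp
  qed
  also have "\<dots> = ennreal (r0 * I + r1)"
    using R0(2) R1(2) P(2) by (intro ennreal_plus[symmetric]) auto
  finally show ?thesis using R0(2) R1(2) P(2) by (subst (asm) ennreal_le_iff) auto
qed

lemma design_second_moment_local:
  assumes [measurable]: "f \<in> borel_measurable borel" and H: "H \<ge> 0" and r: "r > 0"
    and T: "\<And>\<theta> s. norm \<theta> = 1 \<Longrightarrow> \<bar>exp_radon \<mu> f \<theta> s\<bar> \<le> H * indicator {-r..r} (s - x \<bullet> \<theta>)"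
  shows "(\<integral>\<^sup>+ z. ennreal ((exp_radon \<mu> f (fst z) (snd z))\<^sup>2) \<partial>design_law) \<le> ennreal (H\<^sup>2 * r)"
proof -
  have "(\<integral>\<^sup>+ z. ennreal ((exp_radon \<mu> f (fst z) (snd z))\<^sup>2) \<partial>design_law) =
    (\<integral>\<^sup>+ \<phi>. (\<integral>\<^sup>+ s. ennreal ((exp_radon \<mu> f (circle_point \<phi>) s)\<^sup>2) * indicator {-1..1} s \<partial>lborel) / 2 *
      indicator {0..2 * pi} \<phi> \<partial>lborel) / ennreal (2 * pi)"
    by (subst nn_integral_design_law) auto
  also have "\<dots> \<le> (\<integral>\<^sup>+ \<phi>. ennreal (H\<^sup>2 * r) * indicator {0..2 * pi} \<phi> \<partial>lborel) / ennreal (2 * pi)"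
  proof (intro divide_right_mono_ennreal nn_integral_mono mult_right_mono)
    fix \<phi> :: real
    let ?c = "x \<bullet> circle_point \<phi>"
    have "(\<integral>\<^sup>+ s. ennreal ((exp_radon \<mu> f (circle_point \<phi>) s)\<^sup>2) * indicator {-1..1} s \<partial>lborel) \<le>
        (\<integral>\<^sup>+ s. ennreal (H\<^sup>2) * indicator {?c - r..?c + r} s \<partial>lborel)"
    proof (rule nn_integral_mono)
      fix s :: real
      have "\<bar>exp_radon \<mu> f (circle_point \<phi>) s\<bar>\<^sup>2 \<le> (H * indicator {-r..r} (s - ?c))\<^sup>2"
        using T[OF norm_circle_point] by (intro power_mono) auto
      then have "ennreal ((exp_radon \<mu> f (circle_point \<phi>) s)\<^sup>2) \<le> ennreal ((H * indicator {-r..r} (s - ?c))\<^sup>2)"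
        by (intro ennreal_leI) simp
      also have "\<dots> = ennreal (H\<^sup>2) * indicator {?c - r..?c + r} s" by (auto simp: indicator_def)
      finally show "ennreal ((exp_radon \<mu> f (circle_point \<phi>) s)\<^sup>2) * indicator {-1..1} s \<le>
          ennreal (H\<^sup>2) * indicator {?c - r..?c + r} s"
        by (auto simp: indicator_def split: if_splits)
    qed
    also have "\<dots> = ennreal (H\<^sup>2) * ennreal (2 * r)" using r by (subst nn_integral_cmult_indicator) auto
    also have "\<dots> = ennreal (H\<^sup>2 * (2 * r))" by (rule ennreal_mult'[symmetric]) simp
    finally have "(\<integral>\<^sup>+ s. ennreal ((exp_radon \<mu> f (circle_point \<phi>) s)\<^sup>2) * indicator {-1..1} s \<partial>lborel) / 2 \<le>
        ennreal (H\<^sup>2 * (2 * r)) / ennreal 2" by (simp add: divide_right_mono_ennreal)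
    also have "\<dots> = ennreal (H\<^sup>2 * r)" using r by (subst divide_ennreal) auto
    finally show "(\<integral>\<^sup>+ s. ennreal ((exp_radon \<mu> f (circle_point \<phi>) s)\<^sup>2) * indicator {-1..1} s \<partial>lborel) / 2 \<le>
        ennreal (H\<^sup>2 * r)" .
  qed auto
  also have "\<dots> = ennreal (H\<^sup>2 * r) * ennreal (2 * pi) / ennreal (2 * pi)"
    by (subst nn_integral_cmult_indicator) auto
  also have "\<dots> = ennreal (H\<^sup>2 * r * (2 * pi)) / ennreal (2 * pi)" using r by (subst ennreal_mult''[symmetric]) auto
  also have "\<dots> = ennreal (H\<^sup>2 * r * (2 * pi) / (2 * pi))" using r by (intro divide_ennreal) auto
  finally show ?thesis by simp
qed

section \<open>The price of superefficiency\<close>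

lemma attains_rate_risk_bound:
  assumes "attains_rate \<mu> \<sigma> C L x B \<gamma> G"
  obtains M where "M > 0"
    "\<forall>\<^sub>F n in sequentially. \<forall>\<beta>\<in>B n. \<gamma> n \<beta> > 0 \<longrightarrow>
      (\<forall>f\<in>smooth_class C L \<beta>. risk \<mu> \<sigma> x G n f \<le> ennreal ((M * \<gamma> n \<beta>)\<^sup>2))"
proof -
  let ?S = "\<lambda>n. SUP \<beta>\<in>B n. SUP f\<in>smooth_class C L \<beta>. ennreal (1 / (\<gamma> n \<beta>)\<^sup>2) * risk \<mu> \<sigma> x G n f"
  have "limsup ?S < \<infinity>" using assms by (simp add: attains_rate_def)
  then obtain N where N: "limsup ?S < N" "N < (\<infinity> :: ennreal)" using dense by blast
  then obtain r where r: "N = ennreal r" "r \<ge> 0" by (cases N) auto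
  \<comment> \<open>the summand one only makes \<open>M\<close> positive\<close>
  define M where "M = sqrt r + 1"
  have sr: "0 \<le> sqrt r" "sqrt r * sqrt r = r" using r by simp_all
  then have M: "M > 0" "r \<le> M\<^sup>2"
    unfolding M_def power2_eq_square distrib_left distrib_right by linarith+
  have "\<forall>\<^sub>F n in sequentially. ?S n < ennreal r" using Limsup_lessD[OF N(1)] r by simp
  then have "\<forall>\<^sub>F n in sequentially. \<forall>\<beta>\<in>B n. \<gamma> n \<beta> > 0 \<longrightarrow>
      (\<forall>f\<in>smooth_class C L \<beta>. risk \<mu> \<sigma> x G n f \<le> ennreal ((M * \<gamma> n \<beta>)\<^sup>2))"
  proof eventually_elim
    case (elim n)
    show ?case
    proof (intro ballI impI)
      fix \<beta> f assume \<beta>: "\<beta> \<in> B n" and g: "\<gamma> n \<beta> > 0" and f: "f \<in> smooth_class C L \<beta>"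
      let ?R = "risk \<mu> \<sigma> x G n f"
      have "ennreal (1 / (\<gamma> n \<beta>)\<^sup>2) * ?R \<le> ?S n"
        by (rule SUP_upper2[OF \<beta>], rule SUP_upper2[OF f]) simp
      then have le: "ennreal (1 / (\<gamma> n \<beta>)\<^sup>2) * ?R \<le> ennreal r" using elim by simp
      have "?R = ennreal ((\<gamma> n \<beta>)\<^sup>2 * (1 / (\<gamma> n \<beta>)\<^sup>2)) * ?R" using g by simp
      also have "\<dots> = ennreal ((\<gamma> n \<beta>)\<^sup>2) * (ennreal (1 / (\<gamma> n \<beta>)\<^sup>2) * ?R)"
        by (subst ennreal_mult') (simp_all add: mult.assoc)
      also have "\<dots> \<le> ennreal ((\<gamma> n \<beta>)\<^sup>2) * ennreal r" using le by (rule mult_left_mono) simp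
      also have "\<dots> = ennreal ((\<gamma> n \<beta>)\<^sup>2 * r)" by (rule ennreal_mult'[symmetric]) simp
      also have "\<dots> \<le> ennreal ((M * \<gamma> n \<beta>)\<^sup>2)"
        using M(2) by (intro ennreal_leI) (simp add: power_mult_distrib mult.commute mult_right_mono)
      finally show "?R \<le> ennreal ((M * \<gamma> n \<beta>)\<^sup>2)" .
    qed
  qed
  with M(1) that show ?thesis by blast
qed

lemma zero_in_smooth_class: "C > 0 \<Longrightarrow> L > 0 \<Longrightarrow> (\<lambda>_. 0) \<in> smooth_class C L \<beta>"
  by (simp add: smooth_class_def sobolev_ball_def bounded_class_def fourier_def)

text \<open>The two hypotheses are zero and a bump of width \<open>h\<close> at \<open>x\<close>.\<close>

lemma risk_trade_off:
  fixes \<mu> \<sigma> C L \<beta> :: real and x :: "real ^ 2"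
  assumes \<sigma>: "\<sigma> > 0" and C: "C > 0" and L: "L > 0" and x: "norm x < 1" and \<beta>: "\<beta> > 1"
  obtains a c h\<^sub>0 :: real where "a > 0" "c > 0" "h\<^sub>0 > 0"
    "\<And>h n G r0 r1. 0 < h \<Longrightarrow> h \<le> h\<^sub>0 \<Longrightarrow> adaptive_estimator G \<Longrightarrow> 0 \<le> r0 \<Longrightarrow> 0 \<le> r1 \<Longrightarrow>
      risk \<mu> \<sigma> x G n (\<lambda>_. 0) \<le> ennreal (r0\<^sup>2) \<Longrightarrow>
      (\<And>f. f \<in> smooth_class C L \<beta> \<Longrightarrow> risk \<mu> \<sigma> x G n f \<le> ennreal (r1\<^sup>2)) \<Longrightarrow>
      a * h powr (\<beta> - 1) \<le> r0 * exp (c * real n * h powr (2 * \<beta> + 1)) + r1"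
proof -
  obtain a h\<^sub>1 D :: real and f :: "real \<Rightarrow> real ^ 2 \<Rightarrow> real" where a: "a > 0" and h1: "h\<^sub>1 > 0" and D: "D \<ge> 0"
    and f: "\<And>h. 0 < h \<Longrightarrow> h \<le> h\<^sub>1 \<Longrightarrow> f h \<in> smooth_class C L \<beta> \<and> f h x = a * h powr (\<beta> - 1)"
    and T: "\<And>h \<theta> s. 0 < h \<Longrightarrow> h \<le> h\<^sub>1 \<Longrightarrow> norm \<theta> = 1 \<Longrightarrow>
      \<bar>exp_radon \<mu> (f h) \<theta> s\<bar> \<le> D * h powr \<beta> * indicator {-2 * h..2 * h} (s - x \<bullet> \<theta>)"
    using bump_family[OF C L x \<beta>, of \<mu>] by blast
  \<comment> \<open>makes the Radon transform of the bump at most \<open>\<sigma>\<close>, where the second moment of the likelihood ratio is controlled linearly\<close>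
  define h\<^sub>0 where "h\<^sub>0 = min h\<^sub>1 (min 1 (\<sigma> / (D + 1)))"
  define c where "c = 2 * D\<^sup>2 / \<sigma>\<^sup>2 + 1"
  show ?thesis
  proof
    show "a > 0" by (rule a)
    show "c > 0" by (simp add: c_def add_nonneg_pos)
    show "h\<^sub>0 > 0" using h1 \<sigma> D by (simp add: h\<^sub>0_def)
    fix h n G r0 r1
    assume h: "0 < h" "h \<le> h\<^sub>0" and G: "adaptive_estimator G" and r: "0 \<le> r0" "0 \<le> r1"
      and R0: "risk \<mu> \<sigma> x G n (\<lambda>_. 0) \<le> ennreal (r0\<^sup>2)"
      and R1: "\<And>f. f \<in> smooth_class C L \<beta> \<Longrightarrow> risk \<mu> \<sigma> x G n f \<le> ennreal (r1\<^sup>2)"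
    have hh: "h \<le> h\<^sub>1" "h \<le> 1" "h \<le> \<sigma> / (D + 1)" using h(2) by (auto simp: h\<^sub>0_def)
    note fh = f[OF h(1) hh(1)]
    have fm: "f h \<in> borel_measurable borel"
      using fh by (auto simp: smooth_class_def intro: borel_measurable_continuous_onI)
    let ?H = "D * h powr \<beta>"
    have H0: "?H \<ge> 0" using D by simp
    have HT: "\<bar>exp_radon \<mu> (f h) \<theta> s\<bar> \<le> ?H * indicator {-(2 * h)..2 * h} (s - x \<bullet> \<theta>)" if "norm \<theta> = 1" for \<theta> s
      using T[OF h(1) hh(1) that, of s] by simp
    have "?H \<le> \<sigma>"
    proof -
      have "h powr \<beta> \<le> h powr 1" using h hh \<beta> by (intro powr_mono') auto
      then have "?H \<le> D * h" using h D by (simp add: mult_left_mono)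
      also have "\<dots> \<le> D * (\<sigma> / (D + 1))" using hh D by (intro mult_left_mono) auto
      also have "\<dots> \<le> \<sigma>" using D \<sigma> by (simp add: field_simps)
      finally show ?thesis .
    qed
    then have Hs: "(exp_radon \<mu> (f h) \<theta> s)\<^sup>2 \<le> \<sigma>\<^sup>2" if "norm \<theta> = 1" for \<theta> s
    proof -
      have "?H * indicator {-(2 * h)..2 * h} (s - x \<bullet> \<theta>) \<le> ?H * 1" using H0 by (intro mult_left_mono) (auto simp: indicator_def)
      then have "\<bar>exp_radon \<mu> (f h) \<theta> s\<bar> \<le> \<sigma>" using HT[OF that, of s] \<open>?H \<le> \<sigma>\<close> by linarith
      then have "\<bar>exp_radon \<mu> (f h) \<theta> s\<bar>\<^sup>2 \<le> \<sigma>\<^sup>2" by (intro power_mono) auto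
      then show ?thesis by simp
    qed
    have V: "(\<integral>\<^sup>+ z. ennreal ((exp_radon \<mu> (f h) (fst z) (snd z))\<^sup>2) \<partial>design_law) \<le> ennreal (?H\<^sup>2 * (2 * h))"
      using h by (intro design_second_moment_local[OF fm H0 _ HT]) auto
    have Hp: "?H\<^sup>2 * (2 * h) = 2 * D\<^sup>2 * h powr (2 * \<beta> + 1)"
    proof -
      have "(h powr \<beta>)\<^sup>2 = h powr (2 * \<beta>)" using h by (simp add: powr_power mult.commute)
      then show ?thesis using h powr_add[of h "2 * \<beta>" 1] by (simp add: power_mult_distrib)
    qed
    define I where "I = exp (c * real n * h powr (2 * \<beta> + 1))"
    have P: "(\<integral>\<^sup>+ d. (\<Prod>i\<in>{1..n}. ennreal (likelihood_ratio \<mu> \<sigma> (f h) (d i)))\<^sup>2 \<partial>data_law \<mu> \<sigma> n (\<lambda>_. 0)) \<le> ennreal (I\<^sup>2)"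
    proof -
      have "(\<integral>\<^sup>+ d. (\<Prod>i\<in>{1..n}. ennreal (likelihood_ratio \<mu> \<sigma> (f h) (d i)))\<^sup>2 \<partial>data_law \<mu> \<sigma> n (\<lambda>_. 0)) \<le>
          ennreal (exp (2 * real n * (?H\<^sup>2 * (2 * h)) / \<sigma>\<^sup>2))"
        using h by (intro likelihood_ratio_second_moment[OF fm \<sigma> Hs V]) auto
      also have "\<dots> \<le> ennreal (I\<^sup>2)"
      proof (rule ennreal_leI)
        have "2 * real n * (?H\<^sup>2 * (2 * h)) / \<sigma>\<^sup>2 = 2 * ((2 * D\<^sup>2 / \<sigma>\<^sup>2) * (real n * h powr (2 * \<beta> + 1)))"
          unfolding Hp by simp
        also have "\<dots> \<le> 2 * (c * (real n * h powr (2 * \<beta> + 1)))"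
          by (intro mult_left_mono mult_right_mono) (auto simp: c_def)
        also have "exp \<dots> = I\<^sup>2" by (simp add: I_def exp_double mult.assoc)
        finally show "exp (2 * real n * (?H\<^sup>2 * (2 * h)) / \<sigma>\<^sup>2) \<le> I\<^sup>2" by simp
      qed
      finally show ?thesis .
    qed
    have "a * h powr (\<beta> - 1) \<le> r0 * I + r1"
    proof (rule two_point_inequality[OF fm \<sigma>, where F="\<lambda>d. G n d x"])
      show "(\<lambda>d. G n d x) \<in> borel_measurable (\<Pi>\<^sub>M i\<in>{1..n}. (borel :: observation measure))"
        using G by (simp add: adaptive_estimator_def)
      show "(\<integral>\<^sup>+ d. ennreal ((G n d x)\<^sup>2) \<partial>data_law \<mu> \<sigma> n (\<lambda>_. 0)) \<le> ennreal (r0\<^sup>2)"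
        using R0 by (simp add: risk_def)
      show "(\<integral>\<^sup>+ d. ennreal ((G n d x - a * h powr (\<beta> - 1))\<^sup>2) \<partial>data_law \<mu> \<sigma> n (f h)) \<le> ennreal (r1\<^sup>2)"
        using R1[of "f h"] fh by (simp add: risk_def)
      show "0 \<le> I" by (simp add: I_def)
    qed (use r P a in auto)
    then show "a * h powr (\<beta> - 1) \<le> r0 * exp (c * real n * h powr (2 * \<beta> + 1)) + r1" by (simp add: I_def)
  qed
qed

text \<open>The trade-off is used twice on the class of exponent \<open>\<beta>\<close>. At width \<open>n powr (- 1 / (2 * \<beta> + 1))\<close>, with the risk of the class
\<open>\<beta>\<close> itself as risk at zero, it bounds \<open>\<gamma> n \<beta>\<close> below by the minimax rate. At a width larger by a power of the logarithm, with
the risk of the class \<open>\<beta>'\<close> at zero, it bounds \<open>\<gamma> n \<beta>'\<close> below by \<open>\<psi> n \<beta> * n powr (- \<delta>)\<close>. In the product of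
the two quotients \<open>\<psi> n \<beta>\<close> cancels, and what remains grows like \<open>n powr \<delta>\<close> up to logarithms.\<close>

lemma superefficiency_cost:
  fixes \<mu> \<sigma> C L \<beta> \<beta>' :: real and x :: "real ^ 2" and B :: "nat \<Rightarrow> real set"
  defines "\<psi> \<equiv> \<lambda>n \<beta>. (ln (real n) / real n) powr ((\<beta> - 1) / (2 * \<beta> + 1))"
  assumes \<sigma>: "\<sigma> > 0" and C: "C > 0" and L: "L > 0" and x: "norm x < 1" and \<beta>: "1 < \<beta>" "\<beta> < \<beta>'"
    and B: "\<forall>\<^sub>F n in sequentially. \<beta> \<in> B n \<and> \<beta>' \<in> B n"
    and G: "adaptive_estimator G" "attains_rate \<mu> \<sigma> C L x B \<gamma> G" and pos: "positive_rate B \<gamma>"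
    and faster: "(\<lambda>n. \<gamma> n \<beta> / \<psi> n \<beta>) \<longlonglongrightarrow> 0"
  shows "filterlim (\<lambda>n. (\<gamma> n \<beta> / \<psi> n \<beta>) * (\<gamma> n \<beta>' / \<psi> n \<beta>')) at_top sequentially"
proof -
  obtain a c h\<^sub>0 :: real where a: "a > 0" and c: "c > 0" and h0: "h\<^sub>0 > 0"
    and trade: "\<And>h n G r0 r1. 0 < h \<Longrightarrow> h \<le> h\<^sub>0 \<Longrightarrow> adaptive_estimator G \<Longrightarrow> 0 \<le> r0 \<Longrightarrow> 0 \<le> r1 \<Longrightarrow>
      risk \<mu> \<sigma> x G n (\<lambda>_. 0) \<le> ennreal (r0\<^sup>2) \<Longrightarrow>
      (\<And>f. f \<in> smooth_class C L \<beta> \<Longrightarrow> risk \<mu> \<sigma> x G n f \<le> ennreal (r1\<^sup>2)) \<Longrightarrow>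
      a * h powr (\<beta> - 1) \<le> r0 * exp (c * real n * h powr (2 * \<beta> + 1)) + r1"
    using risk_trade_off[OF \<sigma> C L x \<beta>(1), of \<mu>] by blast
  obtain M where M: "M > 0" and Mrisk: "\<forall>\<^sub>F n in sequentially. \<forall>\<beta>\<in>B n. \<gamma> n \<beta> > 0 \<longrightarrow>
      (\<forall>f\<in>smooth_class C L \<beta>. risk \<mu> \<sigma> x G n f \<le> ennreal ((M * \<gamma> n \<beta>)\<^sup>2))"
    using attains_rate_risk_bound[OF G(2)] by blast
  define e where "e = (\<beta> - 1) / (2 * \<beta> + 1)"
  define e' where "e' = (\<beta>' - 1) / (2 * \<beta>' + 1)"
  \<comment> \<open>half the difference of the rate exponents is spent on the likelihood ratio, the other half remains as the growth of the product\<close>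
  define \<delta> where "\<delta> = (e' - e) / 2"
  \<comment> \<open>makes \<open>exp (c * n * h powr (2 * \<beta> + 1)) = n powr \<delta>\<close> for \<open>h powr (2 * \<beta> + 1) = \<kappa> * ln n / n\<close>\<close>
  define \<kappa> where "\<kappa> = \<delta> / c"
  have ee: "e < e'" "0 < e"
    using \<beta> by (auto simp: e_def e'_def field_simps)
  have d: "\<delta> > 0" and k: "\<kappa> > 0" using ee c by (auto simp: \<delta>_def \<kappa>_def)
  let ?t = "1 / (2 * \<beta> + 1)"
  have tp: "?t > 0" using \<beta> by simp
  have te: "(y powr ?t) powr (\<beta> - 1) = y powr e" "y > 0 \<Longrightarrow> (y powr ?t) powr (2 * \<beta> + 1) = y" for y :: real
    using \<beta> by (simp_all add: powr_powr e_def)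
  have lim1: "(\<lambda>n. (1 / real n) powr ?t) \<longlonglongrightarrow> 0" using tp by real_asymp
  have lim2: "(\<lambda>n. (\<kappa> * ln (real n) / real n) powr ?t) \<longlonglongrightarrow> 0" using tp k by real_asymp
  have small1: "\<forall>\<^sub>F n in sequentially. (1 / real n) powr ?t < h\<^sub>0" using lim1 h0 by (rule order_tendstoD)
  have small2: "\<forall>\<^sub>F n in sequentially. (\<kappa> * ln (real n) / real n) powr ?t < h\<^sub>0" using lim2 h0 by (rule order_tendstoD)
  \<comment> \<open>half the height of the bump at the larger width, in units of \<open>M * \<psi> n \<beta>\<close>\<close>
  define b where "b = a * \<kappa> powr e / (2 * M)"
  have b: "b > 0" using a k M by (simp add: b_def)
  have fast: "\<forall>\<^sub>F n in sequentially. \<gamma> n \<beta> / \<psi> n \<beta> < b" using faster b by (rule order_tendstoD)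
  define K where "K = a / (M * (exp c + 1)) * b"
  have K: "K > 0" using a b M by (simp add: K_def add_pos_pos)
  have lower: "\<forall>\<^sub>F n in sequentially. K * (real n powr \<delta> / ln (real n) powr e') \<le>
      (\<gamma> n \<beta> / \<psi> n \<beta>) * (\<gamma> n \<beta>' / \<psi> n \<beta>')"
    using B Mrisk pos[unfolded positive_rate_def] small1 small2 fast eventually_ge_at_top[of 3]
  proof eventually_elim
    case (elim n)
    let ?n = "real n"
    have n: "?n > 0" and lnn: "ln ?n > 0" using elim(7) by auto
    have q: "ln ?n / ?n > 0" using n lnn by simp
    have g: "\<gamma> n \<beta> > 0" "\<gamma> n \<beta>' > 0" using elim(1,3) by auto
    have p: "\<psi> n \<beta> > 0" "\<psi> n \<beta>' > 0" using q n by (auto simp: \<psi>_def)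
    have R: "risk \<mu> \<sigma> x G n f \<le> ennreal ((M * \<gamma> n \<beta>)\<^sup>2)" if "f \<in> smooth_class C L \<beta>" for f
      using elim(1,2) g that by blast
    have R': "risk \<mu> \<sigma> x G n (\<lambda>_. 0) \<le> ennreal ((M * \<gamma> n \<beta>')\<^sup>2)"
      using elim(1,2) g zero_in_smooth_class[OF C L, of \<beta>'] by blast
    have M0: "0 \<le> M * \<gamma> n \<beta>" "0 \<le> M * \<gamma> n \<beta>'" using M g by auto
    have "a * ((1 / ?n) powr ?t) powr (\<beta> - 1) \<le>
        M * \<gamma> n \<beta> * exp (c * ?n * ((1 / ?n) powr ?t) powr (2 * \<beta> + 1)) + M * \<gamma> n \<beta>"
      using n elim(4)
      by (intro trade[OF _ _ G(1) M0(1) M0(1) R[OF zero_in_smooth_class[OF C L]] R]) auto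
    also have "((1 / ?n) powr ?t) powr (\<beta> - 1) = (1 / ?n) powr e" by (rule te(1))
    also have "((1 / ?n) powr ?t) powr (2 * \<beta> + 1) = 1 / ?n" using n by (intro te(2)) simp
    also have "M * \<gamma> n \<beta> * exp (c * ?n * (1 / ?n)) + M * \<gamma> n \<beta> = \<gamma> n \<beta> * (M * (exp c + 1))"
      using n by (simp add: algebra_simps)
    finally have first: "a / (M * (exp c + 1)) * (1 / ?n) powr e \<le> \<gamma> n \<beta>"
      using M by (simp add: divide_le_eq add_pos_pos mult_pos_pos)
    let ?y = "\<kappa> * ln ?n / ?n"
    have y: "?y > 0" using k lnn n by simp
    have "a * (?y powr ?t) powr (\<beta> - 1) \<le>
        M * \<gamma> n \<beta>' * exp (c * ?n * (?y powr ?t) powr (2 * \<beta> + 1)) + M * \<gamma> n \<beta>"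
      using y n elim(5) by (intro trade[OF _ _ G(1) M0(2) M0(1) R' R]) auto
    also have "(?y powr ?t) powr (\<beta> - 1) = ?y powr e" by (rule te(1))
    also have "(?y powr ?t) powr (2 * \<beta> + 1) = ?y" using y by (intro te(2)) simp
    also have "c * ?n * ?y = \<delta> * ln ?n" using n c by (simp add: \<kappa>_def)
    also have "exp (\<delta> * ln ?n) = ?n powr \<delta>" using n by (simp add: powr_def)
    also have "?y powr e = \<kappa> powr e * \<psi> n \<beta>"
      using powr_mult[of \<kappa> "ln ?n / ?n" e] by (simp add: \<psi>_def e_def)
    finally have sec: "a * (\<kappa> powr e * \<psi> n \<beta>) \<le> M * \<gamma> n \<beta>' * ?n powr \<delta> + M * \<gamma> n \<beta>" .
    have ab: "a * \<kappa> powr e = 2 * M * b" using M by (simp add: b_def)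
    have "\<gamma> n \<beta> < b * \<psi> n \<beta>" using elim(6) p by (simp add: divide_less_eq)
    then have "M * \<gamma> n \<beta> \<le> M * (b * \<psi> n \<beta>)" using M by simp
    moreover have "a * (\<kappa> powr e * \<psi> n \<beta>) = 2 * (M * (b * \<psi> n \<beta>))"
      using ab by (metis mult.assoc)
    ultimately have "M * (b * \<psi> n \<beta>) \<le> M * (\<gamma> n \<beta>' * ?n powr \<delta>)"
      using sec unfolding mult.assoc by linarith
    then have second: "b * \<psi> n \<beta> \<le> \<gamma> n \<beta>' * ?n powr \<delta>" using M by simp
    have "(a / (M * (exp c + 1)) * (1 / ?n) powr e) * (b * \<psi> n \<beta>) \<le> \<gamma> n \<beta> * (\<gamma> n \<beta>' * ?n powr \<delta>)"
      by (rule mult_mono[OF first second]) (use g b p in auto)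
    then have main: "K * (1 / ?n) powr e * \<psi> n \<beta> \<le> \<gamma> n \<beta> * \<gamma> n \<beta>' * ?n powr \<delta>"
      by (simp add: K_def mult_ac)
    have psi': "\<psi> n \<beta>' = ln ?n powr e' / ?n powr e'"
      using n lnn by (simp add: \<psi>_def e'_def powr_divide)
    have pw: "?n powr \<delta> / ln ?n powr e' * \<psi> n \<beta>' = (1 / ?n) powr e / ?n powr \<delta>"
    proof -
      have "?n powr \<delta> / ln ?n powr e' * \<psi> n \<beta>' = ?n powr (\<delta> - e')"
        using lnn by (simp add: psi' powr_diff)
      also have "\<delta> - e' = (0 - e) - \<delta>" by (simp add: \<delta>_def field_simps)
      also have "?n powr ((0 - e) - \<delta>) = (1 / ?n) powr e / ?n powr \<delta>"
        using n by (simp only: powr_diff powr_divide) simp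
      finally show ?thesis .
    qed
    have "K * (?n powr \<delta> / ln ?n powr e') * (\<psi> n \<beta> * \<psi> n \<beta>') =
        K * \<psi> n \<beta> * (?n powr \<delta> / ln ?n powr e' * \<psi> n \<beta>')"
      by (simp only: mult_ac)
    also have "\<dots> = (K * (1 / ?n) powr e * \<psi> n \<beta>) / ?n powr \<delta>"
      unfolding pw by simp
    also have "\<dots> \<le> \<gamma> n \<beta> * \<gamma> n \<beta>'"
      using main n by (simp add: divide_le_eq)
    finally have "K * (?n powr \<delta> / ln ?n powr e') \<le> (\<gamma> n \<beta> * \<gamma> n \<beta>') / (\<psi> n \<beta> * \<psi> n \<beta>')"
      using p by (simp only: le_divide_eq mult_pos_pos if_True)
    then show "K * (?n powr \<delta> / ln ?n powr e') \<le> (\<gamma> n \<beta> / \<psi> n \<beta>) * (\<gamma> n \<beta>' / \<psi> n \<beta>')"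
      by (simp only: times_divide_times_eq)
  qed
  have "filterlim (\<lambda>n. K * (real n powr \<delta> / ln (real n) powr e')) at_top sequentially"
    using K d by real_asymp
  then show ?thesis using lower by (rule filterlim_at_top_mono)
qed

theorem theorem4:
  fixes \<mu> \<sigma> C L :: real and x :: "real ^ 2"
    and b :: "nat \<Rightarrow> real" and N :: "nat \<Rightarrow> nat" and B :: "nat \<Rightarrow> real set"
  assumes "\<sigma> > 0" and "C > 0" and "L > 0" and "norm x < 1"
    and "strict_mono_on {1..} b" and "b 1 > 1"
    and "\<And>n. n \<ge> 1 \<Longrightarrow> N n \<ge> 1" and "filterlim (\<lambda>n. b (N n)) at_top sequentially"
    and "\<And>n. B n = b ` {1..N n}"
  shows "\<not> (\<exists>F. adaptive_estimator F \<and>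
              attains_rate \<mu> \<sigma> C L x B
                (\<lambda>n \<beta>. real n powr (- ((\<beta> - 1) / (2 * \<beta> + 1)))) F) \<and>
         ARC \<mu> \<sigma> C L x B
           (\<lambda>n \<beta>. (ln (real n) / real n) powr ((\<beta> - 1) / (2 * \<beta> + 1)))"
proof -
  note \<sigma> = assms(1) and C = assms(2) and L = assms(3) and x = assms(4) and mono = assms(5) and B = assms(9)
  let ?\<psi> = "\<lambda>n \<beta>. (ln (real n) / real n) powr ((\<beta> - 1) / (2 * \<beta> + 1))"
  let ?\<phi> = "\<lambda>n \<beta>. real n powr (- ((\<beta> - 1) / (2 * \<beta> + 1)))"
  have less: "b i < b j" if "1 \<le> i" "i < j" for i j
    using mono that by (auto simp: strict_mono_on_def)
  have b1: "b 1 \<le> b k" if "1 \<le> k" for k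
    using less[of 1 k] that by (cases "k = 1") auto
  have evB: "\<forall>\<^sub>F n in sequentially. b k \<in> B n" if k: "1 \<le> k" for k
  proof -
    have "\<forall>\<^sub>F n in sequentially. b k \<le> b (N n)"
      using assms(8) by (simp add: filterlim_at_top)
    with eventually_ge_at_top[of 1] show ?thesis
    proof eventually_elim
      case (elim n)
      then have "N n \<ge> 1" by (intro assms(7))
      then have "k \<le> N n" using less[of "N n" k] elim(2) by (meson not_le)
      then show ?case using k by (simp add: B)
    qed
  qed
  have pos_psi: "positive_rate B ?\<psi>"
    unfolding positive_rate_def using eventually_ge_at_top[of 2] by eventually_elim auto
  have cost: "filterlim (\<lambda>n. (\<gamma> n (b k) / ?\<psi> n (b k)) * (\<gamma> n (b (Suc k)) / ?\<psi> n (b (Suc k)))) at_top sequentially"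
    if "adaptive_estimator G" "attains_rate \<mu> \<sigma> C L x B \<gamma> G" "positive_rate B \<gamma>" "1 \<le> k"
      "(\<lambda>n. \<gamma> n (b k) / ?\<psi> n (b k)) \<longlonglongrightarrow> 0" for \<gamma> G k
  proof (rule superefficiency_cost[OF \<sigma> C L x _ _ _ that(1,2,3,5)])
    show "1 < b k" using b1[OF that(4)] assms(6) by linarith
    show "b k < b (Suc k)" using that(4) by (intro less) auto
    show "\<forall>\<^sub>F n in sequentially. b k \<in> B n \<and> b (Suc k) \<in> B n"
      using evB that(4) by (intro eventually_conj) auto
  qed
  have "\<not> (\<exists>F. adaptive_estimator F \<and> attains_rate \<mu> \<sigma> C L x B ?\<phi> F)"
  proof
    assume "\<exists>F. adaptive_estimator F \<and> attains_rate \<mu> \<sigma> C L x B ?\<phi> F"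
    then obtain F where F: "adaptive_estimator F" "attains_rate \<mu> \<sigma> C L x B ?\<phi> F" by blast
    have pos_phi: "positive_rate B ?\<phi>"
      unfolding positive_rate_def using eventually_ge_at_top[of 1] by eventually_elim auto
    have gt1: "b 1 > 1" "b (Suc 1) > 1" using b1[of "Suc 1"] assms(6) by auto
    have quot: "(\<lambda>n. ?\<phi> n \<beta> / ?\<psi> n \<beta>) \<longlonglongrightarrow> 0" if "\<beta> > 1" for \<beta> :: real
    proof -
      define e where "e = (\<beta> - 1) / (2 * \<beta> + 1)"
      have "e > 0" using that by (simp add: e_def)
      then have "(\<lambda>n. real n powr (- e) / (ln (real n) / real n) powr e) \<longlonglongrightarrow> 0" by real_asymp
      then show ?thesis by (simp add: e_def)
    qed
    have "(\<lambda>n. (?\<phi> n (b 1) / ?\<psi> n (b 1)) * (?\<phi> n (b (Suc 1)) / ?\<psi> n (b (Suc 1)))) \<longlonglongrightarrow> 0 * 0"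
      by (intro tendsto_mult quot gt1)
    moreover have "filterlim (\<lambda>n. (?\<phi> n (b 1) / ?\<psi> n (b 1)) * (?\<phi> n (b (Suc 1)) / ?\<psi> n (b (Suc 1)))) at_top sequentially"
      by (rule cost[OF F pos_phi _ quot[OF gt1(1)]]) simp
    ultimately show False
      using not_tendsto_and_filterlim_at_infinity[OF sequentially_bot] filterlim_at_top_imp_at_infinity by blast
  qed
  moreover have "ARC \<mu> \<sigma> C L x B ?\<psi>"
    unfolding ARC_def
  proof (intro conjI allI impI ballI)
    show "positive_rate B ?\<psi>" by (rule pos_psi)
    show "\<exists>F. adaptive_estimator F \<and> attains_rate \<mu> \<sigma> C L x B ?\<psi> F"
      by (rule adaptive_upper_bound[OF \<sigma> C _ assms(6)]) (use x b1 in \<open>auto simp: B\<close>)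
    fix \<gamma> G \<beta>
    assume G: "positive_rate B \<gamma> \<and> adaptive_estimator G \<and> attains_rate \<mu> \<sigma> C L x B \<gamma> G"
      and "\<beta> \<in> (\<Union>n. B n)" and q: "(\<lambda>n. \<gamma> n \<beta> / ?\<psi> n \<beta>) \<longlonglongrightarrow> 0"
    then obtain k where k: "1 \<le> k" "\<beta> = b k" by (auto simp: B)
    obtain n where "b (Suc k) \<in> B n"
      using eventually_happens[OF evB[of "Suc k"]] by auto
    then show "\<exists>\<beta>''\<in>(\<Union>n. B n). filterlim (\<lambda>n. (\<gamma> n \<beta> / ?\<psi> n \<beta>) * (\<gamma> n \<beta>'' / ?\<psi> n \<beta>'')) at_top sequentially"
      using cost[of G \<gamma> k] G k q by blast
  qed
  ultimately show ?thesis by blast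
qed

end
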